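(* Let $S=\mathbf{k}[x_1,\dots,x_n]$ over a field $\mathbf{k}$ and let $I\subset S$ be a quadratic monomial ideal of codimension $c$. Then $$e(S/I)\le\frac1{c!}\prod_{i=1}^c\tilde M_i(S/I).$$ If moreover $S/I$ is Cohen-Macaulay, then $$e(S/I)\ge\frac1{c!}\prod_{i=1}^c\tilde m_i(S/I).$$ (That is, all quadratic monomial ideals satisfy the Taylor upper bound conjecture, and all Cohen-Macaulay quadratic monomial ideals satisfy the Taylor lower bound conjecture.)
   Context: $S$ is standard graded, $e(S/I)$ is the multiplicity of $S/I$. A quadratic monomial ideal is one all of whose minimal monomial generators have degree $2$. $\mathrm{GEN}(I)$ is the set of minimal monomial generators of $I$, and $\tilde m_i(S/I)=\min\{\deg\operatorname{lcm}(T):T\subset\mathrm{GEN}(I),|T|=i\}$, $\tilde M_i(S/I)=\max\{\deg\operatorname{lcm}(T):T\subset\mathrm{GEN}(I),|T|=i\}$ are the minimal and maximal shifts of the Taylor resolution of $S/I$. *)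

theory Defs
  imports
    "HOL-Algebra.Algebra"
    "HOL-Algebra.Algebraic_Closure_Type"
    "HOL-Library.Poly_Mapping"
    "HOL-Library.Extended_Nat"
    "HOL-Computational_Algebra.Polynomial"
begin

section \<open>Commutative rings\<close>

text \<open>
  A chain of \<open>r + 1\<close> primes has length \<open>r\<close>.  Dimension, height and depth take values in
  \<^typ>\<open>enat\<close>, so that they are suprema also when these are infinite; the supremum over no chain
  at all is \<open>0\<close>.
\<close>

definition prime_chain :: "('a, 'b) ring_scheme \<Rightarrow> 'a set list \<Rightarrow> bool" where
  "prime_chain R Ps \<longleftrightarrow>
     Ps \<noteq> [] \<and> (\<forall>P\<in>set Ps. primeideal P R) \<and> sorted_wrt (\<subset>) Ps"

definition krull_dim :: "('a, 'b) ring_scheme \<Rightarrow> enat" where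
  "krull_dim R = (SUP Ps \<in> {Ps. prime_chain R Ps}. enat (length Ps - 1))"

definition prime_height :: "('a, 'b) ring_scheme \<Rightarrow> 'a set \<Rightarrow> enat" where
  "prime_height R P = (SUP Ps \<in> {Ps. prime_chain R Ps \<and> last Ps = P}. enat (length Ps - 1))"

definition codim :: "('a, 'b) ring_scheme \<Rightarrow> 'a set \<Rightarrow> enat" where
  "codim R I = (INF P \<in> {P. primeideal P R \<and> I \<subseteq> P}. prime_height R P)"

definition regular_sequence :: "('a, 'b) ring_scheme \<Rightarrow> 'a list \<Rightarrow> bool" where
  "regular_sequence R fs \<longleftrightarrow>
     set fs \<subseteq> carrier R \<and>
     (\<forall>i<length fs. \<forall>g\<in>carrier R.
        fs ! i \<otimes>\<^bsub>R\<^esub> g \<in> Idl\<^bsub>R\<^esub> (set (take i fs)) \<longrightarrow> g \<in> Idl\<^bsub>R\<^esub> (set (take i fs))) \<and>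
     Idl\<^bsub>R\<^esub> (set fs) \<noteq> carrier R"

definition depth :: "('a, 'b) ring_scheme \<Rightarrow> 'a set \<Rightarrow> enat" where
  "depth R m = (SUP fs \<in> {fs. regular_sequence R fs \<and> set fs \<subseteq> m}. enat (length fs))"


section \<open>The polynomial ring and its graded quotients\<close>

text \<open>
  The variables are the elements of a finite type \<open>'v\<close>, so that \<open>n = CARD('v)\<close>.  A monomial is
  identified with its exponent vector.
\<close>

type_synonym 'v monomial = "'v \<Rightarrow>\<^sub>0 nat"
type_synonym ('v, 'k) mpoly = "'v monomial \<Rightarrow>\<^sub>0 'k"

abbreviation mpoly_ring :: "('v, 'k::field) mpoly ring" where
  "mpoly_ring \<equiv> ring_of_type_algebra"

definition monom_of :: "'v monomial \<Rightarrow> ('v, 'k::field) mpoly" where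
  "monom_of a = Poly_Mapping.single a 1"

definition mdeg :: "'v::finite monomial \<Rightarrow> nat" where
  "mdeg a = (\<Sum>v\<in>UNIV. Poly_Mapping.lookup a v)"

definition constants :: "('v, 'k::field) mpoly set" where
  "constants = range (Poly_Mapping.single 0)"

definition homogeneous_part :: "nat \<Rightarrow> ('v::finite, 'k::field) mpoly set" where
  "homogeneous_part i = {p. \<forall>a\<in>Poly_Mapping.keys p. mdeg a = i}"

definition irrelevant_ideal :: "('v, 'k::field) mpoly set" where
  "irrelevant_ideal = Idl\<^bsub>mpoly_ring\<^esub> (range (\<lambda>v. monom_of (Poly_Mapping.single v 1)))"

text \<open>The image in \<open>S/I\<close> of a subset of \<open>S\<close>.\<close>

definition image_mod :: "('v, 'k::field) mpoly set \<Rightarrow> ('v, 'k) mpoly set \<Rightarrow> ('v, 'k) mpoly set set" where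
  "image_mod I A = (\<lambda>p. I +>\<^bsub>mpoly_ring\<^esub> p) ` A"

text \<open>
  \<open>dim\<^sub>k\<close> of the image of \<open>A\<close> in \<open>S/I\<close>; for a proper ideal \<open>I\<close> the image of the constants
  is a copy of the field \<open>k\<close>.
\<close>

definition dim_mod :: "('v, 'k::field) mpoly set \<Rightarrow> ('v, 'k) mpoly set \<Rightarrow> nat" where
  "dim_mod I A =
     (ring.dim (mpoly_ring Quot I) over (image_mod I constants)) (image_mod I A)"

definition hilbert_function :: "('v::finite, 'k::field) mpoly set \<Rightarrow> nat \<Rightarrow> nat" where
  "hilbert_function I i = dim_mod I (homogeneous_part i)"

definition hilbert_poly :: "('v::finite, 'k::field) mpoly set \<Rightarrow> rat poly" where
  "hilbert_poly I =
     (THE P. \<forall>\<^sub>F i in sequentially. of_nat (hilbert_function I i) = poly P (of_nat i))"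

text \<open>
  For \<open>d = dim S/I > 0\<close> the Hilbert polynomial has leading term \<open>e/(d-1)! t\<^sup>d\<^sup>-\<^sup>1\<close>;
  for \<open>d = 0\<close> it vanishes, and the multiplicity is the length of \<open>S/I\<close>.
\<close>

definition multiplicity_quot :: "('v::finite, 'k::field) mpoly set \<Rightarrow> rat" where
  "multiplicity_quot I =
     (let d = the_enat (krull_dim (mpoly_ring Quot I)) in
      if d = 0 then of_nat (dim_mod I UNIV)
      else fact (d - 1) * lead_coeff (hilbert_poly I))"

text \<open>
  As usual for standard graded algebras, depth is taken with respect to the graded maximal ideal.
\<close>

definition cohen_macaulay_quot :: "('v, 'k::field) mpoly set \<Rightarrow> bool" where
  "cohen_macaulay_quot I \<longleftrightarrow>
     depth (mpoly_ring Quot I) (image_mod I irrelevant_ideal) = krull_dim (mpoly_ring Quot I)"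


section \<open>Monomial ideals and the shifts of the Taylor resolution\<close>

definition monomial_ideal :: "('v, 'k::field) mpoly set \<Rightarrow> bool" where
  "monomial_ideal I \<longleftrightarrow> (\<exists>A. I = Idl\<^bsub>mpoly_ring\<^esub> (monom_of ` A))"

text \<open>
  The minimal monomial generators are the monomials of \<open>I\<close> that are minimal with respect to
  divisibility, which is the componentwise order on exponents.
\<close>

definition GEN :: "('v, 'k::field) mpoly set \<Rightarrow> 'v monomial set" where
  "GEN I = {a. monom_of a \<in> I \<and>
     (\<forall>b. monom_of b \<in> I \<and> (\<forall>v. Poly_Mapping.lookup b v \<le> Poly_Mapping.lookup a v) \<longrightarrow> b = a)}"

definition quadratic_monomial_ideal :: "('v::finite, 'k::field) mpoly set \<Rightarrow> bool" where
  "quadratic_monomial_ideal I \<longleftrightarrow> monomial_ideal I \<and> (\<forall>a\<in>GEN I. mdeg a = 2)"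

definition lcm_monomial :: "'v::finite monomial set \<Rightarrow> 'v monomial" where
  "lcm_monomial T = Poly_Mapping.Abs_poly_mapping (\<lambda>v. SUP a\<in>T. Poly_Mapping.lookup a v)"

definition taylor_min_shift :: "('v::finite, 'k::field) mpoly set \<Rightarrow> nat \<Rightarrow> nat" where
  "taylor_min_shift I i = Min {mdeg (lcm_monomial T) | T. T \<subseteq> GEN I \<and> finite T \<and> card T = i}"

definition taylor_max_shift :: "('v::finite, 'k::field) mpoly set \<Rightarrow> nat \<Rightarrow> nat" where
  "taylor_max_shift I i = Max {mdeg (lcm_monomial T) | T. T \<subseteq> GEN I \<and> finite T \<and> card T = i}"

end

theory Submission
  imports Defs
begin

text \<open>
  Polarization turns the ideal into the edge ideal of a graph whose vertex cover number is the
  codimension \<open>c\<close>, whose minimum vertex covers are counted by the multiplicity, and in which the degree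
  of an lcm of \<open>i\<close> generators is the number of vertices touched by \<open>i\<close> edges.

  Upper bound: double counting pairs of a minimum cover and one of its vertices \<open>v\<close>, and deleting \<open>v\<close>,
  reduces the claim to showing that \<open>c\<close> edges can touch every vertex lying in some minimum cover; such
  edges come from Hall matchings between a fixed minimum cover and the others.

  Lower bound: a regular sequence of length \<open>d = dim S/I\<close> kills the Koszul cohomology of the squares of
  the variables below degree \<open>d\<close>, and reading this in suitable multidegrees gives Reisner's criterion
  for the independence complex.  Hence the minimum covers are connected by exchanges of a single vertex and
  no vertex lies in all of them.  Both properties pass to the connected components of the graph, so
  a component with cover number \<open>k\<close> has at least \<open>k + 1\<close> minimum covers, while \<open>i\<close> edges can be chosen to
  touch only \<open>i + r\<close> vertices as long as they fit into \<open>r\<close> components.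
\<close>

text \<open>Polarization is applied to the combinatorics only: Cohen-Macaulayness is never carried
  over to a polarized ring. Variables whose squares lie in \<open>I\<close> (called looped below)
  are treated inside \<open>S/I\<close>, through multidegrees that are 1 on a set of looped
  variables. Squares of the variables are used because they are the smallest powers that show links:
  in a multidegree with entry -1 at \<open>v\<close>, a cochain must live on sets containing
  \<open>v\<close> and has the variable \<open>v\<close> itself as a factor of its coefficient, so
  membership in \<open>I\<close> can see \<open>v\<close>. With first powers that factor would be 1.
  The obstacle in the lower bound is a graph with several components. Using all \<open>r\<close>
  components from the start gives \<open>min_span E i \<le> i + r\<close>, but the product of these
  bounds over all \<open>i\<close> is too large: two disjoint edges have 4 minimum covers, while 3 *
  4 / 2! = 6. Hence the components are split off one by one, smallest cover number first, and each
  is charged with the largest indices still present.\<close>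

abbreviation "lookup \<equiv> Poly_Mapping.lookup"
abbreviation "keys \<equiv> Poly_Mapping.keys"
abbreviation "single \<equiv> Poly_Mapping.single"

abbreviation coset :: "'a::comm_ring_1 set \<Rightarrow> 'a \<Rightarrow> 'a set" where
  "coset J p \<equiv> J +>\<^bsub>ring_of_type_algebra\<^esub> p"

section \<open>Minimum vertex covers: the upper bound\<close>

definition vertex_cover :: "'a set set \<Rightarrow> 'a set \<Rightarrow> bool" where
  "vertex_cover E C \<longleftrightarrow> (\<forall>e\<in>E. e \<inter> C \<noteq> {})"

definition covers_of_card :: "'a set set \<Rightarrow> nat \<Rightarrow> 'a set set" where
  "covers_of_card E c = {C. C \<subseteq> \<Union>E \<and> vertex_cover E C \<and> card C = c}"

definition edge_set :: "'a set set \<Rightarrow> bool" where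
  "edge_set E \<longleftrightarrow> finite E \<and> (\<forall>e\<in>E. card e = 2)"

text \<open>Minimality is tested against all finite sets, not only subsets of
  \<open>\<Union>E\<close>, so that sets built by exchange can be compared with \<open>c\<close>
  without trimming them first.\<close>

definition min_cover_number :: "'a set set \<Rightarrow> nat \<Rightarrow> bool" where
  "min_cover_number E c \<longleftrightarrow> covers_of_card E c \<noteq> {} \<and>
     (\<forall>C. finite C \<longrightarrow> vertex_cover E C \<longrightarrow> c \<le> card C)"

text \<open>On the polarized generators this is the minimal Taylor shift and \<open>max_span\<close>
  the maximal one, by \<open>taylor_shift_spans\<close>.\<close>

definition min_span :: "'a set set \<Rightarrow> nat \<Rightarrow> nat" where
  "min_span E i = Min {card (\<Union>T) | T. T \<subseteq> E \<and> card T = i}"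

definition max_span :: "'a set set \<Rightarrow> nat \<Rightarrow> nat" where
  "max_span E i = Max {card (\<Union>T) | T. T \<subseteq> E \<and> card T = i}"

section \<open>Edge sets and extremal sizes of unions of edges\<close>

lemma edge_setD:
  assumes "edge_set E"
  shows "finite E" "e \<in> E \<Longrightarrow> card e = 2" "e \<in> E \<Longrightarrow> finite e" "finite (\<Union>E)"
proof -
  show fE: "finite E" and *: "e \<in> E \<Longrightarrow> card e = 2" for e
    using assms by (auto simp: edge_set_def)
  show **: "e \<in> E \<Longrightarrow> finite e" for e
    using * by (metis card.infinite zero_neq_numeral)
  show "finite (\<Union>E)" using fE ** by auto
qed

lemma edge_set_subset: "edge_set E \<Longrightarrow> E' \<subseteq> E \<Longrightarrow> edge_set E'"
  by (auto simp: edge_set_def intro: finite_subset)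

lemma finite_spans:
  assumes "finite E"
  shows "finite {card (\<Union>T) | T. T \<subseteq> E \<and> card T = i}"
proof -
  have "{card (\<Union>T) | T. T \<subseteq> E \<and> card T = i} \<subseteq> (\<lambda>T. card (\<Union>T)) ` Pow E" by blast
  then show ?thesis using assms by (meson finite_Pow_iff finite_imageI finite_subset)
qed

lemma min_span_le:
  assumes "finite E" "T \<subseteq> E"
  shows "min_span E (card T) \<le> card (\<Union>T)"
  unfolding min_span_def using assms by (intro Min_le finite_spans) auto

lemma max_span_ge:
  assumes "finite E" "T \<subseteq> E"
  shows "card (\<Union>T) \<le> max_span E (card T)"
  unfolding max_span_def using assms by (intro Max_ge finite_spans) auto

text \<open>The bound on \<open>i\<close> keeps the smaller set of spans nonempty;
  \<open>Min\<close> of the empty set has no useful value.\<close>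

lemma min_span_mono:
  assumes "finite E" "E' \<subseteq> E" "i \<le> card E'"
  shows "min_span E i \<le> min_span E' i"
proof -
  have fin: "finite E'" using assms finite_subset by blast
  obtain T where "T \<subseteq> E'" "card T = i"
    by (rule obtain_subset_with_card_n[OF assms(3)]) auto
  then have "{card (\<Union>T) | T. T \<subseteq> E' \<and> card T = i} \<noteq> {}" by auto
  then show ?thesis
    unfolding min_span_def using assms by (intro Min_antimono finite_spans) auto
qed

lemma max_span_mono:
  assumes "finite E" "E' \<subseteq> E" "i \<le> card E'"
  shows "max_span E' i \<le> max_span E i"
proof -
  have fin: "finite E'" using assms finite_subset by blast
  obtain T where "T \<subseteq> E'" "card T = i"
    by (rule obtain_subset_with_card_n[OF assms(3)]) auto
  then have "{card (\<Union>T) | T. T \<subseteq> E' \<and> card T = i} \<noteq> {}" by auto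
  then show ?thesis
    unfolding max_span_def using assms by (intro Max_mono finite_spans) auto
qed

text \<open>Padding \<open>T\<close> to exactly \<open>i\<close> edges only enlarges its union, so
  families with at most \<open>i\<close> edges may serve as witnesses.\<close>

lemma max_span_ge':
  assumes E: "edge_set E" and "T \<subseteq> E" "card T \<le> i" "i \<le> card E" "A \<subseteq> \<Union>T"
  shows "card A \<le> max_span E i"
proof -
  note fE = edge_setD(1)[OF E]
  have fT: "finite T" using assms fE finite_subset by blast
  have "i - card T \<le> card (E - T)"
    using assms fT by (simp add: card_Diff_subset diff_le_mono)
  then obtain T' where T': "T' \<subseteq> E - T" "card T' = i - card T" "finite T'"
    by (rule obtain_subset_with_card_n)
  have "card (T \<union> T') = i" using T' fT assms(3) by (subst card_Un_disjoint) auto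
  moreover have "T \<union> T' \<subseteq> E" using T' assms by auto
  ultimately have "card (\<Union>(T \<union> T')) \<le> max_span E i" using max_span_ge[OF fE] by blast
  moreover have "finite (\<Union>(T \<union> T'))"
    using edge_setD(4)[OF E] \<open>T \<union> T' \<subseteq> E\<close> by (meson Union_mono finite_subset)
  then have "card A \<le> card (\<Union>(T \<union> T'))" using assms(5) by (intro card_mono) auto
  ultimately show ?thesis by linarith
qed

text \<open>Induction by tight sets: a nonempty proper subset with exactly as many neighbours as
  elements splits the problem in two. If there is none, every such subset has a surplus, so one
  element can be matched arbitrarily and its partner deleted.\<close>

lemma hall_marriage:
  assumes "finite D" "\<And>d. d \<in> D \<Longrightarrow> finite (N d)"
    and "\<And>D'. D' \<subseteq> D \<Longrightarrow> card D' \<le> card (\<Union>(N ` D'))"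
  shows "\<exists>f. inj_on f D \<and> (\<forall>d\<in>D. f d \<in> N d)"
  using assms
proof (induction "card D" arbitrary: D N rule: less_induct)
  case less
  show ?case
  proof (cases "D = {}")
    case True then show ?thesis by auto
  next
    case False
    then obtain d where d: "d \<in> D" by auto
    show ?thesis
    proof (cases "\<exists>D1. D1 \<subset> D \<and> D1 \<noteq> {} \<and> card (\<Union>(N ` D1)) = card D1")
      case True
      then obtain D1 where D1: "D1 \<subset> D" "D1 \<noteq> {}" "card (\<Union>(N ` D1)) = card D1" by blast
      have fD1: "finite D1" using D1 less.prems(1) finite_subset by blast
      have fN1: "finite (\<Union>(N ` D1))" using fD1 D1 less.prems(2) by auto
      have "\<exists>f. inj_on f D1 \<and> (\<forall>d\<in>D1. f d \<in> N d)"
        using D1 less.prems fD1 by (intro less.hyps) (auto intro: psubset_card_mono)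
      then obtain f where f: "inj_on f D1" "\<forall>d\<in>D1. f d \<in> N d" by auto
      have "\<exists>g. inj_on g (D - D1) \<and> (\<forall>d\<in>D - D1. g d \<in> N d - \<Union>(N ` D1))"
      proof (rule less.hyps)
        show "card (D - D1) < card D" using D1 less.prems(1)
          by (intro psubset_card_mono) auto
        fix D' assume D': "D' \<subseteq> D - D1"
        then have fD': "finite D'" using less.prems(1) finite_subset by blast
        have fN': "finite (\<Union>(N ` D'))" using fD' D' less.prems(2) by auto
        \<comment> \<open>Hall's condition for \<open>D' \<union> D1\<close>, minus the tight
          equality for \<open>D1\<close>, is Hall's condition for \<open>D'\<close> without the
          neighbours of \<open>D1\<close>.\<close>
        have "card D' + card D1 = card (D' \<union> D1)"
          using D' fD' fD1 by (subst card_Un_disjoint) auto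
        also have "\<dots> \<le> card (\<Union>(N ` (D' \<union> D1)))" using D' D1 by (intro less.prems) auto
        also have "\<Union>(N ` (D' \<union> D1)) = (\<Union>(N ` D') - \<Union>(N ` D1)) \<union> \<Union>(N ` D1)" by auto
        also have "card \<dots> = card (\<Union>(N ` D') - \<Union>(N ` D1)) + card D1"
          using fN1 fN' D1(3) by (subst card_Un_disjoint) auto
        also have "\<Union>(N ` D') - \<Union>(N ` D1) = (\<Union>d\<in>D'. N d - \<Union>(N ` D1))" by auto
        finally show "card D' \<le> card (\<Union>d\<in>D'. N d - \<Union>(N ` D1))" by simp
      qed (use less.prems in auto)
      then obtain g where g: "inj_on g (D - D1)" "\<forall>d\<in>D - D1. g d \<in> N d - \<Union>(N ` D1)" by auto
      let ?h = "\<lambda>d. if d \<in> D1 then f d else g d"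
      have "inj_on ?h D"
      proof (rule inj_onI)
        fix a b assume ab: "a \<in> D" "b \<in> D" "?h a = ?h b"
        show "a = b"
        proof (cases "a \<in> D1"; cases "b \<in> D1")
          assume "a \<in> D1" "b \<in> D1"
          then show ?thesis using ab f(1) by (simp add: inj_on_def)
        next
          assume "a \<in> D1" "b \<notin> D1"
          then have "f a \<in> \<Union>(N ` D1)" "g b \<notin> \<Union>(N ` D1)" using f(2) g(2) ab(2) by blast+
          then show ?thesis using ab(3) \<open>a \<in> D1\<close> \<open>b \<notin> D1\<close> by simp
        next
          assume "a \<notin> D1" "b \<in> D1"
          then have "f b \<in> \<Union>(N ` D1)" "g a \<notin> \<Union>(N ` D1)" using f(2) g(2) ab(1) by blast+
          then show ?thesis using ab(3) \<open>a \<notin> D1\<close> \<open>b \<in> D1\<close> by simp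
        next
          assume "a \<notin> D1" "b \<notin> D1"
          then show ?thesis using ab inj_onD[OF g(1)] by simp
        qed
      qed
      moreover have "\<forall>d\<in>D. ?h d \<in> N d" using f g by auto
      ultimately show ?thesis by blast
    next
      case False
      have "card {d} \<le> card (\<Union>(N ` {d}))" using d by (intro less.prems(3)) auto
      then obtain x where x: "x \<in> N d" by fastforce
      have "\<exists>g. inj_on g (D - {d}) \<and> (\<forall>e\<in>D - {d}. g e \<in> N e - {x})"
      proof (rule less.hyps)
        show "card (D - {d}) < card D" using d less.prems(1) by (intro psubset_card_mono) auto
        fix D' assume D': "D' \<subseteq> D - {d}"
        then have fD': "finite D'" using less.prems(1) finite_subset by blast
        have fN': "finite (\<Union>(N ` D'))" using fD' D' less.prems(2) by auto
        show "card D' \<le> card (\<Union>e\<in>D'. N e - {x})"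
        proof (cases "D' = {}")
          case False
          have "D' \<subset> D" using D' d by auto
          then have "card D' \<noteq> card (\<Union>(N ` D'))" using False \<open>\<not> (\<exists>D1. _ D1)\<close> by metis
          then have "card D' < card (\<Union>(N ` D'))" using less.prems(3)[of D'] D' by fastforce
          moreover have "card (\<Union>(N ` D')) - 1 \<le> card (\<Union>(N ` D') - {x})"
            by (simp add: card_Diff_singleton_if)
          ultimately have "card D' \<le> card (\<Union>(N ` D') - {x})" by linarith
          also have "\<Union>(N ` D') - {x} = (\<Union>e\<in>D'. N e - {x})" by auto
          finally show ?thesis .
        qed simp
      qed (use less.prems in auto)
      then obtain g where g: "inj_on g (D - {d})" "\<forall>e\<in>D - {d}. g e \<in> N e - {x}" by auto
      have "inj_on (g(d := x)) D \<and> (\<forall>e\<in>D. (g(d := x)) e \<in> N e)"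
        using g x by (auto simp: inj_on_def)
      then show ?thesis by blast
    qed
  qed
qed

text \<open>Intersecting a cover with \<open>\<Union>E\<close> leaves a cover, which still needs
  \<open>c\<close> vertices; so nothing was cut off.\<close>

lemma covers_of_cardI:
  assumes "min_cover_number E c" "finite C" "vertex_cover E C" "card C \<le> c"
  shows "C \<in> covers_of_card E c"
proof -
  have "vertex_cover E (C \<inter> \<Union>E)" using assms(3) by (auto simp: vertex_cover_def)
  then have "c \<le> card (C \<inter> \<Union>E)" using assms by (auto simp: min_cover_number_def)
  moreover have "card (C \<inter> \<Union>E) \<le> card C" using assms by (intro card_mono) auto
  ultimately have "card (C \<inter> \<Union>E) = card C" "card C = c" using assms(4) by auto
  moreover from this have "C \<inter> \<Union>E = C" using assms(2) by (intro card_subset_eq) auto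
  ultimately show ?thesis using assms by (auto simp: covers_of_card_def)
qed

lemma covers_of_cardD:
  assumes "edge_set E" "C \<in> covers_of_card E c"
  shows "finite C" "C \<subseteq> \<Union>E" "card C = c" "\<And>e. e \<in> E \<Longrightarrow> e \<inter> C \<noteq> {}" "vertex_cover E C"
  using assms edge_setD(4)[OF assms(1)] by (auto simp: covers_of_card_def vertex_cover_def intro: finite_subset)

lemma finite_covers_of_card: "edge_set E \<Longrightarrow> finite (covers_of_card E c)"
  using edge_setD(4)[of E] by (auto simp: covers_of_card_def intro: finite_subset[of _ "Pow (\<Union>E)"])

text \<open>One endpoint chosen from every edge gives a cover. This is what guarantees enough edges
  for the spans with index up to \<open>c\<close>.\<close>

lemma cover_le_card_edges:
  assumes "edge_set E" "\<And>C. finite C \<Longrightarrow> vertex_cover E C \<Longrightarrow> c \<le> card C"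
  shows "c \<le> card E"
proof -
  let ?f = "\<lambda>e. SOME x. x \<in> e"
  have "?f e \<in> e" if "e \<in> E" for e
  proof -
    have "e \<noteq> {}" using edge_setD(2)[OF assms(1) that] by auto
    then show ?thesis by (simp add: some_in_eq)
  qed
  then have "vertex_cover E (?f ` E)" unfolding vertex_cover_def by blast
  then have "c \<le> card (?f ` E)" using assms edge_setD(1)[OF assms(1)] by auto
  also have "\<dots> \<le> card E" using edge_setD(1)[OF assms(1)] by (rule card_image_le)
  finally show ?thesis .
qed

lemma edge_eq_pair:
  assumes "edge_set E" "e \<in> E" "x \<in> e" "y \<in> e" "x \<noteq> y"
  shows "e = {x, y}"
  using assms edge_setD(2)[OF assms(1,2)] edge_setD(3)[OF assms(1,2)]
  by (intro card_seteq[symmetric]) auto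

text \<open>Exchanging a set violating Hall's condition would produce a smaller cover.\<close>

lemma min_cover_exchange_matching:
  assumes E: "edge_set E" and mc: "min_cover_number E c"
    and C: "C \<in> covers_of_card E c" and C': "C' \<in> covers_of_card E c"
  shows "\<exists>m. bij_betw m (C' - C) (C - C') \<and> (\<forall>y\<in>C' - C. {y, m y} \<in> E)"
proof -
  note C = covers_of_cardD[OF E C] and C' = covers_of_cardD[OF E C']
  define N where "N d = {y \<in> C' - C. {d, y} \<in> E}" for d
  have fN: "finite (N d)" for d using C' by (auto simp: N_def)
  have cards: "card (C' - C) = card (C - C')"
    using C C' by (metis card_Diff_subset_Int finite_Int inf_commute)
  have "\<exists>f. inj_on f (C - C') \<and> (\<forall>d\<in>C - C'. f d \<in> N d)"
  proof (rule hall_marriage)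
    fix D' assume D': "D' \<subseteq> C - C'"
    have fD': "finite D'" using D' C finite_subset by blast
    have fND: "finite (\<Union>(N ` D'))" using fD' fN by auto
    let ?K = "(C - D') \<union> \<Union>(N ` D')"
    \<comment> \<open>An edge that \<open>C\<close> covers only within \<open>D'\<close> has an end
      in \<open>C'\<close>, which then lies outside \<open>C\<close> and is a neighbour of
      \<open>D'\<close>.\<close>
    have "vertex_cover E ?K" unfolding vertex_cover_def
    proof
      fix e assume e: "e \<in> E"
      show "e \<inter> ?K \<noteq> {}"
      proof (cases "e \<inter> (C - D') = {}")
        case True
        then obtain x where x: "x \<in> e" "x \<in> D'" using C(4)[OF e] by auto
        obtain y where y: "y \<in> e" "y \<in> C'" using C'(4)[OF e] by auto
        have xy: "x \<noteq> y" using x y D' by auto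
        then have exy: "e = {x, y}" using edge_eq_pair[OF E e] x y by auto
        have "y \<notin> D'" using y D' by auto
        then have "y \<notin> C" using True y by auto
        then have "y \<in> N x" using y exy e by (auto simp: N_def)
        then show ?thesis using x y by auto
      qed auto
    qed
    then have "c \<le> card ?K" using mc C fND by (auto simp: min_cover_number_def)
    also have "\<dots> \<le> card (C - D') + card (\<Union>(N ` D'))" by (rule card_Un_le)
    also have "card (C - D') = c - card D'" using D' C fD' by (subst card_Diff_subset) auto
    finally have "c \<le> c - card D' + card (\<Union>(N ` D'))" by simp
    moreover have "card D' \<le> c" using card_mono[of C D'] D' C by blast
    ultimately show "card D' \<le> card (\<Union>(N ` D'))" by linarith
  qed (use C fN in auto)
  then obtain f where f: "inj_on f (C - C')" "\<forall>d\<in>C - C'. f d \<in> N d" by auto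
  have "f ` (C - C') \<subseteq> C' - C" using f by (auto simp: N_def)
  then have im: "f ` (C - C') = C' - C"
    using f cards C' by (intro card_subset_eq) (auto simp: card_image)
  then have bij: "bij_betw f (C - C') (C' - C)" using f by (auto simp: bij_betw_def)
  show ?thesis
  proof (intro exI conjI ballI)
    show "bij_betw (the_inv_into (C - C') f) (C' - C) (C - C')"
      using bij by (rule bij_betw_the_inv_into)
    fix y assume "y \<in> C' - C"
    then obtain d where d: "d \<in> C - C'" "y = f d" using im by auto
    then have "the_inv_into (C - C') f y = d" using f by (simp add: the_inv_into_f_f)
    then show "{y, the_inv_into (C - C') f y} \<in> E"
      using f d by (auto simp: N_def insert_commute)
  qed
qed

text \<open>Fix a minimum cover \<open>C\<close> and number all minimum covers. A vertex outside
  \<open>C\<close> is matched into \<open>C\<close> by the matching that belongs to the first cover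
  containing it. Choosing the first cover is what makes these separate matchings fit together
  injectively.\<close>

lemma min_covers_spanned:
  assumes E: "edge_set E" and mc: "min_cover_number E c"
  shows "card (\<Union>(covers_of_card E c)) \<le> max_span E c"
proof -
  let ?A = "\<Union>(covers_of_card E c)"
  obtain C where Cin: "C \<in> covers_of_card E c" using mc by (auto simp: min_cover_number_def)
  note C = covers_of_cardD[OF E Cin]
  have "\<forall>C'\<in>covers_of_card E c. \<exists>m. bij_betw m (C' - C) (C - C') \<and> (\<forall>y\<in>C' - C. {y, m y} \<in> E)"
    using min_cover_exchange_matching[OF E mc Cin] by blast
  then obtain m where m: "\<And>C'. C' \<in> covers_of_card E c \<Longrightarrow> bij_betw (m C') (C' - C) (C - C')"
    and mE: "\<And>C' y. C' \<in> covers_of_card E c \<Longrightarrow> y \<in> C' - C \<Longrightarrow> {y, m C' y} \<in> E"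
    by metis
  obtain idx :: "'a set \<Rightarrow> nat" where idx: "inj_on idx (covers_of_card E c)"
    using finite_covers_of_card[OF E] finite_imp_inj_to_nat_seg by metis
  define first where "first y = (ARG_MIN idx C'. C' \<in> covers_of_card E c \<and> y \<in> C')" for y
  have first: "first y \<in> covers_of_card E c" "y \<in> first y"
    "\<And>C'. C' \<in> covers_of_card E c \<Longrightarrow> y \<in> C' \<Longrightarrow> idx (first y) \<le> idx C'" if y: "y \<in> ?A" for y
  proof -
    obtain C0 where "C0 \<in> covers_of_card E c \<and> y \<in> C0" using y by auto
    from arg_min_nat_lemma[of "\<lambda>C'. C' \<in> covers_of_card E c \<and> y \<in> C'", OF this, of idx]
    show "first y \<in> covers_of_card E c" "y \<in> first y"
      "\<And>C'. C' \<in> covers_of_card E c \<Longrightarrow> y \<in> C' \<Longrightarrow> idx (first y) \<le> idx C'"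
      unfolding first_def by auto
  qed
  define g where "g y = m (first y) y" for y
  have gC: "g y \<in> C - first y" and gE: "{y, g y} \<in> E" if "y \<in> ?A - C" for y
  proof -
    have y: "y \<in> ?A" "y \<in> first y - C" using that first by auto
    show "g y \<in> C - first y" using m[OF first(1)[OF y(1)]] y unfolding g_def bij_betw_def by blast
    show "{y, g y} \<in> E" using mE[OF first(1)[OF y(1)] y(2)] by (simp add: g_def)
  qed
  \<comment> \<open>The cover \<open>first y\<close> misses the common partner, so to cover the edge
    at \<open>y'\<close> it must contain \<open>y'\<close>; this contradicts the choice of the later
    cover as the first one through \<open>y'\<close>.\<close>
  have key: "False" if y: "y \<in> ?A - C" and y': "y' \<in> ?A - C" and eq: "g y = g y'"
    and less: "idx (first y) < idx (first y')" for y y'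
  proof -
    have "g y' \<notin> first y" using gC[OF y] eq by auto
    then have "y' \<in> first y"
      using covers_of_cardD(4)[OF E first(1) gE[OF y'], of y] y by auto
    then have "idx (first y') \<le> idx (first y)" using y' y first(1)[of y] by (intro first(3)) auto
    then show False using less by simp
  qed
  have inj: "inj_on g (?A - C)"
  proof (rule inj_onI)
    fix y y' assume *: "y \<in> ?A - C" "y' \<in> ?A - C" "g y = g y'"
    then have "idx (first y) = idx (first y')" using key[of y y'] key[of y' y] by force
    then have f: "first y = first y'" using idx first(1) * by (auto simp: inj_on_def)
    have "inj_on (m (first y)) (first y - C)" using m first(1) * by (auto simp: bij_betw_def)
    moreover have "y \<in> first y - C" "y' \<in> first y - C" using * first(2) f by auto
    ultimately show "y = y'" using * f by (auto simp: g_def inj_on_def)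
  qed
  have "\<exists>e\<in>E. u \<in> e" if "u \<in> C" for u using that C by auto
  then obtain h where h: "\<And>u. u \<in> C \<Longrightarrow> h u \<in> E \<and> u \<in> h u" by metis
  \<comment> \<open>The matched edges, and one arbitrary edge at each vertex of \<open>C\<close>
    without a partner: by injectivity at most \<open>c\<close> edges.\<close>
  let ?T = "(\<lambda>y. {y, g y}) ` (?A - C) \<union> h ` (C - g ` (?A - C))"
  have finA: "finite ?A"
    using finite_covers_of_card[OF E] covers_of_cardD(1)[OF E] by blast
  have "card ?T \<le> card (?A - C) + card (C - g ` (?A - C))"
    using finA C by (intro order_trans[OF card_Un_le] add_mono card_image_le) auto
  also have "card (C - g ` (?A - C)) = card C - card (?A - C)"
    using gC C finA inj by (subst card_Diff_subset) (auto simp: card_image)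
  also have "card (?A - C) + \<dots> = c"
  proof -
    have "card (g ` (?A - C)) \<le> card C" using gC C(1) by (intro card_mono) blast+
    then show ?thesis using C(3) inj by (simp add: card_image)
  qed
  finally have cardT: "card ?T \<le> c" .
  have TE: "?T \<subseteq> E" using gE h by auto
  have AT: "?A \<subseteq> \<Union>?T"
  proof
    fix x assume x: "x \<in> ?A"
    consider "x \<in> ?A - C" | "x \<in> g ` (?A - C)" | "x \<in> C - g ` (?A - C)" using x by auto
    then show "x \<in> \<Union>?T"
    proof cases
      case 1
      then have "{x, g x} \<in> ?T" by (intro UnI1 imageI)
      then show ?thesis by (rule UnionI) simp
    next
      case 2
      then obtain y where y: "y \<in> ?A - C" "x = g y" by (rule imageE)
      then have "{y, g y} \<in> ?T" by (intro UnI1 imageI)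
      then show ?thesis by (rule UnionI) (simp add: y)
    next
      case 3
      then have "h x \<in> ?T" by (intro UnI2 imageI)
      then show ?thesis by (rule UnionI) (use 3 h in blast)
    qed
  qed
  have "c \<le> card E"
    using cover_le_card_edges[OF E] mc by (auto simp: min_cover_number_def)
  then show ?thesis by (rule max_span_ge'[OF E TE cardT _ AT])
qed

text \<open>Assuming only a lower bound on cover sizes lets the induction hypothesis apply after
  deleting a vertex, without asking whether \<open>c\<close> is attained there.\<close>

theorem card_min_covers_le:
  assumes "edge_set E" "\<And>C. finite C \<Longrightarrow> vertex_cover E C \<Longrightarrow> c \<le> card C"
  shows "card (covers_of_card E c) * fact c \<le> (\<Prod>i=1..c. max_span E i)"
  using assms
proof (induction c arbitrary: E)
  case 0
  have "covers_of_card E 0 \<subseteq> {{}}"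
    using covers_of_cardD(1,3)[OF 0(1)] by fastforce
  then have "card (covers_of_card E 0) \<le> card {{} :: 'a set}" by (intro card_mono) auto
  then show ?case by simp
next
  case (Suc c)
  note E = Suc.prems(1)
  show ?case
  proof (cases "covers_of_card E (Suc c) = {}")
    case False
    then have mc: "min_cover_number E (Suc c)" using Suc.prems by (auto simp: min_cover_number_def)
    let ?M = "covers_of_card E (Suc c)"
    let ?A = "\<Union>?M"
    let ?P = "\<Prod>i=1..c. max_span E i"
    have finM: "finite ?M" using finite_covers_of_card[OF E] .
    have finA: "finite ?A" using finM covers_of_cardD(1)[OF E] by blast
    have step: "card {C\<in>?M. v \<in> C} * fact c \<le> ?P" if "v \<in> ?A" for v
    proof -
      let ?E = "{e\<in>E. v \<notin> e}"
      have E': "edge_set ?E" using E by (auto simp: edge_set_def)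
      have low: "c \<le> card C" if "finite C" "vertex_cover ?E C" for C
      proof -
        have "vertex_cover E (insert v C)" using that by (auto simp: vertex_cover_def)
        then have "Suc c \<le> card (insert v C)" using Suc.prems(2) that by blast
        also have "\<dots> \<le> Suc (card C)" by (rule card_insert_le_m1) auto
        finally show ?thesis by simp
      qed
      \<comment> \<open>A vertex of \<open>C - {v}\<close> might have lost all its edges with
        \<open>v\<close>; the lower bound \<open>c\<close> for the remaining graph excludes
        this.\<close>
      have sub: "C - {v} \<in> covers_of_card ?E c" if "C \<in> ?M" "v \<in> C" for C
      proof -
        note C = covers_of_cardD[OF E that(1)]
        have cov: "vertex_cover ?E (C - {v})" using C(4) unfolding vertex_cover_def by blast
        have card: "card (C - {v}) = c" using C that by simp
        have "covers_of_card ?E c \<noteq> {}"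
        proof -
          have "vertex_cover ?E ((C - {v}) \<inter> \<Union>?E)" using cov by (auto simp: vertex_cover_def)
          then have "c \<le> card ((C - {v}) \<inter> \<Union>?E)" using low C by auto
          moreover have "card ((C - {v}) \<inter> \<Union>?E) \<le> c" unfolding card[symmetric]
            using C by (intro card_mono) auto
          ultimately have "(C - {v}) \<inter> \<Union>?E \<in> covers_of_card ?E c"
            using \<open>vertex_cover ?E ((C - {v}) \<inter> \<Union>?E)\<close> by (auto simp: covers_of_card_def)
          then show ?thesis by auto
        qed
        then have "min_cover_number ?E c" using low by (auto simp: min_cover_number_def)
        then show ?thesis using covers_of_cardI[of ?E c "C - {v}"] cov card C(1) by simp
      qed
      have "card {C\<in>?M. v \<in> C} \<le> card (covers_of_card ?E c)"
      proof (rule card_inj_on_le[of "\<lambda>C. C - {v}"])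
        show "inj_on (\<lambda>C. C - {v}) {C\<in>?M. v \<in> C}"
          by (rule inj_onI) (metis (lifting) insert_Diff mem_Collect_eq)
        show "(\<lambda>C. C - {v}) ` {C\<in>?M. v \<in> C} \<subseteq> covers_of_card ?E c" using sub by blast
        show "finite (covers_of_card ?E c)" using finite_covers_of_card[OF E'] .
      qed
      then have "card {C\<in>?M. v \<in> C} * fact c \<le> card (covers_of_card ?E c) * fact c" by simp
      also have "\<dots> \<le> (\<Prod>i=1..c. max_span ?E i)" using Suc.IH[OF E' low] by auto
      also have "\<dots> \<le> ?P"
      proof (rule prod_mono, safe)
        fix i assume "i \<in> {1..c}"
        then have "i \<le> card ?E" using cover_le_card_edges[OF E' low] by auto
        then show "max_span ?E i \<le> max_span E i" using edge_setD(1)[OF E] by (intro max_span_mono) auto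
      qed
      finally show ?thesis .
    qed
    have "card ?M * Suc c = (\<Sum>C\<in>?M. card C)" using covers_of_cardD(3)[OF E] by simp
    also have "\<dots> = (\<Sum>C\<in>?M. \<Sum>v\<in>?A. if v \<in> C then 1 else 0)"
    proof (rule sum.cong)
      fix C assume C: "C \<in> ?M"
      have "(\<Sum>v\<in>?A. if v \<in> C then 1 else 0) = card (?A \<inter> C)"
        using finA by (simp add: sum.If_cases)
      also have "?A \<inter> C = C" using C by auto
      finally show "card C = (\<Sum>v\<in>?A. if v \<in> C then 1 else 0)" by simp
    qed simp
    also have "\<dots> = (\<Sum>v\<in>?A. \<Sum>C\<in>?M. if v \<in> C then 1 else 0)" by (rule sum.swap)
    also have "\<dots> = (\<Sum>v\<in>?A. card {C\<in>?M. v \<in> C})"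
    proof (rule sum.cong)
      fix v
      have "{C\<in>?M. v \<in> C} = ?M \<inter> {C. v \<in> C}" by blast
      then show "(\<Sum>C\<in>?M. if v \<in> C then 1 else 0) = card {C\<in>?M. v \<in> C}"
        by (simp only: sum.If_cases[OF finM] sum.neutral_const card_eq_sum add_0_right)
    qed simp
    finally have "card ?M * Suc c * fact c = (\<Sum>v\<in>?A. card {C\<in>?M. v \<in> C} * fact c)"
      by (simp only: sum_distrib_right)
    then have "card ?M * fact (Suc c) = (\<Sum>v\<in>?A. card {C\<in>?M. v \<in> C} * fact c)"
      by (simp only: fact_Suc of_nat_id mult.assoc)
    also have "\<dots> \<le> (\<Sum>v\<in>?A. ?P)" using step by (intro sum_mono) auto
    also have "\<dots> = card ?A * ?P" by simp
    also have "\<dots> \<le> max_span E (Suc c) * ?P"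
      using min_covers_spanned[OF E mc] by (intro mult_right_mono) auto
    finally show ?thesis by (simp add: mult.commute)
  qed simp
qed


section \<open>Minimum vertex covers: the lower bound\<close>

text \<open>Stronger in spirit than the usual notion of this name: it records that no vertex is in
  all minimum covers and that these are connected under single exchanges. Connectedness is phrased
  by cuts instead of paths, because cuts pull back along restriction maps.\<close>

definition well_covered :: "'a set set \<Rightarrow> nat \<Rightarrow> bool" where
  "well_covered E c \<longleftrightarrow> min_cover_number E c \<and>
     (\<forall>v\<in>\<Union>E. \<exists>C\<in>covers_of_card E c. v \<notin> C) \<and>
     (\<forall>\<A>. \<A> \<subset> covers_of_card E c \<longrightarrow> \<A> \<noteq> {} \<longrightarrow>
        (\<exists>C\<in>\<A>. \<exists>C'\<in>covers_of_card E c - \<A>. card (C - C') \<le> 1))"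

lemma well_coveredD:
  assumes "well_covered E c"
  shows "min_cover_number E c" "covers_of_card E c \<noteq> {}"
    "\<And>v. v \<in> \<Union>E \<Longrightarrow> \<exists>C\<in>covers_of_card E c. v \<notin> C"
    "\<And>\<A>. \<A> \<subset> covers_of_card E c \<Longrightarrow> \<A> \<noteq> {} \<Longrightarrow>
        \<exists>C\<in>\<A>. \<exists>C'\<in>covers_of_card E c - \<A>. card (C - C') \<le> 1"
  using assms unfolding well_covered_def min_cover_number_def by blast+

lemma min_cover_number_le:
  "min_cover_number E c \<Longrightarrow> finite C \<Longrightarrow> vertex_cover E C \<Longrightarrow> c \<le> card C"
  by (simp add: min_cover_number_def)

lemma min_cover_number_unique:
  assumes "edge_set E" "min_cover_number E c" "min_cover_number E c'"
  shows "c = c'"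
proof -
  obtain C C' where C: "C \<in> covers_of_card E c" and C': "C' \<in> covers_of_card E c'"
    using assms by (auto simp: min_cover_number_def)
  note C = covers_of_cardD[OF assms(1) C] and C' = covers_of_cardD[OF assms(1) C']
  have "c \<le> card C'" "c' \<le> card C"
    using min_cover_number_le[OF assms(2) C'(1,5)] min_cover_number_le[OF assms(3) C(1,5)] .
  then show ?thesis using C(3) C'(3) by simp
qed

text \<open>Each further cover shrinks the common intersection by at most one vertex.\<close>

lemma card_covers_gt:
  assumes E: "edge_set E" and w: "well_covered E c"
  shows "c + 1 \<le> card (covers_of_card E c)"
proof -
  let ?C = "covers_of_card E c"
  have fin: "finite ?C" using finite_covers_of_card[OF E] .
  have pos: "1 \<le> card ?C" using fin well_coveredD(2)[OF w] by (simp add: Suc_le_eq card_gt_0_iff)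
  have "\<exists>\<A>\<subseteq>?C. card \<A> = Suc k \<and> c \<le> card (\<Inter>\<A>) + k" if "Suc k \<le> card ?C" for k
    using that
  proof (induction k)
    case 0
    obtain C where "C \<in> ?C" using well_coveredD(2)[OF w] by blast
    then show ?case using covers_of_cardD(3)[OF E] by (intro exI[of _ "{C}"]) auto
  next
    case (Suc k)
    then obtain \<A> where A: "\<A> \<subseteq> ?C" "card \<A> = Suc k" "c \<le> card (\<Inter>\<A>) + k" by auto
    have "\<A> \<subset> ?C" "\<A> \<noteq> {}" using A Suc.prems by auto
    then obtain C C' where CC: "C \<in> \<A>" "C' \<in> ?C - \<A>" "card (C - C') \<le> 1"
      using well_coveredD(4)[OF w] by blast
    have finC: "finite C" using covers_of_cardD(1)[OF E] CC(1) A(1) by blast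
    have finI: "finite (\<Inter>\<A>)" using finC CC(1) by (meson Inter_lower finite_subset)
    have sub: "\<Inter>\<A> - (C - C') \<subseteq> \<Inter>(insert C' \<A>)" using CC(1) by auto
    have fin': "finite (\<Inter>(insert C' \<A>))" using finI by simp
    have "card (\<Inter>\<A>) - card (C - C') \<le> card (\<Inter>\<A> - (C - C'))"
      using finC by (intro diff_card_le_card_Diff) auto
    also have "\<dots> \<le> card (\<Inter>(insert C' \<A>))" using sub fin' by (intro card_mono)
    finally have "c \<le> card (\<Inter>(insert C' \<A>)) + Suc k" using A(3) CC(3) by linarith
    moreover have "card (insert C' \<A>) = Suc (Suc k)"
      using A CC(2) finite_subset[OF A(1) fin] by simp
    ultimately show ?case using A(1) CC(2) by (intro exI[of _ "insert C' \<A>"]) auto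
  qed
  from this[of "card ?C - 1"] obtain \<A> where A: "\<A> \<subseteq> ?C" "card \<A> = card ?C"
    "c \<le> card (\<Inter>\<A>) + (card ?C - 1)" using pos by auto
  then have "\<A> = ?C" using fin by (intro card_subset_eq) auto
  moreover have "\<Inter>?C = {}"
  proof (rule equals0I)
    fix v assume v: "v \<in> \<Inter>?C"
    obtain C where "C \<in> ?C" using well_coveredD(2)[OF w] by blast
    then have "v \<in> \<Union>E" using v covers_of_cardD(2)[OF E] by blast
    then show False using well_coveredD(3)[OF w] v by blast
  qed
  ultimately show ?thesis using A(3) pos by simp
qed

text \<open>A cheaper cover of \<open>E1\<close> could be pasted to the part of \<open>C\<close> in
  \<open>E2\<close>, giving a cover of the whole graph below \<open>c\<close>.\<close>

lemma min_cover_number_part: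
  assumes E: "edge_set (E1 \<union> E2)" and dis: "\<Union>E1 \<inter> \<Union>E2 = {}"
    and mc: "min_cover_number (E1 \<union> E2) c" and C: "C \<in> covers_of_card (E1 \<union> E2) c"
  shows "min_cover_number E1 (card (C \<inter> \<Union>E1))"
    and "C \<inter> \<Union>E1 \<in> covers_of_card E1 (card (C \<inter> \<Union>E1))"
proof -
  note C = covers_of_cardD[OF E C]
  have "vertex_cover E1 (C \<inter> \<Union>E1)" unfolding vertex_cover_def
  proof
    fix e assume "e \<in> E1"
    then show "e \<inter> (C \<inter> \<Union>E1) \<noteq> {}" using C(4)[of e] by blast
  qed
  then show mem: "C \<inter> \<Union>E1 \<in> covers_of_card E1 (card (C \<inter> \<Union>E1))"
    by (simp add: covers_of_card_def)
  have "card (C \<inter> \<Union>E1) \<le> card K" if K: "finite K" "vertex_cover E1 K" for K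
  proof -
    have "vertex_cover (E1 \<union> E2) (K \<union> (C \<inter> \<Union>E2))" unfolding vertex_cover_def
    proof
      fix e assume "e \<in> E1 \<union> E2"
      then consider "e \<in> E1" | "e \<in> E2" by blast
      then show "e \<inter> (K \<union> C \<inter> \<Union>E2) \<noteq> {}"
      proof cases
        case 1
        then have "e \<inter> K \<noteq> {}" using K(2) unfolding vertex_cover_def by blast
        then show ?thesis by blast
      next
        case 2
        then have "e \<inter> C \<noteq> {}" using C(4)[of e] by blast
        then show ?thesis using 2 by blast
      qed
    qed
    then have "c \<le> card (K \<union> (C \<inter> \<Union>E2))"
      using C(1) K(1) by (intro min_cover_number_le[OF mc]) auto
    also have "\<dots> \<le> card K + card (C \<inter> \<Union>E2)" by (rule card_Un_le)
    finally have "c \<le> card K + card (C \<inter> \<Union>E2)" .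
    moreover have "c = card (C \<inter> \<Union>E1) + card (C \<inter> \<Union>E2)"
    proof -
      have "C = (C \<inter> \<Union>E1) \<union> (C \<inter> \<Union>E2)" using C(2) by auto
      then have "card C = card ((C \<inter> \<Union>E1) \<union> (C \<inter> \<Union>E2))" by simp
      also have "\<dots> = card (C \<inter> \<Union>E1) + card (C \<inter> \<Union>E2)"
        using C(1) dis by (intro card_Un_disjoint) auto
      finally show ?thesis using C(3) by simp
    qed
    ultimately show ?thesis by simp
  qed
  then show "min_cover_number E1 (card (C \<inter> \<Union>E1))"
    using mem by (auto simp: min_cover_number_def)
qed

lemma Un_Int_separated:
  assumes "P \<subseteq> V" "Q \<subseteq> W" "V \<inter> W = {}"
  shows "(P \<union> Q) \<inter> V = P" "(P \<union> Q) \<inter> W = Q"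
  using assms by blast+

text \<open>Minimum covers of a disjoint union restrict to minimum covers of both sides, and any two
  minimum covers of the sides can be glued.\<close>

lemma well_covered_split:
  assumes E: "edge_set (E1 \<union> E2)" and dis: "\<Union>E1 \<inter> \<Union>E2 = {}" and w: "well_covered (E1 \<union> E2) c"
  shows "\<exists>c1 c2. c = c1 + c2 \<and> well_covered E1 c1 \<and> well_covered E2 c2 \<and>
    card (covers_of_card E1 c1) * card (covers_of_card E2 c2) \<le> card (covers_of_card (E1 \<union> E2) c)"
proof -
  note mc = well_coveredD(1)[OF w]
  have E1: "edge_set E1" and E2: "edge_set E2" using E edge_set_subset by blast+
  have E': "edge_set (E2 \<union> E1)" and dis': "\<Union>E2 \<inter> \<Union>E1 = {}" and mc': "min_cover_number (E2 \<union> E1) c"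
    and w': "well_covered (E2 \<union> E1) c"
    using E dis mc w by (auto simp: Un_commute)
  obtain C0 where C0: "C0 \<in> covers_of_card (E1 \<union> E2) c" using well_coveredD(2)[OF w] by blast
  then have C0': "C0 \<in> covers_of_card (E2 \<union> E1) c" by (simp add: Un_commute)
  define c1 where "c1 = card (C0 \<inter> \<Union>E1)"
  define c2 where "c2 = card (C0 \<inter> \<Union>E2)"
  note m1 = min_cover_number_part[OF E dis mc C0, folded c1_def]
  note m2 = min_cover_number_part[OF E' dis' mc' C0', folded c2_def]
  have c: "c = c1 + c2"
  proof -
    have "C0 = (C0 \<inter> \<Union>E1) \<union> (C0 \<inter> \<Union>E2)" using covers_of_cardD(2)[OF E C0] by auto
    then have "card C0 = card ((C0 \<inter> \<Union>E1) \<union> (C0 \<inter> \<Union>E2))" by simp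
    also have "\<dots> = c1 + c2" unfolding c1_def c2_def
      using covers_of_cardD(1)[OF E C0] dis by (intro card_Un_disjoint) auto
    finally show ?thesis using covers_of_cardD(3)[OF E C0] by simp
  qed
  have r1: "C \<inter> \<Union>E1 \<in> covers_of_card E1 c1" if "C \<in> covers_of_card (E1 \<union> E2) c" for C
    using min_cover_number_part[OF E dis mc that] min_cover_number_unique[OF E1 m1(1)] by simp
  have r2: "C \<inter> \<Union>E2 \<in> covers_of_card E2 c2" if "C \<in> covers_of_card (E1 \<union> E2) c" for C
    using min_cover_number_part[OF E' dis' mc', of C] that min_cover_number_unique[OF E2 m2(1)]
    by (simp add: Un_commute)
  have u: "C1 \<union> C2 \<in> covers_of_card (E1 \<union> E2) c"
    if "C1 \<in> covers_of_card E1 c1" "C2 \<in> covers_of_card E2 c2" for C1 C2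
  proof -
    note d1 = covers_of_cardD[OF E1 that(1)] and d2 = covers_of_cardD[OF E2 that(2)]
    have "card (C1 \<union> C2) = c" using d1 d2 dis c by (subst card_Un_disjoint) auto
    moreover have "vertex_cover (E1 \<union> E2) (C1 \<union> C2)"
      using d1(5) d2(5) unfolding vertex_cover_def by blast
    ultimately show ?thesis using d1(2) d2(2) by (auto simp: covers_of_card_def)
  qed
  have u1: "(C1 \<union> C2) \<inter> \<Union>E1 = C1" and u2: "(C1 \<union> C2) \<inter> \<Union>E2 = C2"
    if "C1 \<in> covers_of_card E1 c1" "C2 \<in> covers_of_card E2 c2" for C1 C2
    using Un_Int_separated[OF covers_of_cardD(2)[OF E1 that(1)] covers_of_cardD(2)[OF E2 that(2)] dis] .
  \<comment> \<open>Both properties descend along the restriction to \<open>\<Union>F\<close>, which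
    is onto by \<open>uF\<close>: a cut of its image pulls back to a cut, and restricting two covers
    cannot enlarge their difference.\<close>
  have wc: "well_covered F k"
    if F: "F \<subseteq> E1 \<union> E2" and mF: "min_cover_number F k"
      and rF: "\<And>C. C \<in> covers_of_card (E1 \<union> E2) c \<Longrightarrow> C \<inter> \<Union>F \<in> covers_of_card F k"
      and uF: "\<And>K. K \<in> covers_of_card F k \<Longrightarrow> \<exists>C\<in>covers_of_card (E1 \<union> E2) c. C \<inter> \<Union>F = K" for F k
    unfolding well_covered_def
  proof (intro conjI ballI allI impI)
    show "min_cover_number F k" by fact
  next
    fix v assume v: "v \<in> \<Union>F"
    then have "v \<in> \<Union>(E1 \<union> E2)" using F by blast
    then obtain C where "C \<in> covers_of_card (E1 \<union> E2) c" "v \<notin> C"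
      using well_coveredD(3)[OF w] by blast
    then show "\<exists>C\<in>covers_of_card F k. v \<notin> C" using rF by blast
  next
    fix \<A> assume A: "\<A> \<subset> covers_of_card F k" "\<A> \<noteq> {}"
    let ?A = "{C \<in> covers_of_card (E1 \<union> E2) c. C \<inter> \<Union>F \<in> \<A>}"
    obtain K where K: "K \<in> \<A>" using A by blast
    then obtain C where "C \<in> covers_of_card (E1 \<union> E2) c" "C \<inter> \<Union>F = K" using uF A(1) by blast
    then have ne: "?A \<noteq> {}" using K by blast
    obtain K' where K': "K' \<in> covers_of_card F k" "K' \<notin> \<A>" using A by blast
    then obtain C' where "C' \<in> covers_of_card (E1 \<union> E2) c" "C' \<inter> \<Union>F = K'" using uF by blast
    then have "?A \<subset> covers_of_card (E1 \<union> E2) c" using K' by blast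
    from well_coveredD(4)[OF w this ne] obtain D D' where D: "D \<in> ?A"
      "D' \<in> covers_of_card (E1 \<union> E2) c - ?A" "card (D - D') \<le> 1" by blast
    have "card (D \<inter> \<Union>F - D' \<inter> \<Union>F) \<le> card (D - D')"
      using covers_of_cardD(1)[OF E, of D] D(1) by (intro card_mono) auto
    then have "card (D \<inter> \<Union>F - D' \<inter> \<Union>F) \<le> 1" using D(3) by simp
    moreover have "D \<inter> \<Union>F \<in> \<A>" "D' \<inter> \<Union>F \<in> covers_of_card F k - \<A>" using D(1,2) rF by blast+
    ultimately show "\<exists>C\<in>\<A>. \<exists>C'\<in>covers_of_card F k - \<A>. card (C - C') \<le> 1" by blast
  qed
  have "well_covered E1 c1"
  proof (rule wc)
    fix K assume "K \<in> covers_of_card E1 c1"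
    then show "\<exists>C\<in>covers_of_card (E1 \<union> E2) c. C \<inter> \<Union>E1 = K"
      by (intro bexI[of _ "K \<union> (C0 \<inter> \<Union>E2)"] u1 u m2(2))
  qed (use m1 r1 in auto)
  moreover have "well_covered E2 c2"
  proof (rule wc)
    fix K assume "K \<in> covers_of_card E2 c2"
    then show "\<exists>C\<in>covers_of_card (E1 \<union> E2) c. C \<inter> \<Union>E2 = K"
      by (intro bexI[of _ "(C0 \<inter> \<Union>E1) \<union> K"] u2 u m1(2))
  qed (use m2 r2 in auto)
  moreover have "card (covers_of_card E1 c1 \<times> covers_of_card E2 c2) \<le> card (covers_of_card (E1 \<union> E2) c)"
  proof (rule card_inj_on_le[of "\<lambda>(C1, C2). C1 \<union> C2"])
    show "inj_on (\<lambda>(C1, C2). C1 \<union> C2) (covers_of_card E1 c1 \<times> covers_of_card E2 c2)"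
    proof (rule inj_onI, clarify)
      fix a b a' b' assume *: "a \<in> covers_of_card E1 c1" "b \<in> covers_of_card E2 c2"
        "a' \<in> covers_of_card E1 c1" "b' \<in> covers_of_card E2 c2" "a \<union> b = a' \<union> b'"
      show "a = a' \<and> b = b'"
        using u1[OF *(1,2)] u1[OF *(3,4)] u2[OF *(1,2)] u2[OF *(3,4)] *(5) by simp
    qed
    show "(\<lambda>(C1, C2). C1 \<union> C2) ` (covers_of_card E1 c1 \<times> covers_of_card E2 c2) \<subseteq> covers_of_card (E1 \<union> E2) c"
      using u by auto
  qed (rule finite_covers_of_card[OF E])
  ultimately show ?thesis using c by (auto simp: card_cartesian_product)
qed

section \<open>Connected components, as sets of edges\<close>

definition connected_edges :: "'a set set \<Rightarrow> bool" where
  "connected_edges B \<longleftrightarrow> B \<noteq> {} \<and>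
     (\<forall>B1. B1 \<subset> B \<longrightarrow> B1 \<noteq> {} \<longrightarrow> (\<exists>e1\<in>B1. \<exists>e2\<in>B - B1. e1 \<inter> e2 \<noteq> {}))"

definition components_of :: "'a set set \<Rightarrow> 'a set set set \<Rightarrow> bool" where
  "components_of E \<P> \<longleftrightarrow> \<Union>\<P> = E \<and> finite \<P> \<and> (\<forall>B\<in>\<P>. connected_edges B) \<and>
     (\<forall>B\<in>\<P>. \<forall>B'\<in>\<P>. B \<noteq> B' \<longrightarrow> \<Union>B \<inter> \<Union>B' = {})"

lemma ex_components_of: "finite E \<Longrightarrow> \<exists>\<P>. components_of E \<P>"
proof (induction "card E" arbitrary: E rule: less_induct)
  case less
  show ?case
  proof (cases "E = {} \<or> connected_edges E")
    case True
    then show ?thesis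
    proof
      assume "E = {}" then show ?thesis by (intro exI[of _ "{}"]) (simp add: components_of_def)
    next
      assume "connected_edges E"
      then show ?thesis by (intro exI[of _ "{E}"]) (simp add: components_of_def)
    qed
  next
    case False
    then obtain B where B: "B \<subset> E" "B \<noteq> {}" and sep: "\<forall>e1\<in>B. \<forall>e2\<in>E - B. e1 \<inter> e2 = {}"
      by (auto simp: connected_edges_def)
    have fin: "finite B" "finite (E - B)" using B less.prems finite_subset by auto
    have "card B < card E" "card (E - B) < card E"
      using B less.prems by (auto intro!: psubset_card_mono)
    then obtain P Q where P: "components_of B P" and Q: "components_of (E - B) Q"
      using less.hyps fin by meson
    have "components_of E (P \<union> Q)" unfolding components_of_def
    proof (intro conjI ballI impI)
      show "\<Union>(P \<union> Q) = E" using P Q B(1) by (auto simp: components_of_def)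
      show "finite (P \<union> Q)" using P Q by (simp add: components_of_def)
      show "connected_edges U" if "U \<in> P \<union> Q" for U using that P Q by (auto simp: components_of_def)
      have PQ: "\<Union>U \<inter> \<Union>W = {}" if "U \<in> P" "W \<in> Q" for U W
      proof -
        have "U \<subseteq> B" "W \<subseteq> E - B" using that P Q by (auto simp: components_of_def)
        then show ?thesis using sep by fastforce
      qed
      fix U W assume XY: "U \<in> P \<union> Q" "W \<in> P \<union> Q" "U \<noteq> W"
      show "\<Union>U \<inter> \<Union>W = {}"
        using XY PQ[of U W] PQ[of W U] P Q unfolding components_of_def by (metis Un_iff inf_commute)
    qed
    then show ?thesis by blast
  qed
qed

lemma components_of_Diff:
  assumes "components_of E \<P>" "B \<in> \<P>"
  shows "components_of (\<Union>(\<P> - {B})) (\<P> - {B})" "E = B \<union> \<Union>(\<P> - {B})"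
    "\<Union>B \<inter> \<Union>(\<Union>(\<P> - {B})) = {}"
proof -
  show "components_of (\<Union>(\<P> - {B})) (\<P> - {B})" "E = B \<union> \<Union>(\<P> - {B})"
    using assms by (auto simp: components_of_def)
  have "\<Union>B \<inter> \<Union>B' = {}" if "B' \<in> \<P> - {B}" for B'
    using assms that unfolding components_of_def by (metis DiffE insertI1)
  then show "\<Union>B \<inter> \<Union>(\<Union>(\<P> - {B})) = {}" by blast
qed

text \<open>Splitting off a component adds the cover numbers and multiplies the lower bounds on the
  numbers of covers; \<open>card_covers_gt\<close> supplies the factor
  \<open>k B + 1\<close>.\<close>

lemma well_covered_components:
  assumes "components_of E \<P>" "edge_set E" "well_covered E c"
  shows "\<exists>k. (\<forall>B\<in>\<P>. well_covered B (k B)) \<and> c = (\<Sum>B\<in>\<P>. k B) \<and>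
    (\<Prod>B\<in>\<P>. k B + 1) \<le> card (covers_of_card E c)"
  using assms
proof (induction "card \<P>" arbitrary: E \<P> c)
  case 0
  then have P: "\<P> = {}" "E = {}" by (auto simp: components_of_def)
  have "covers_of_card E c \<noteq> {}" using well_coveredD(2) 0 by blast
  then have "c = 0" "1 \<le> card (covers_of_card E c)" using P by (auto simp: covers_of_card_def Suc_le_eq card_gt_0_iff)
  then show ?case using P by auto
next
  case (Suc n)
  then obtain B where B: "B \<in> \<P>" by (metis card.empty ex_in_conv nat.distinct(1))
  note D = components_of_Diff[OF Suc.prems(1) B]
  let ?Q = "\<P> - {B}"
  have fin: "finite \<P>" using Suc.prems(1) by (simp add: components_of_def)
  have n: "n = card ?Q" using Suc.hyps(2) B by simp
  have EE: "edge_set (B \<union> \<Union>?Q)" "well_covered (B \<union> \<Union>?Q) c" using Suc.prems(2,3) D(2) by auto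
  obtain c1 c2 where c: "c = c1 + c2" "well_covered B c1" "well_covered (\<Union>?Q) c2"
    and le: "card (covers_of_card B c1) * card (covers_of_card (\<Union>?Q) c2) \<le> card (covers_of_card E c)"
    using well_covered_split[OF EE(1) D(3) EE(2)] D(2) by auto
  have eB: "edge_set B" and eQ: "edge_set (\<Union>?Q)" using EE(1) edge_set_subset by blast+
  obtain k where k: "\<forall>B\<in>?Q. well_covered B (k B)" "c2 = (\<Sum>B\<in>?Q. k B)"
    "(\<Prod>B\<in>?Q. k B + 1) \<le> card (covers_of_card (\<Union>?Q) c2)"
    using Suc.hyps(1)[OF n D(1) eQ c(3)] by auto
  let ?k = "k(B := c1)"
  have "(\<Sum>U\<in>\<P>. ?k U) = c1 + (\<Sum>U\<in>?Q. ?k U)" using fin B by (simp add: sum.remove)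
  also have "(\<Sum>U\<in>?Q. ?k U) = c2" unfolding k(2) by (intro sum.cong) auto
  finally have s: "c = (\<Sum>U\<in>\<P>. ?k U)" using c(1) by simp
  have "(\<Prod>U\<in>\<P>. ?k U + 1) = (c1 + 1) * (\<Prod>U\<in>?Q. ?k U + 1)" using fin B by (simp add: prod.remove)
  also have "(\<Prod>U\<in>?Q. ?k U + 1) = (\<Prod>U\<in>?Q. k U + 1)" by (intro prod.cong) auto
  also have "(c1 + 1) * (\<Prod>U\<in>?Q. k U + 1) \<le> card (covers_of_card B c1) * card (covers_of_card (\<Union>?Q) c2)"
    using card_covers_gt[OF eB c(2)] k(3) by (rule mult_le_mono)
  also have "\<dots> \<le> card (covers_of_card E c)" by (rule le)
  finally show ?case using s k(1) c(2) by (intro exI[of _ ?k]) auto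
qed

text \<open>Edges are added one at a time, always next to an edge already chosen when there is one:
  such an edge contributes at most one new vertex.\<close>

lemma ex_edges_few_vertices:
  assumes "components_of E \<P>" "edge_set E" "i \<le> card E"
  shows "\<exists>T\<subseteq>E. card T = i \<and> card (\<Union>T) \<le> i + card {B\<in>\<P>. T \<inter> B \<noteq> {}}"
  using assms(3)
proof (induction i)
  case 0 then show ?case by (intro exI[of _ "{}"]) simp
next
  case (Suc i)
  have finP: "finite \<P>" and UP: "\<Union>\<P> = E" using assms(1) by (auto simp: components_of_def)
  obtain T where T: "T \<subseteq> E" "card T = i" "card (\<Union>T) \<le> i + card {B\<in>\<P>. T \<inter> B \<noteq> {}}"
    using Suc by auto
  have finT: "finite T" using T edge_setD(1)[OF assms(2)] finite_subset by blast
  have finUT: "finite (\<Union>T)" using edge_setD(4)[OF edge_set_subset[OF assms(2) T(1)]] .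
  have "card T \<noteq> card E" using T(2) Suc.prems by linarith
  then have "T \<noteq> E" by metis
  then obtain e0 where e0: "e0 \<in> E - T" using T(1) by blast
  have mono: "card {B\<in>\<P>. T \<inter> B \<noteq> {}} \<le> card {B\<in>\<P>. insert e T \<inter> B \<noteq> {}}" for e
  proof (rule card_mono)
    show "finite {B\<in>\<P>. insert e T \<inter> B \<noteq> {}}" using finP by simp
  qed blast
  show ?case
  proof (cases "\<exists>e\<in>E - T. e \<inter> \<Union>T \<noteq> {}")
    case True
    then obtain e where e: "e \<in> E - T" "e \<inter> \<Union>T \<noteq> {}" by blast
    have fe: "finite e" "card e = 2" using edge_setD[OF assms(2)] e by auto
    have pos: "0 < card (e \<inter> \<Union>T)" using e(2) fe by (simp add: card_gt_0_iff)
    have "card (\<Union>(insert e T)) + card (e \<inter> \<Union>T) = card e + card (\<Union>T)"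
      using card_Un_Int[OF fe(1) finUT] by simp
    then have "card (\<Union>(insert e T)) \<le> card (\<Union>T) + 1" using pos fe by linarith
    then have "card (\<Union>(insert e T)) \<le> Suc i + card {B\<in>\<P>. insert e T \<inter> B \<noteq> {}}"
      using T(3) mono[of e] by linarith
    then show ?thesis using T e finT by (intro exI[of _ "insert e T"]) auto
  next
    case False
    obtain B where B: "B \<in> \<P>" "e0 \<in> B" using e0 UP by blast
    \<comment> \<open>If \<open>T\<close> had already entered \<open>B\<close>, connectedness of
      \<open>B\<close> would supply a new edge touching \<open>T\<close>. So the two new vertices
      are paid for by one more edge and one more component.\<close>
    have TB: "T \<inter> B = {}"
    proof (rule ccontr)
      assume ne: "T \<inter> B \<noteq> {}"
      have "T \<inter> B \<subset> B" using B e0 by blast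
      moreover have "connected_edges B" using assms(1) B by (simp add: components_of_def)
      ultimately obtain e1 e2 where "e1 \<in> T \<inter> B" "e2 \<in> B - T \<inter> B" "e1 \<inter> e2 \<noteq> {}"
        using ne unfolding connected_edges_def by blast
      moreover from this have "e2 \<in> E - T" using B UP by blast
      ultimately show False using False by blast
    qed
    have fe: "finite e0" "card e0 = 2" using edge_setD[OF assms(2)] e0 by auto
    have "card (\<Union>(insert e0 T)) \<le> card e0 + card (\<Union>T)" using card_Un_le[of e0 "\<Union>T"] by simp
    moreover have "Suc (card {B\<in>\<P>. T \<inter> B \<noteq> {}}) \<le> card {B\<in>\<P>. insert e0 T \<inter> B \<noteq> {}}"
    proof -
      have "Suc (card {B\<in>\<P>. T \<inter> B \<noteq> {}}) = card (insert B {B\<in>\<P>. T \<inter> B \<noteq> {}})"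
        using TB finP by simp
      also have "\<dots> \<le> card {B\<in>\<P>. insert e0 T \<inter> B \<noteq> {}}"
        using B finP by (intro card_mono) auto
      finally show ?thesis .
    qed
    ultimately have "card (\<Union>(insert e0 T)) \<le> Suc i + card {B\<in>\<P>. insert e0 T \<inter> B \<noteq> {}}"
      using T(3) fe by linarith
    then show ?thesis using T e0 finT by (intro exI[of _ "insert e0 T"]) auto
  qed
qed

text \<open>With \<open>i = s + l\<close>, the quotient of \<open>i + r\<close> by \<open>i\<close>
  is at most that of \<open>l + 1\<close> by \<open>l\<close> exactly when
  \<open>r * l \<le> s + l\<close>, which the assumption gives for \<open>l \<le> k\<close>. These
  quotients telescope to \<open>k + 1\<close>.\<close>

lemma prod_shift_le:
  assumes "(r - 1) * k \<le> s"
  shows "(\<Prod>i=s+1..s+k. i + r) \<le> (k + 1) * (\<Prod>i=s+1..s+k. i :: nat)"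
proof -
  \<comment> \<open>The telescoping bound with denominators cleared: the factorials are the products
    of the numbers \<open>l\<close> and of the numbers \<open>l + 1\<close>.\<close>
  have *: "(\<Prod>l=1..j. s + l + r) * fact j \<le> fact (Suc j) * (\<Prod>l=1..j. s + l)" if "j \<le> k" for j
    using that
  proof (induction j)
    case (Suc j)
    have "r * Suc j \<le> s + Suc j"
    proof (cases r)
      case (Suc r')
      have "r' * Suc j \<le> r' * k" using Suc.prems by (rule mult_le_mono2)
      then show ?thesis using assms Suc by simp
    qed simp
    then have "(s + Suc j + r) * Suc j \<le> Suc (Suc j) * (s + Suc j)" by (simp add: algebra_simps)
    from mult_le_mono[OF Suc.IH this] Suc.prems show ?case by (simp add: algebra_simps)
  qed simp
  have "(\<Prod>l=1..k. s + l + r) * fact k \<le> ((k + 1) * (\<Prod>l=1..k. s + l)) * fact k"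
    using *[of k] by (simp add: algebra_simps)
  then have "(\<Prod>l=1..k. s + l + r) \<le> (k + 1) * (\<Prod>l=1..k. s + l)"
    by (simp only: mult_le_cancel2) simp
  moreover have "(\<Prod>i=s+1..s+k. f i) = (\<Prod>l=1..k. f (s + l))" for f :: "nat \<Rightarrow> nat"
    using prod.shift_bounds_cl_nat_ivl[of f 1 s k] by (simp add: add.commute)
  ultimately show ?thesis by simp
qed

text \<open>The component with the least \<open>k B\<close> takes the top \<open>k B\<close>
  indices, where edges from all components may be used. Minimality says that each of the others
  contributes at least \<open>k B\<close> to the sum \<open>s\<close>, which is the hypothesis of
  \<open>prod_shift_le\<close> for \<open>r = card \<P>\<close>. The indices up to \<open>s\<close>
  go to the remaining graph.\<close>

lemma prod_min_span_components:
  assumes "components_of E \<P>" "edge_set E" "\<And>B. B \<in> \<P> \<Longrightarrow> k B \<le> card B"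
  shows "(\<Prod>i=1..(\<Sum>B\<in>\<P>. k B). min_span E i) \<le> (\<Prod>B\<in>\<P>. k B + 1) * fact (\<Sum>B\<in>\<P>. k B)"
  using assms
proof (induction "card \<P>" arbitrary: E \<P>)
  case 0
  then have "\<P> = {}" by (auto simp: components_of_def)
  then show ?case by simp
next
  case (Suc n)
  have fin: "finite \<P>" and ne: "\<P> \<noteq> {}" using Suc by (auto simp: components_of_def)
  define B where "B = arg_min_on k \<P>"
  have B: "B \<in> \<P>" and min: "\<And>U. U \<in> \<P> \<Longrightarrow> k B \<le> k U"
    using arg_min_if_finite[OF fin ne, of k] arg_min_least[OF fin ne, of _ k] by (auto simp: B_def)
  note D = components_of_Diff[OF Suc.prems(1) B]
  let ?Q = "\<P> - {B}"
  let ?s = "\<Sum>U\<in>?Q. k U"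
  have n: "n = card ?Q" using Suc.hyps(2) B by simp
  have eQ: "edge_set (\<Union>?Q)" and eB: "edge_set B" using Suc.prems(2) D(2) edge_set_subset by blast+
  have dis: "B \<inter> \<Union>?Q = {}"
  proof (rule equals0I)
    fix e assume e: "e \<in> B \<inter> \<Union>?Q"
    then have "e = {}" using D(3) by blast
    then show False using edge_setD(2)[OF eB] e by fastforce
  qed
  have IH: "(\<Prod>i=1..?s. min_span (\<Union>?Q) i) \<le> (\<Prod>U\<in>?Q. k U + 1) * fact ?s"
    using Suc.hyps(1)[OF n D(1) eQ] Suc.prems(3) by auto
  have finQ: "finite (\<Union>?Q)" using edge_setD(1)[OF eQ] .
  have sQ: "?s \<le> card (\<Union>?Q)"
  proof -
    have "?s \<le> (\<Sum>U\<in>?Q. card U)" using Suc.prems(3) by (intro sum_mono) auto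
    also have "\<dots> = card (\<Union>?Q)"
    proof (rule card_Union_disjoint[symmetric])
      show "pairwise disjnt ?Q"
      proof (rule pairwiseI)
        fix U W assume XY: "U \<in> ?Q" "W \<in> ?Q" "U \<noteq> W"
        then have d: "\<Union>U \<inter> \<Union>W = {}" using Suc.prems(1) by (auto simp: components_of_def)
        show "disjnt U W" unfolding disjnt_def
        proof (rule equals0I)
          fix e assume e: "e \<in> U \<inter> W"
          then have "e = {}" using d by blast
          moreover have "e \<in> \<Union>?Q" using e XY by blast
          ultimately show False using edge_setD(2)[OF eQ] by fastforce
        qed
      qed
      show "\<And>A. A \<in> ?Q \<Longrightarrow> finite A" using finQ by (meson Union_upper finite_subset)
    qed
    finally show ?thesis .
  qed
  have E: "E = B \<union> \<Union>?Q" by (rule D(2))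
  have finE: "finite E" using edge_setD(1)[OF Suc.prems(2)] .
  have cardE: "card E = card B + card (\<Union>?Q)"
    unfolding E using dis edge_setD(1)[OF eB] finQ by (intro card_Un_disjoint)
  have tot: "(\<Sum>U\<in>\<P>. k U) = ?s + k B" using fin B by (simp add: sum.remove)
  have low: "min_span E i \<le> min_span (\<Union>?Q) i" if "i \<in> {1..?s}" for i
    using that sQ E finE by (intro min_span_mono) auto
  have high: "min_span E i \<le> i + card \<P>" if "i \<in> {?s+1..?s + k B}" for i
  proof -
    have "i \<le> card E" using that sQ cardE Suc.prems(3)[OF B] by auto
    then obtain T where T: "T \<subseteq> E" "card T = i" "card (\<Union>T) \<le> i + card {B\<in>\<P>. T \<inter> B \<noteq> {}}"
      using ex_edges_few_vertices[OF Suc.prems(1,2)] by blast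
    have "min_span E i \<le> card (\<Union>T)" using min_span_le[OF finE T(1)] T(2) by simp
    also have "\<dots> \<le> i + card {B\<in>\<P>. T \<inter> B \<noteq> {}}" by (rule T(3))
    also have "card {B\<in>\<P>. T \<inter> B \<noteq> {}} \<le> card \<P>" using fin by (intro card_mono) auto
    finally show ?thesis by simp
  qed
  have "(card \<P> - 1) * k B \<le> ?s"
  proof -
    have "(card \<P> - 1) * k B = (\<Sum>U\<in>?Q. k B)" using B by simp
    also have "\<dots> \<le> ?s" using min by (intro sum_mono) auto
    finally show ?thesis .
  qed
  note ps = prod_shift_le[OF this]
  have ivl: "{1..?s + k B} = {1..?s} \<union> {?s+1..?s + k B}" by auto
  have split: "(\<Prod>i=1..?s + k B. f i) = (\<Prod>i=1..?s. f i) * (\<Prod>i=?s+1..?s + k B. f i)" for f :: "nat \<Rightarrow> nat"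
    unfolding ivl by (intro prod.union_disjoint) auto
  have f: "fact (?s + k B) = fact ?s * (\<Prod>i=?s+1..?s + k B. i :: nat)"
    using split[of "\<lambda>i. i"] by (simp only: fact_prod of_nat_id)
  have "(\<Prod>i=1..?s + k B. min_span E i) \<le>
      (\<Prod>i=1..?s. min_span (\<Union>?Q) i) * (\<Prod>i=?s+1..?s + k B. i + card \<P>)"
    unfolding split using low high by (intro mult_le_mono prod_mono) auto
  also have "\<dots> \<le> ((\<Prod>U\<in>?Q. k U + 1) * fact ?s) * ((k B + 1) * (\<Prod>i=?s+1..?s + k B. i))"
    using IH ps by (rule mult_le_mono)
  also have "\<dots> = ((k B + 1) * (\<Prod>U\<in>?Q. k U + 1)) * fact (?s + k B)"
    unfolding f by (simp only: mult_ac)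
  also have "(k B + 1) * (\<Prod>U\<in>?Q. k U + 1) = (\<Prod>U\<in>\<P>. k U + 1)" using fin B by (simp add: prod.remove)
  finally show ?case unfolding tot .
qed

theorem card_min_covers_ge:
  assumes E: "edge_set E" and w: "well_covered E c"
  shows "(\<Prod>i=1..c. min_span E i) \<le> card (covers_of_card E c) * fact c"
proof -
  obtain \<P> where P: "components_of E \<P>" using ex_components_of edge_setD(1)[OF E] by blast
  obtain k where k: "\<forall>B\<in>\<P>. well_covered B (k B)" "c = (\<Sum>B\<in>\<P>. k B)"
    "(\<Prod>B\<in>\<P>. k B + 1) \<le> card (covers_of_card E c)"
    using well_covered_components[OF P E w] by blast
  have "k B \<le> card B" if B: "B \<in> \<P>" for B
  proof (rule cover_le_card_edges)
    show "edge_set B" using P B E edge_set_subset by (auto simp: components_of_def)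
    show "k B \<le> card C" if "finite C" "vertex_cover B C" for C
      using well_coveredD(1)[of B "k B"] k(1) B that by (auto intro: min_cover_number_le)
  qed
  from prod_min_span_components[OF P E this] show ?thesis
    unfolding k(2)[symmetric] using mult_right_mono[OF k(3), of "fact c"] by linarith
qed


section \<open>Monomial ideals\<close>

lemma ring_of_type_algebra_simps [simp]:
  "carrier (ring_of_type_algebra :: 'a::comm_ring_1 ring) = UNIV"
  "x \<otimes>\<^bsub>ring_of_type_algebra\<^esub> y = (x * y :: 'a)"
  "x \<oplus>\<^bsub>ring_of_type_algebra\<^esub> y = (x + y :: 'a)"
  "\<one>\<^bsub>ring_of_type_algebra\<^esub> = (1 :: 'a)"
  "\<zero>\<^bsub>ring_of_type_algebra\<^esub> = (0 :: 'a)"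
  by (simp_all add: ring_of_type_algebra_def)

lemma a_inv_ring_of_type_algebra [simp]:
  "\<ominus>\<^bsub>ring_of_type_algebra\<^esub> x = (- x :: 'a::comm_ring_1)"
proof -
  interpret ring "ring_of_type_algebra :: 'a ring" by (rule ring_from_type_algebra)
  show ?thesis by (rule minus_equality) simp_all
qed

lemma ideal_ring_of_type_algebra_iff:
  "ideal J (ring_of_type_algebra :: 'a::comm_ring_1 ring) \<longleftrightarrow>
     0 \<in> J \<and> (\<forall>a\<in>J. \<forall>b\<in>J. a + b \<in> J) \<and> (\<forall>a\<in>J. \<forall>r. r * a \<in> J)" (is "?L \<longleftrightarrow> ?R")
proof
  assume ?L
  then interpret ideal J "ring_of_type_algebra :: 'a ring" .
  show ?R
    using additive_subgroup.zero_closed[OF additive_subgroup_axioms]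
      additive_subgroup.a_closed[OF additive_subgroup_axioms] I_l_closed by auto
next
  assume R: ?R
  then have neg: "- a \<in> J" if "a \<in> J" for a using that by (metis mult_minus1)
  show ?L
  proof (rule idealI)
    show "subgroup J (add_monoid (ring_of_type_algebra :: 'a ring))"
    proof (rule subgroup.intro)
      show "\<And>x. x \<in> J \<Longrightarrow> inv\<^bsub>add_monoid (ring_of_type_algebra :: 'a ring)\<^esub> x \<in> J"
        by (simp only: a_inv_def[symmetric] a_inv_ring_of_type_algebra neg)
    qed (use R in auto)
  qed (use R in \<open>auto simp: mult.commute\<close>)
qed

lemma ideal_closed:
  assumes "ideal J (ring_of_type_algebra :: 'a::comm_ring_1 ring)"
  shows "0 \<in> J" "a \<in> J \<Longrightarrow> b \<in> J \<Longrightarrow> a + b \<in> J" "a \<in> J \<Longrightarrow> r * a \<in> J" "a \<in> J \<Longrightarrow> a * r \<in> J"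
    "a \<in> J \<Longrightarrow> - a \<in> J" "a \<in> J \<Longrightarrow> b \<in> J \<Longrightarrow> a - b \<in> J"
proof -
  show *: "0 \<in> J" "a \<in> J \<Longrightarrow> b \<in> J \<Longrightarrow> a + b \<in> J" "a \<in> J \<Longrightarrow> r * a \<in> J" for a b r
    using assms by (auto simp: ideal_ring_of_type_algebra_iff)
  show "a \<in> J \<Longrightarrow> a * r \<in> J" using *(3) by (simp add: mult.commute)
  show neg: "a \<in> J \<Longrightarrow> - a \<in> J" for a using *(3)[of a "-1"] by simp
  show "a \<in> J \<Longrightarrow> b \<in> J \<Longrightarrow> a - b \<in> J" using *(2)[of a "- b"] neg[of b] by simp
qed

lemma ideal_sum_closed:
  assumes "ideal J (ring_of_type_algebra :: 'a::comm_ring_1 ring)" "\<And>x. x \<in> S \<Longrightarrow> f x \<in> J"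
  shows "sum f S \<in> J"
  using assms(2) by (induction S rule: infinite_finite_induct) (auto intro: ideal_closed[OF assms(1)])

lemma primeideal_ring_of_type_algebra_iff:
  "primeideal J (ring_of_type_algebra :: 'a::comm_ring_1 ring) \<longleftrightarrow>
     ideal J (ring_of_type_algebra :: 'a ring) \<and> J \<noteq> UNIV \<and> (\<forall>a b. a * b \<in> J \<longrightarrow> a \<in> J \<or> b \<in> J)"
  (is "?L \<longleftrightarrow> ?R")
proof
  assume ?L
  then interpret primeideal J "ring_of_type_algebra :: 'a ring" .
  show ?R using ideal_axioms I_notcarr I_prime by auto
next
  assume ?R
  then show ?L by (intro primeidealI cring_from_type_algebra) auto
qed

lemma prime_one_notin:
  assumes "primeideal J (ring_of_type_algebra :: 'a::comm_ring_1 ring)"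
  shows "1 \<notin> J"
proof
  assume "1 \<in> J"
  then have "r \<in> J" for r
    using assms ideal_closed(3)[of J 1 r] by (auto simp: primeideal_ring_of_type_algebra_iff)
  then show False using assms by (auto simp: primeideal_ring_of_type_algebra_iff)
qed

lemma prime_power_notin:
  assumes "primeideal J (ring_of_type_algebra :: 'a::comm_ring_1 ring)" "a \<notin> J"
  shows "a ^ n \<notin> J"
  using assms prime_one_notin[OF assms(1)]
  by (induction n) (auto simp: primeideal_ring_of_type_algebra_iff)

lemma Idl_le: "ideal J R \<Longrightarrow> S \<subseteq> J \<Longrightarrow> Idl\<^bsub>R\<^esub> S \<subseteq> J"
  by (auto simp: genideal_def)

lemma Idl_ideal: "ideal (Idl\<^bsub>ring_of_type_algebra\<^esub> S) (ring_of_type_algebra :: 'a::comm_ring_1 ring)"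
  using ring.genideal_ideal[OF ring_from_type_algebra, of S] by simp

lemma subset_Idl: "S \<subseteq> Idl\<^bsub>(ring_of_type_algebra :: 'a::comm_ring_1 ring)\<^esub> S"
  by (auto simp: genideal_def)

section \<open>Divisibility and products of monomials\<close>

definition mono_dvd :: "'v monomial \<Rightarrow> 'v monomial \<Rightarrow> bool" where
  "mono_dvd s a \<longleftrightarrow> (\<forall>v. lookup s v \<le> lookup a v)"

lemma mono_dvd_iff: "mono_dvd s a \<longleftrightarrow> (\<exists>t. a = s + t)"
proof
  assume "mono_dvd s a"
  then have "a = s + (a - s)"
    by (intro poly_mapping_eqI) (simp add: lookup_add lookup_minus mono_dvd_def)
  then show "\<exists>t. a = s + t" ..
qed (auto simp: mono_dvd_def lookup_add)

lemma mono_dvd_refl [simp]: "mono_dvd a a"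
  by (simp add: mono_dvd_def)

lemma mono_dvd_trans: "mono_dvd a b \<Longrightarrow> mono_dvd b c \<Longrightarrow> mono_dvd a c"
  by (auto simp: mono_dvd_def intro: order_trans)

lemma mpoly_sum_monomials:
  "p = (\<Sum>a\<in>keys p. single a (lookup p a))"
proof (rule poly_mapping_eqI)
  fix b
  have "lookup (\<Sum>a\<in>keys p. single a (lookup p a)) b =
      (\<Sum>a\<in>keys p. if a = b then lookup p a else 0)"
    by (auto simp: lookup_sum lookup_single when_def intro!: sum.cong)
  also have "\<dots> = lookup p b" by (simp add: in_keys_iff)
  finally show "lookup p b =
      lookup (\<Sum>a\<in>keys p. single a (lookup p a)) b" ..
qed

text \<open>Writing the convolution as a finite sum over both supports makes it possible to isolate
  the contribution of one pair of monomials.\<close>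

lemma lookup_mult_keys:
  fixes p q :: "('v, 'k::field) mpoly"
  shows "lookup (p * q) c =
    (\<Sum>a\<in>keys p. \<Sum>b\<in>keys q.
       if a + b = c then lookup p a * lookup q b else 0)"
proof -
  have "p * q = (\<Sum>a\<in>keys p. \<Sum>b\<in>keys q.
      single (a + b) (lookup p a * lookup q b))"
    by (subst mpoly_sum_monomials[of p], subst mpoly_sum_monomials[of q])
      (simp add: sum_product mult_single)
  then show ?thesis by (auto simp: lookup_sum lookup_single when_def intro!: sum.cong)
qed

lemma lookup_single_mult:
  fixes q :: "('v, 'k::field) mpoly"
  shows "lookup (single s c * q) a =
    (if mono_dvd s a then c * lookup q (a - s) else 0)"
proof (cases "c = 0")
  case False
  have k: "keys (single s c) = {s}" using False by simp
  have "lookup (single s c * q) a =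
      (\<Sum>b\<in>keys q. if s + b = a then c * lookup q b else 0)"
    unfolding lookup_mult_keys k by (simp cong: if_cong)
  also have "\<dots> = (if mono_dvd s a then c * lookup q (a - s) else 0)"
  proof (cases "mono_dvd s a")
    case True
    then obtain t where t: "a = s + t" by (auto simp: mono_dvd_iff)
    have "(\<Sum>b\<in>keys q. if s + b = a then c * lookup q b else 0) =
        (\<Sum>b\<in>keys q. if b = t then c * lookup q b else 0)"
      unfolding t by simp
    also have "\<dots> = c * lookup q t" by (simp add: in_keys_iff)
    finally show ?thesis using True by (simp add: t)
  next
    case no: False
    then have "s + b \<noteq> a" for b by (auto simp: mono_dvd_iff)
    then show ?thesis using no by simp
  qed
  finally show ?thesis .
qed simp

lemma single_eq_scale_monom: "single a c = single 0 c * monom_of a"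
  by (simp add: monom_of_def mult_single)

lemma ideal_mem_if_monomials:
  assumes "ideal J (mpoly_ring :: ('v, 'k::field) mpoly ring)"
    "\<And>a. a \<in> keys p \<Longrightarrow> monom_of a \<in> J"
  shows "p \<in> J"
proof -
  have "(\<Sum>a\<in>keys p. single a (lookup p a)) \<in> J"
  proof (rule ideal_sum_closed[OF assms(1)])
    fix a assume "a \<in> keys p"
    then show "single a (lookup p a) \<in> J"
      using ideal_closed(3)[OF assms(1) assms(2)] by (subst single_eq_scale_monom) blast
  qed
  then show ?thesis using mpoly_sum_monomials[of p] by simp
qed

lemma monom_of_add: "monom_of (a + b) = monom_of a * monom_of b"
  by (simp add: monom_of_def mult_single)

lemma keys_monom_of [simp]: "keys (monom_of a) = {a}"
  by (simp add: monom_of_def)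

text \<open>Up-sets of monomials correspond to monomial ideals.\<close>

lemma ideal_of_upset:
  assumes "\<And>a b. a \<in> U \<Longrightarrow> a + b \<in> U"
  shows "ideal {p. keys p \<subseteq> U} (mpoly_ring :: ('v, 'k::field) mpoly ring)"
  unfolding ideal_ring_of_type_algebra_iff
proof (intro conjI ballI allI)
  fix p q :: "('v, 'k) mpoly" assume p: "p \<in> {p. keys p \<subseteq> U}"
  show "p + q \<in> {p. keys p \<subseteq> U}" if "q \<in> {p. keys p \<subseteq> U}"
    using p that keys_add[of p q] by auto
  show "q * p \<in> {p. keys p \<subseteq> U}"
  proof clarify
    fix c assume "c \<in> keys (q * p)"
    then obtain a b where "c = a + b" "b \<in> keys p" using keys_mult[of q p] by auto
    then show "c \<in> U" using p assms[of b a] by (auto simp: add.commute)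
  qed
qed simp

lemma Idl_monomials:
  "Idl\<^bsub>(mpoly_ring :: ('v, 'k::field) mpoly ring)\<^esub> (monom_of ` A) =
     {p. \<forall>a\<in>keys p. \<exists>b\<in>A. mono_dvd b a}"
proof
  let ?U = "{a. \<exists>b\<in>A. mono_dvd b a}"
  have "ideal {p :: ('v, 'k) mpoly. keys p \<subseteq> ?U} mpoly_ring"
    by (rule ideal_of_upset) (auto simp: mono_dvd_def lookup_add intro: le_trans trans_le_add1)
  then have "Idl\<^bsub>(mpoly_ring :: ('v, 'k) mpoly ring)\<^esub> (monom_of ` A) \<subseteq> {p. keys p \<subseteq> ?U}"
    by (rule Idl_le) (auto intro!: bexI[of _ "_ :: 'v monomial"] mono_dvd_refl)
  then show "Idl\<^bsub>(mpoly_ring :: ('v, 'k) mpoly ring)\<^esub> (monom_of ` A) \<subseteq>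
      {p. \<forall>a\<in>keys p. \<exists>b\<in>A. mono_dvd b a}" by blast
next
  let ?J = "Idl\<^bsub>(mpoly_ring :: ('v, 'k) mpoly ring)\<^esub> (monom_of ` A)"
  show "{p. \<forall>a\<in>keys p. \<exists>b\<in>A. mono_dvd b a} \<subseteq> ?J"
  proof clarify
    fix p :: "('v, 'k) mpoly" assume p: "\<forall>a\<in>keys p. \<exists>b\<in>A. mono_dvd b a"
    show "p \<in> ?J"
    proof (rule ideal_mem_if_monomials[OF Idl_ideal])
      fix a assume "a \<in> keys p"
      then obtain b t where b: "b \<in> A" "a = b + t" using p by (force simp: mono_dvd_iff)
      have "monom_of b \<in> ?J" using b(1) by (intro subsetD[OF subset_Idl] imageI)
      then show "monom_of a \<in> ?J" unfolding b(2) monom_of_add by (rule ideal_closed(4)[OF Idl_ideal])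
    qed
  qed
qed

lemma monomial_ideal_ideal: "monomial_ideal I \<Longrightarrow> ideal I mpoly_ring"
  by (auto simp: monomial_ideal_def intro: Idl_ideal)

lemma monomial_ideal_mem_iff:
  assumes "monomial_ideal (I :: ('v, 'k::field) mpoly set)"
  shows "p \<in> I \<longleftrightarrow> (\<forall>a\<in>keys p. monom_of a \<in> I)"
proof -
  obtain A where "I = {p. \<forall>a\<in>keys p. \<exists>b\<in>A. mono_dvd b a}"
    using assms Idl_monomials unfolding monomial_ideal_def by blast
  then show ?thesis by auto
qed

lemma monomial_ideal_upward:
  assumes "monomial_ideal I" "monom_of a \<in> I" "mono_dvd a b"
  shows "monom_of b \<in> I"
  using assms ideal_closed(4)[OF monomial_ideal_ideal[OF assms(1)]] by (auto simp: mono_dvd_iff monom_of_add)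

text \<open>The ideal generated by the variables in \<open>D\<close>, described through
  supports.\<close>

definition var_ideal :: "'v set \<Rightarrow> ('v, 'k::field) mpoly set" where
  "var_ideal D = {p. keys p \<subseteq> {a. \<exists>v\<in>D. lookup a v > 0}}"

abbreviation mvar :: "'v \<Rightarrow> 'v monomial" where
  "mvar v \<equiv> single v 1"

lemma ideal_var_ideal: "ideal (var_ideal D) mpoly_ring"
  unfolding var_ideal_def by (rule ideal_of_upset) (auto simp: lookup_add)

lemma monom_of_mem_var_ideal:
  "monom_of a \<in> var_ideal D \<longleftrightarrow> (\<exists>v\<in>D. lookup a v > 0)"
  by (auto simp: var_ideal_def)

text \<open>Numbering the variables carries monomials to
  \<open>nat \<Rightarrow>\<^sub>0 nat\<close>, whose linear order respects addition: it provides a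
  monomial order for variables without an order of their own.\<close>

lemma ex_total_preorder_monomials:
  fixes dummy :: "'v::finite"
  shows "\<exists>w :: 'v monomial \<Rightarrow> (nat \<Rightarrow>\<^sub>0 nat). inj w \<and> (\<forall>a b. w (a + b) = w a + w b)"
proof -
  obtain idx :: "'v \<Rightarrow> nat" where idx: "inj idx" using finite_imp_inj_to_nat_seg[of "UNIV :: 'v set"] by auto
  define w where "w a = (\<Sum>v\<in>UNIV. single (idx v) (lookup a v))" for a :: "'v monomial"
  have look: "lookup (w a) (idx v) = lookup a v" for a v
  proof -
    have "lookup (w a) (idx v) =
        (\<Sum>u\<in>UNIV. if u = v then lookup a u else 0)"
      unfolding w_def lookup_sum
      by (intro sum.cong) (auto simp: lookup_single when_def inj_eq[OF idx])
    then show ?thesis by simp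
  qed
  have "inj w" by (rule injI, rule poly_mapping_eqI) (metis look)
  moreover have "w (a + b) = w a + w b" for a b
    by (simp add: w_def lookup_add single_add sum.distrib)
  ultimately show ?thesis by blast
qed

text \<open>Primality: among the monomials free of \<open>D\<close>, the product of the two leading ones survives.\<close>

lemma primeideal_var_ideal: "primeideal (var_ideal D) (mpoly_ring :: ('v::finite, 'k::field) mpoly ring)"
  unfolding primeideal_ring_of_type_algebra_iff
proof (intro conjI allI impI)
  show "ideal (var_ideal D) mpoly_ring" by (rule ideal_var_ideal)
  have "(1 :: ('v, 'k) mpoly) \<notin> var_ideal D" by (simp add: var_ideal_def)
  then show "var_ideal D \<noteq> (UNIV :: ('v, 'k) mpoly set)" by blast
  fix p q :: "('v, 'k) mpoly" assume pq: "p * q \<in> var_ideal D"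
  show "p \<in> var_ideal D \<or> q \<in> var_ideal D"
  proof (rule ccontr)
    assume "\<not> (p \<in> var_ideal D \<or> q \<in> var_ideal D)"
    let ?free = "\<lambda>a :: 'v monomial. \<forall>v\<in>D. lookup a v = 0"
    define A where "A = {a\<in>keys p. ?free a}"
    define B where "B = {b\<in>keys q. ?free b}"
    have ne: "A \<noteq> {}" "B \<noteq> {}" and fin: "finite A" "finite B"
      using \<open>\<not> (p \<in> var_ideal D \<or> q \<in> var_ideal D)\<close> by (auto simp: A_def B_def var_ideal_def)
    obtain w :: "'v monomial \<Rightarrow> (nat \<Rightarrow>\<^sub>0 nat)" where inj: "inj w" and hom: "\<And>a b. w (a + b) = w a + w b"
      using ex_total_preorder_monomials by blast
    obtain a where a: "a \<in> A" "w a = Max (w ` A)" using Max_in[of "w ` A"] ne fin by fastforce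
    obtain b where b: "b \<in> B" "w b = Max (w ` B)" using Max_in[of "w ` B"] ne fin by fastforce
    \<comment> \<open>Factors of a monomial free of \<open>D\<close> are free of \<open>D\<close>,
      so they compete in \<open>A\<close> and \<open>B\<close>; by strict monotonicity only the two
      maxima reach the weight of \<open>a + b\<close>.\<close>
    have uniq: "a' = a \<and> b' = b"
      if "a' \<in> keys p" "b' \<in> keys q" "a' + b' = a + b" for a' b'
    proof -
      have "?free (a + b)" using a b by (auto simp: A_def B_def lookup_add)
      then have "?free a'" "?free b'" unfolding that(3)[symmetric] by (simp_all add: lookup_add)
      then have mem: "a' \<in> A" "b' \<in> B" using that by (auto simp: A_def B_def)
      have le: "w a' \<le> w a" "w b' \<le> w b" using a b fin mem by auto
      have sum: "w a' + w b' = w a + w b" using that(3) hom by metis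
      have "w a' = w a"
      proof (rule ccontr)
        assume "w a' \<noteq> w a"
        then have "w a' + w b' < w a + w b" using le by (intro add_less_le_mono) auto
        then show False using sum by simp
      qed
      then show ?thesis using sum inj by (auto simp: inj_eq)
    qed
    have "lookup (p * q) (a + b) =
        (\<Sum>a'\<in>keys p. \<Sum>b'\<in>keys q.
          if a' = a \<and> b' = b then lookup p a' * lookup q b' else 0)"
      unfolding lookup_mult_keys using uniq by (intro sum.cong refl if_cong) auto
    also have "\<dots> = (\<Sum>a'\<in>keys p. if a' = a then
        lookup p a' * lookup q b else 0)"
      using b(1) by (intro sum.cong refl) (auto simp: B_def)
    also have "\<dots> = lookup p a * lookup q b" using a(1) by (auto simp: A_def)
    finally have "lookup (p * q) (a + b) \<noteq> 0"
      using a(1) b(1) by (auto simp: A_def B_def in_keys_iff)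
    then have "a + b \<in> keys (p * q)" by (simp add: in_keys_iff)
    moreover have "?free (a + b)" using a b by (auto simp: A_def B_def lookup_add)
    ultimately show False using pq by (fastforce simp: var_ideal_def)
  qed
qed


section \<open>Chains of primes in a polynomial ring\<close>

text \<open>A family with a repetition is dependent although its image set may not be; hence the
  separate relation with coefficients 1 and -1 when \<open>f\<close> is not injective.\<close>

lemma (in vector_space) ex_nontrivial_relation:
  fixes A :: "'c set"
  assumes "finite A" "finite B" "f ` A \<subseteq> span B" "card B < card A"
  shows "\<exists>F :: 'c \<Rightarrow> 'a. (\<exists>e\<in>A. F e \<noteq> 0) \<and> (\<Sum>e\<in>A. scale (F e) (f e)) = 0"
proof (cases "inj_on f A")
  case True
  have "dependent (f ` A)"
  proof (rule ccontr)
    assume "\<not> dependent (f ` A)"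
    from independent_span_bound[OF assms(2) this assms(3)] show False
      using assms(4) by (simp add: card_image True)
  qed
  then obtain u where u: "\<exists>v\<in>f ` A. u v \<noteq> 0" "(\<Sum>v\<in>f ` A. scale (u v) v) = 0"
    using assms(1) by (auto simp: dependent_finite)
  then show ?thesis using True by (intro exI[of _ "u \<circ> f"]) (auto simp: sum.reindex)
next
  case False
  then obtain a b where ab: "a \<in> A" "b \<in> A" "a \<noteq> b" "f a = f b" by (auto simp: inj_on_def)
  let ?F = "\<lambda>e. if e = a then (1 :: 'a) else if e = b then - 1 else 0"
  have "(\<Sum>e\<in>A. scale (?F e) (f e)) = (\<Sum>e\<in>{a, b}. scale (?F e) (f e))"
    using assms(1) ab by (intro sum.mono_neutral_right) auto
  also have "\<dots> = scale (?F a) (f a) + scale (?F b) (f b)" using ab(3) by (simp del: scale_left_distrib)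
  also have "\<dots> = 0" using ab(3,4) by simp
  finally have s0: "(\<Sum>e\<in>A. scale (?F e) (f e)) = 0" .
  have nz: "\<exists>e\<in>A. ?F e \<noteq> 0" using ab(1) by (intro bexI[of _ a]) auto
  show ?thesis by (rule exI[of _ ?F]) (rule conjI[OF nz s0])
qed

text \<open>Bounding each exponent, instead of the total degree, makes the count a power of
  \<open>N + 1\<close>, to be compared with the count of exponent lists.\<close>

definition monomial_box :: "nat \<Rightarrow> 'v monomial set" where
  "monomial_box N = {a. \<forall>v. lookup a v \<le> N}"

lemma monomial_box_card:
  "finite (monomial_box N :: 'v::finite monomial set)"
  "card (monomial_box N :: 'v monomial set) \<le> (N + 1) ^ card (UNIV :: 'v set)"
proof -
  let ?F = "PiE (UNIV :: 'v set) (\<lambda>_. {..N})"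
  have inj: "inj_on lookup (monomial_box N :: 'v monomial set)"
    by (rule inj_onI, rule poly_mapping_eqI) simp
  have sub: "lookup ` (monomial_box N :: 'v monomial set) \<subseteq> ?F"
    by (auto simp: monomial_box_def)
  have fin: "finite ?F" by (intro finite_PiE) auto
  show "finite (monomial_box N :: 'v monomial set)"
    using inj sub fin by (meson finite_imageD finite_subset)
  have "card (monomial_box N :: 'v monomial set) \<le> card ?F"
    by (rule card_inj_on_le[OF inj sub fin])
  also have "card ?F = (N + 1) ^ card (UNIV :: 'v set)" by (simp add: card_PiE)
  finally show "card (monomial_box N :: 'v monomial set) \<le> (N + 1) ^ card (UNIV :: 'v set)" .
qed

lemma keys_mult_box:
  fixes p q :: "('v, 'k::field) mpoly"
  assumes "keys p \<subseteq> monomial_box M" "keys q \<subseteq> monomial_box N"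
  shows "keys (p * q) \<subseteq> monomial_box (M + N)"
proof
  fix c assume "c \<in> keys (p * q)"
  then obtain a b where "c = a + b" "a \<in> keys p" "b \<in> keys q"
    using keys_mult[of p q] by auto
  then show "c \<in> monomial_box (M + N)"
    using assms by (force simp: monomial_box_def lookup_add intro: add_mono)
qed

lemma keys_power_box:
  fixes p :: "('v, 'k::field) mpoly"
  assumes "keys p \<subseteq> monomial_box M"
  shows "keys (p ^ n) \<subseteq> monomial_box (n * M)"
proof (induction n)
  case 0 then show ?case by (simp add: monomial_box_def)
next
  case (Suc n)
  then show ?case using keys_mult_box[OF assms Suc] by simp
qed

fun power_list :: "'a::comm_ring_1 list \<Rightarrow> nat list \<Rightarrow> 'a" where
  "power_list (x # xs) (e # es) = x ^ e * power_list xs es"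
| "power_list _ _ = 1"

lemma keys_power_list_box:
  fixes ps :: "('v, 'k::field) mpoly list"
  assumes "\<And>p. p \<in> set ps \<Longrightarrow> keys p \<subseteq> monomial_box M" "\<And>e. e \<in> set es \<Longrightarrow> e \<le> N"
  shows "keys (power_list ps es) \<subseteq> monomial_box (length ps * N * M)"
  using assms
proof (induction ps es rule: power_list.induct)
  case (1 p ps e es)
  have "keys (p ^ e) \<subseteq> monomial_box (e * M)" using 1 by (intro keys_power_box) auto
  also have "\<dots> \<subseteq> monomial_box (N * M)" using 1(3)[of e] by (auto simp: monomial_box_def intro: order_trans)
  finally have "keys (p ^ e) \<subseteq> monomial_box (N * M)" .
  from keys_mult_box[OF this 1(1)] 1(2,3) show ?case by (simp add: algebra_simps)
qed (auto simp: monomial_box_def)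

lemma vector_space_mpoly:
  "vector_space (\<lambda>c (p :: ('v, 'k::field) mpoly). single 0 c * p)"
  by unfold_locales
    (simp_all add: algebra_simps single_add mult_single flip: mult.assoc)

text \<open>More than \<open>n\<close> polynomials in \<open>n\<close> variables are algebraically dependent: their products with
  exponents at most \<open>N\<close> outnumber the monomials they involve when \<open>N\<close> is large.\<close>

lemma ex_algebraic_relation:
  fixes ps :: "('v::finite, 'k::field) mpoly list"
  assumes len: "length ps = card (UNIV :: 'v set) + 1"
  shows "\<exists>E F. finite E \<and> E \<noteq> {} \<and> (\<forall>e\<in>E. length e = length ps \<and> F e \<noteq> 0) \<and>
    (\<Sum>e\<in>E. single 0 (F e) * power_list ps e) = 0"
proof -
  interpret vector_space "\<lambda>c (p :: ('v, 'k::field) mpoly). single 0 c * p"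
    by (rule vector_space_mpoly)
  obtain M where M: "\<And>p. p \<in> set ps \<Longrightarrow> keys p \<subseteq> monomial_box M"
  proof -
    let ?S = "{lookup a v | p a v. p \<in> set ps \<and> a \<in> keys p}"
    have "?S = (\<Union>p\<in>set ps. \<Union>a\<in>keys p. lookup a ` UNIV)" by auto
    then have "finite ?S" by simp
    then have "keys p \<subseteq> monomial_box (Max ?S)" if "p \<in> set ps" for p
      using that by (auto simp: monomial_box_def intro!: Max_ge)
    then show ?thesis using that by blast
  qed
  let ?n = "card (UNIV :: 'v set)"
  \<comment> \<open>Chosen so that the box has at most \<open>K * (N + 1)\<close> values per
    variable, and \<open>K\<close> to the power \<open>n\<close> is \<open>N\<close>: the box then
    has at most \<open>N * (N + 1) ^ n\<close> monomials, fewer than the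
    \<open>(N + 1) ^ (n + 1)\<close> products.\<close>
  define K where "K = (?n + 1) * M + 1"
  define N where "N = K ^ ?n"
  let ?A = "{e :: nat list. set e \<subseteq> {..N} \<and> length e = ?n + 1}"
  let ?B = "monom_of ` (monomial_box ((?n + 1) * N * M)) :: ('v, 'k) mpoly set"
  have finA: "finite ?A" using finite_lists_length_eq[of "{..N}" "?n + 1"] by simp
  have cardA: "card ?A = (N + 1) ^ (?n + 1)" using card_lists_length_eq[of "{..N}" "?n + 1"] by simp
  have finB: "finite ?B" using monomial_box_card(1) by (intro finite_imageI)
  have "card ?B \<le> card (monomial_box ((?n + 1) * N * M) :: 'v monomial set)"
    using monomial_box_card(1) by (rule card_image_le)
  also have "\<dots> \<le> ((?n + 1) * N * M + 1) ^ ?n" by (rule monomial_box_card(2))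
  also have "\<dots> \<le> (K * (N + 1)) ^ ?n"
    unfolding K_def by (intro power_mono) (simp_all add: algebra_simps)
  also have "\<dots> = N * (N + 1) ^ ?n" by (simp only: power_mult_distrib N_def)
  also have "\<dots> < (N + 1) ^ (?n + 1)" by simp
  finally have less: "card ?B < card ?A" using cardA by simp
  have "power_list ps ` ?A \<subseteq> span ?B"
  proof clarify
    fix e :: "nat list" assume e: "set e \<subseteq> {..N}" "length e = ?n + 1"
    have k: "keys (power_list ps e) \<subseteq> monomial_box ((?n + 1) * N * M)"
      using keys_power_list_box[of ps M e N] M e len by auto
    have "(\<Sum>a\<in>keys (power_list ps e).
        single a (lookup (power_list ps e) a)) \<in> span ?B"
    proof (rule span_sum)
      fix a assume "a \<in> keys (power_list ps e)"
      then show "single a (lookup (power_list ps e) a) \<in> span ?B"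
        using k by (subst single_eq_scale_monom) (intro span_scale span_base, blast)
    qed
    then show "power_list ps e \<in> span ?B" using mpoly_sum_monomials[of "power_list ps e"] by simp
  qed
  from ex_nontrivial_relation[OF finA finB this less] obtain F where F: "\<exists>e\<in>?A. F e \<noteq> 0"
    "(\<Sum>e\<in>?A. single 0 (F e) * power_list ps e) = 0" by blast
  let ?E = "{e\<in>?A. F e \<noteq> 0}"
  have "(\<Sum>e\<in>?E. single 0 (F e) * power_list ps e) =
      (\<Sum>e\<in>?A. single 0 (F e) * power_list ps e)"
    using finA by (intro sum.mono_neutral_left) auto
  then have s0: "(\<Sum>e\<in>?E. single 0 (F e) * power_list ps e) = 0" using F(2) by simp
  have finE: "finite ?E" using finA by (rule rev_finite_subset) blast
  have ne: "?E \<noteq> {}" and E: "\<forall>e\<in>?E. length e = length ps \<and> F e \<noteq> 0"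
    using F(1) len by auto
  show ?thesis by (rule exI[of _ ?E], rule exI[of _ F]) (rule conjI[OF finE conjI[OF ne conjI[OF E s0]]])
qed

text \<open>Elements picked along a chain of primes satisfy no algebraic relation; the argument isolates
  the part of a relation of lowest degree in the first element, as in the Coquand--Lombardi
  characterisation of dimension.\<close>

lemma algebraic_relation_notin_prime:
  fixes ps :: "('v, 'k::field) mpoly list"
  assumes "length Qs = length ps + 1" "\<And>Q. Q \<in> set Qs \<Longrightarrow> primeideal Q mpoly_ring"
    "\<And>i. i < length ps \<Longrightarrow> Qs ! i \<subseteq> Qs ! Suc i \<and> ps ! i \<in> Qs ! Suc i \<and> ps ! i \<notin> Qs ! i"
    "finite E" "E \<noteq> {}" "\<And>e. e \<in> E \<Longrightarrow> length e = length ps \<and> F e \<noteq> 0"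
  shows "(\<Sum>e\<in>E. single 0 (F e) * power_list ps e) \<notin> Qs ! 0"
  using assms
proof (induction ps arbitrary: Qs E F)
  case Nil
  then have E: "E = {[]}" by auto
  have pr: "primeideal (Qs ! 0) mpoly_ring" using Nil.prems(1,2) by (cases Qs) auto
  then have idl: "ideal (Qs ! 0) mpoly_ring" by (rule primeideal.axioms(1))
  have nz: "F [] \<noteq> 0" using Nil.prems E by auto
  show ?case
  proof
    assume "(\<Sum>e\<in>E. single 0 (F e) * power_list [] e) \<in> Qs ! 0"
    then have "single 0 (F []) \<in> Qs ! 0" using E by simp
    then have "single 0 (inverse (F [])) * single 0 (F []) \<in> Qs ! 0"
      by (rule ideal_closed(3)[OF idl])
    then show False using nz prime_one_notin[OF pr] by (simp add: mult_single)
  qed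
next
  case (Cons p ps)
  obtain Q0 Qs' where Qs: "Qs = Q0 # Qs'" using Cons.prems(1) by (cases Qs) auto
  have pr0: "primeideal Q0 mpoly_ring" using Cons.prems(2) Qs by auto
  have pr1: "primeideal (Qs' ! 0) mpoly_ring" using Cons.prems(1,2) Qs by (cases Qs') auto
  have idl: "ideal (Qs' ! 0) mpoly_ring" using pr1 by (rule primeideal.axioms(1))
  have p: "Q0 \<subseteq> Qs' ! 0" "p \<in> Qs' ! 0" "p \<notin> Q0" using Cons.prems(3)[of 0] Qs by auto
  define \<mu> where "\<mu> = Min (hd ` E)"
  have \<mu>: "\<mu> \<in> hd ` E" "\<And>e. e \<in> E \<Longrightarrow> \<mu> \<le> hd e"
    unfolding \<mu>_def using Cons.prems(4,5) by (auto intro: Min_in Min_le)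
  let ?t = "\<lambda>e. single 0 (F e) * power_list (p # ps) e"
  define E0 where "E0 = {e\<in>E. hd e = \<mu>}"
  define E1 where "E1 = {e\<in>E. hd e \<noteq> \<mu>}"
  define T where "T = tl ` E0"
  have e: "e = hd e # tl e" "length (tl e) = length ps" if "e \<in> E" for e
  proof -
    have "length e = Suc (length ps)" using Cons.prems(6)[OF that] by simp
    then show "e = hd e # tl e" "length (tl e) = length ps" by (cases e; simp)+
  qed
  have E0: "E0 = (#) \<mu> ` T"
  proof -
    have "\<mu> # tl e = e" if "e \<in> E0" for e using e(1)[of e] that by (auto simp: E0_def)
    then have "(\<lambda>e. \<mu> # tl e) ` E0 = (\<lambda>e. e) ` E0" by (intro image_cong) auto
    then show ?thesis by (simp add: T_def image_image)
  qed
  have "(\<Sum>e\<in>T. single 0 (F (\<mu> # e)) * power_list ps e) \<notin> Qs' ! 0"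
  proof (rule Cons.IH)
    show "length Qs' = length ps + 1" using Cons.prems(1) Qs by simp
    show "\<And>Q. Q \<in> set Qs' \<Longrightarrow> primeideal Q mpoly_ring" using Cons.prems(2) Qs by auto
    show "Qs' ! i \<subseteq> Qs' ! Suc i \<and> ps ! i \<in> Qs' ! Suc i \<and> ps ! i \<notin> Qs' ! i" if "i < length ps" for i
      using Cons.prems(3)[of "Suc i"] that Qs by simp
    show "finite T" "T \<noteq> {}" using Cons.prems(4) \<mu>(1) by (auto simp: T_def E0_def)
    show "length e = length ps \<and> F (\<mu> # e) \<noteq> 0" if "e \<in> T" for e
    proof -
      have "\<mu> # e \<in> E" using that E0 by (auto simp: E0_def)
      then show ?thesis using Cons.prems(6) by force
    qed
  qed
  \<comment> \<open>Primality of \<open>Q0\<close> cancels the power of \<open>p\<close> common to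
    all terms; the terms still divisible by \<open>p\<close> then disappear modulo the next prime,
    which contains \<open>p\<close>.\<close>
  moreover have "(\<Sum>e\<in>T. single 0 (F (\<mu> # e)) * power_list ps e) \<in> Qs' ! 0"
    if "(\<Sum>e\<in>E. ?t e) \<in> Q0"
  proof -
    let ?S = "\<Sum>e\<in>T. single 0 (F (\<mu> # e)) * power_list ps e"
    let ?R = "\<Sum>e\<in>E1. single 0 (F e) * p ^ (hd e - Suc \<mu>) * power_list ps (tl e)"
    have S0: "(\<Sum>e\<in>E0. ?t e) = p ^ \<mu> * ?S"
      unfolding E0 by (simp add: sum.reindex sum_distrib_left algebra_simps)
    have S1: "(\<Sum>e\<in>E1. ?t e) = p ^ \<mu> * (p * ?R)"
    proof -
      have "?t e = p ^ \<mu> * (p * (single 0 (F e) * p ^ (hd e - Suc \<mu>) * power_list ps (tl e)))"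
        if "e \<in> E1" for e
      proof -
        have "e \<in> E" "\<mu> < hd e" using that \<mu>(2)[of e] by (auto simp: E1_def)
        then have "power_list (p # ps) e = p ^ hd e * power_list ps (tl e)" using e(1)
          by (metis power_list.simps(1))
        also have "hd e = \<mu> + Suc (hd e - Suc \<mu>)" using \<open>\<mu> < hd e\<close> by simp
        finally show ?thesis by (simp add: power_add algebra_simps)
      qed
      then show ?thesis by (simp add: sum_distrib_left)
    qed
    have "E = E0 \<union> E1" "E0 \<inter> E1 = {}" by (auto simp: E0_def E1_def)
    then have "(\<Sum>e\<in>E. ?t e) = (\<Sum>e\<in>E0. ?t e) + (\<Sum>e\<in>E1. ?t e)"
      using Cons.prems(4) by (simp add: sum.union_disjoint)
    then have "p ^ \<mu> * (?S + p * ?R) \<in> Q0" using that S0 S1 by (simp add: distrib_left)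
    then have "?S + p * ?R \<in> Q0"
      using pr0 prime_power_notin[OF pr0 p(3)] by (auto simp: primeideal_ring_of_type_algebra_iff)
    then have "?S + p * ?R \<in> Qs' ! 0" using p(1) by blast
    then have "(?S + p * ?R) - p * ?R \<in> Qs' ! 0"
      by (rule ideal_closed(6)[OF idl _ ideal_closed(4)[OF idl p(2)]])
    then show ?thesis by simp
  qed
  ultimately show ?case using Qs by auto
qed

text \<open>From \<open>n + 2\<close> primes in a chain, one element is picked in each of the
  \<open>n + 1\<close> successive differences. These polynomials satisfy a relation with value 0,
  and 0 lies in the first prime, against \<open>algebraic_relation_notin_prime\<close>.\<close>

theorem prime_chain_length_le:
  assumes "prime_chain (mpoly_ring :: ('v::finite, 'k::field) mpoly ring) Ps"
  shows "length Ps \<le> card (UNIV :: 'v set) + 1"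
proof (rule ccontr)
  assume "\<not> length Ps \<le> card (UNIV :: 'v set) + 1"
  then have len: "card (UNIV :: 'v set) + 2 \<le> length Ps" by simp
  define Qs where "Qs = take (card (UNIV :: 'v set) + 2) Ps"
  have lQ: "length Qs = card (UNIV :: 'v set) + 2" using len by (simp add: Qs_def)
  have pr: "\<And>Q. Q \<in> set Qs \<Longrightarrow> primeideal Q mpoly_ring"
    using assms by (auto simp: Qs_def prime_chain_def dest: in_set_takeD)
  have strict: "Qs ! i \<subset> Qs ! Suc i" if "i < card (UNIV :: 'v set) + 1" for i
  proof -
    have "sorted_wrt (\<subset>) Ps" using assms by (simp add: prime_chain_def)
    then have "Ps ! i \<subset> Ps ! Suc i" by (rule sorted_wrt_nth_less) (use that len in auto)
    then show ?thesis using that by (simp add: Qs_def)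
  qed
  define ps where "ps = map (\<lambda>i. SOME p. p \<in> Qs ! Suc i - Qs ! i) [0..<card (UNIV :: 'v set) + 1]"
  have lp: "length ps = card (UNIV :: 'v set) + 1" by (simp add: ps_def)
  have ps: "ps ! i \<in> Qs ! Suc i - Qs ! i" if "i < card (UNIV :: 'v set) + 1" for i
  proof -
    have "\<exists>p. p \<in> Qs ! Suc i - Qs ! i" using strict[OF that] by blast
    then have "(SOME p. p \<in> Qs ! Suc i - Qs ! i) \<in> Qs ! Suc i - Qs ! i" by (rule someI_ex)
    moreover have "ps ! i = (SOME p. p \<in> Qs ! Suc i - Qs ! i)"
      unfolding ps_def using that by (subst nth_map) (auto simp del: upt_Suc)
    ultimately show ?thesis by simp
  qed
  obtain E F where E: "finite E" "E \<noteq> {}" "\<forall>e\<in>E. length e = length ps \<and> F e \<noteq> 0"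
    "(\<Sum>e\<in>E. single 0 (F e) * power_list ps e) = 0"
    using ex_algebraic_relation[OF lp] by blast
  have "(\<Sum>e\<in>E. single 0 (F e) * power_list ps e) \<notin> Qs ! 0"
  proof (rule algebraic_relation_notin_prime)
    show "length Qs = length ps + 1" using lQ lp by simp
    show "Qs ! i \<subseteq> Qs ! Suc i \<and> ps ! i \<in> Qs ! Suc i \<and> ps ! i \<notin> Qs ! i" if "i < length ps" for i
      using strict[of i] ps[of i] that lp by auto
  qed (use E pr in auto)
  moreover have "Qs ! 0 \<in> set Qs" using lQ by simp
  then have "0 \<in> Qs ! 0" using pr ideal_closed(1) primeideal.axioms(1) by blast
  ultimately show False using E(4) by simp
qed


section \<open>Codimension and dimension of monomial ideals\<close>

context
  fixes J :: "'a::comm_ring_1 set"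
  assumes J: "ideal J ring_of_type_algebra"
begin

lemma quot_rcos_eq_iff:
  "coset J p = coset J q \<longleftrightarrow> p - q \<in> J"
proof
  assume eq: "coset J p = coset J q"
  have "p \<in> coset J p"
    using ideal_closed(1)[OF J] by (auto simp: a_r_coset_def' intro!: bexI[of _ 0])
  then obtain i where "i \<in> J" "p = i + q" unfolding eq by (auto simp: a_r_coset_def')
  then show "p - q \<in> J" by simp
next
  assume d: "p - q \<in> J"
  have "\<exists>j\<in>J. i + p = j + q" if "i \<in> J" for i
    using ideal_closed(2)[OF J that d] by (intro bexI[of _ "i + (p - q)"]) (simp_all add: algebra_simps)
  moreover have "\<exists>j\<in>J. i + q = j + p" if "i \<in> J" for i
    using ideal_closed(6)[OF J that d] by (intro bexI[of _ "i - (p - q)"]) (simp_all add: algebra_simps)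
  ultimately show "coset J p = coset J q"
    unfolding a_r_coset_def' by auto
qed

lemma quot_carrier: "carrier (ring_of_type_algebra Quot J) = range (coset J)"
  by (auto simp: FactRing_def A_RCOSETS_def')

lemma quot_hom: "ring_hom_ring ring_of_type_algebra (ring_of_type_algebra Quot J) (coset J)"
  using J by (rule ideal.rcos_ring_hom_ring)

lemma quot_mult: "(coset J p) \<otimes>\<^bsub>ring_of_type_algebra Quot J\<^esub> (coset J q) =
    coset J (p * q)"
  using ring_hom_mult[OF ideal.rcos_ring_hom[OF J], of p q] by simp

lemma quot_add: "(coset J p) \<oplus>\<^bsub>ring_of_type_algebra Quot J\<^esub> (coset J q) =
    coset J (p + q)"
  using ring_hom_add[OF ideal.rcos_ring_hom[OF J], of p q] by simp

lemma quot_zero: "\<zero>\<^bsub>ring_of_type_algebra Quot J\<^esub> = coset J 0"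
  using ring_hom_zero[OF ideal.rcos_ring_hom[OF J] ring_from_type_algebra ideal.quotient_is_ring[OF J]] by simp

lemma quot_one: "\<one>\<^bsub>ring_of_type_algebra Quot J\<^esub> = coset J 1"
  using ring_hom_one[OF ideal.rcos_ring_hom[OF J]] by simp

lemma quot_cring: "cring (ring_of_type_algebra Quot J)"
  using J cring_from_type_algebra by (rule ideal.quotient_is_cring)

lemma ideal_vimage_quot:
  assumes "ideal P (ring_of_type_algebra Quot J)"
  shows "ideal {p. coset J p \<in> P} ring_of_type_algebra"
    "J \<subseteq> {p. coset J p \<in> P}"
proof -
  show "ideal {p. coset J p \<in> P} ring_of_type_algebra"
    using ring_hom_ring.ideal_vimage[OF quot_hom assms] by simp
  have "coset J 0 \<in> P"
    using additive_subgroup.zero_closed[OF ideal.axioms(1)[OF assms]] by (simp add: quot_zero)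
  moreover have "coset J p = coset J 0" if "p \<in> J" for p
    using that by (simp add: quot_rcos_eq_iff)
  ultimately show "J \<subseteq> {p. coset J p \<in> P}" by auto
qed

lemma prime_vimage_quot:
  assumes "primeideal P (ring_of_type_algebra Quot J)"
  shows "primeideal {p. coset J p \<in> P} ring_of_type_algebra"
proof -
  interpret primeideal P "ring_of_type_algebra Quot J" by (rule assms)
  have "{p. coset J p \<in> P} \<noteq> UNIV"
  proof
    assume "{p. coset J p \<in> P} = UNIV"
    then have "carrier (ring_of_type_algebra Quot J) \<subseteq> P" by (auto simp: quot_carrier)
    then show False using I_notcarr a_subset by blast
  qed
  moreover have "p \<in> {p. coset J p \<in> P} \<or> q \<in> {p. coset J p \<in> P}"
    if "p * q \<in> {p. coset J p \<in> P}" for p q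
    using that I_prime[of "coset J p" "coset J q"]
    by (simp add: quot_mult quot_carrier)
  ultimately show ?thesis
    unfolding primeideal_ring_of_type_algebra_iff using ideal_vimage_quot(1)[OF ideal_axioms] by blast
qed

text \<open>An ideal containing \<open>J\<close> is a union of cosets of \<open>J\<close>, so
  passing to the quotient forgets nothing about it.\<close>

lemma rcos_mem_image_iff:
  assumes "ideal Q ring_of_type_algebra" "J \<subseteq> Q"
  shows "coset J p \<in> coset J ` Q \<longleftrightarrow> p \<in> Q"
proof
  assume "coset J p \<in> coset J ` Q"
  then obtain q where q: "q \<in> Q" "p - q \<in> J" by (auto simp: quot_rcos_eq_iff)
  then have "(p - q) + q \<in> Q" using assms(2) by (intro ideal_closed(2)[OF assms(1)]) auto
  then show "p \<in> Q" by simp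
qed auto

lemma ideal_image_quot:
  assumes "ideal Q ring_of_type_algebra"
  shows "ideal (coset J ` Q) (ring_of_type_algebra Quot J)"
proof (rule idealI)
  show "ring (ring_of_type_algebra Quot J)" using quot_cring by (rule cring.axioms(1))
  show "subgroup (coset J ` Q) (add_monoid (ring_of_type_algebra Quot J))"
    using ring_hom_ring.img_is_add_subgroup[OF quot_hom] additive_subgroup.a_subgroup[OF ideal.axioms(1)[OF assms]]
    by blast
  fix a x assume a: "a \<in> coset J ` Q" and x: "x \<in> carrier (ring_of_type_algebra Quot J)"
  obtain q r where q: "q \<in> Q" "a = coset J q" and r: "x = coset J r"
    using a x by (auto simp: quot_carrier)
  show "x \<otimes>\<^bsub>ring_of_type_algebra Quot J\<^esub> a \<in> coset J ` Q"
    unfolding q(2) r quot_mult using ideal_closed(3)[OF assms q(1)] by blast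
  show "a \<otimes>\<^bsub>ring_of_type_algebra Quot J\<^esub> x \<in> coset J ` Q"
    unfolding q(2) r quot_mult using ideal_closed(4)[OF assms q(1)] by blast
qed

lemma prime_image_quot:
  assumes "primeideal Q ring_of_type_algebra" "J \<subseteq> Q"
  shows "primeideal (coset J ` Q) (ring_of_type_algebra Quot J)"
proof (rule primeidealI)
  have Q: "ideal Q ring_of_type_algebra" using assms(1) by (rule primeideal.axioms(1))
  note mem = rcos_mem_image_iff[OF Q assms(2)]
  show "ideal (coset J ` Q) (ring_of_type_algebra Quot J)"
    by (rule ideal_image_quot[OF Q])
  show "cring (ring_of_type_algebra Quot J)" by (rule quot_cring)
  show "carrier (ring_of_type_algebra Quot J) \<noteq> coset J ` Q"
    using mem[of 1] prime_one_notin[OF assms(1)] by (auto simp: quot_carrier)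
  fix a b assume *: "a \<in> carrier (ring_of_type_algebra Quot J)" "b \<in> carrier (ring_of_type_algebra Quot J)"
    "a \<otimes>\<^bsub>ring_of_type_algebra Quot J\<^esub> b \<in> coset J ` Q"
  then obtain p q where ab: "a = coset J p" "b = coset J q"
    by (auto simp: quot_carrier)
  have "p * q \<in> Q" using *(3) unfolding ab quot_mult mem .
  then have "p \<in> Q \<or> q \<in> Q" using assms(1) by (auto simp: primeideal_ring_of_type_algebra_iff)
  then show "a \<in> coset J ` Q \<or> b \<in> coset J ` Q"
    unfolding ab mem .
qed

lemma prime_chain_image_quot:
  assumes "prime_chain ring_of_type_algebra Qs" "\<And>Q. Q \<in> set Qs \<Longrightarrow> J \<subseteq> Q"
  shows "prime_chain (ring_of_type_algebra Quot J) (map ((`) (coset J)) Qs)"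
proof -
  have pr: "primeideal Q ring_of_type_algebra" if "Q \<in> set Qs" for Q
    using assms(1) that by (simp add: prime_chain_def)
  have mono: "coset J ` Q1 \<subset> coset J ` Q2"
    if Q: "Q1 \<in> set Qs" "Q2 \<in> set Qs" "Q1 \<subset> Q2" for Q1 Q2
  proof -
    obtain q where "q \<in> Q2" "q \<notin> Q1" using Q(3) by blast
    then have "coset J q \<in> coset J ` Q2 - coset J ` Q1"
      using rcos_mem_image_iff[OF primeideal.axioms(1)[OF pr[OF Q(1)]] assms(2)[OF Q(1)]] by blast
    then show ?thesis using Q(3) by blast
  qed
  have s: "sorted_wrt (\<subset>) Qs" using assms(1) by (simp add: prime_chain_def)
  have "sorted_wrt (\<subset>) (map ((`) (coset J)) Qs)"
    unfolding sorted_wrt_map by (rule sorted_wrt_mono_rel[OF _ s]) (rule mono)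
  then show ?thesis
    using assms pr prime_image_quot by (auto simp: prime_chain_def)
qed

lemma prime_chain_vimage_quot:
  assumes "prime_chain (ring_of_type_algebra Quot J) Ps"
  shows "prime_chain ring_of_type_algebra (map (\<lambda>P. {p. coset J p \<in> P}) Ps)"
proof -
  have pr: "primeideal P (ring_of_type_algebra Quot J)" if "P \<in> set Ps" for P
    using assms that by (simp add: prime_chain_def)
  have mono: "{p. coset J p \<in> P1} \<subset> {p. coset J p \<in> P2}"
    if P: "P1 \<in> set Ps" "P2 \<in> set Ps" "P1 \<subset> P2" for P1 P2
  proof -
    obtain a where a: "a \<in> P2" "a \<notin> P1" using P(3) by blast
    have "a \<in> carrier (ring_of_type_algebra Quot J)"
      using a(1) ideal.Icarr[OF primeideal.axioms(1)[OF pr[OF P(2)]]] by blast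
    then obtain p where "a = coset J p" by (auto simp: quot_carrier)
    then show ?thesis using a P(3) by blast
  qed
  have s: "sorted_wrt (\<subset>) Ps" using assms(1) by (simp add: prime_chain_def)
  have "sorted_wrt (\<subset>) (map (\<lambda>P. {p. coset J p \<in> P}) Ps)"
    unfolding sorted_wrt_map by (rule sorted_wrt_mono_rel[OF _ s]) (rule mono)
  then show ?thesis using assms pr prime_vimage_quot by (auto simp: prime_chain_def)
qed

end

section \<open>Chains of ideals generated by variables\<close>

lemma var_ideal_mono: "C \<subseteq> D \<Longrightarrow> var_ideal C \<subseteq> var_ideal D"
  unfolding var_ideal_def by blast

lemma var_ideal_strict_mono: "C \<subset> D \<Longrightarrow> (var_ideal C :: ('v, 'k::field) mpoly set) \<subset> var_ideal D"
proof -
  assume C: "C \<subset> D"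
  then obtain v where v: "v \<in> D" "v \<notin> C" by blast
  have "(monom_of (mvar v) :: ('v, 'k) mpoly) \<in> var_ideal D - var_ideal C"
    using v by (auto simp: monom_of_mem_var_ideal lookup_single when_def split: if_splits)
  then show ?thesis using var_ideal_mono[of C D] C by blast
qed

lemma prime_chain_snoc:
  assumes "prime_chain R Ps" "primeideal Q R" "last Ps \<subset> Q"
  shows "prime_chain R (Ps @ [Q])"
proof -
  have "P \<subset> Q" if "P \<in> set Ps" for P
  proof (cases "P = last Ps")
    case False
    have "Ps = butlast Ps @ [last Ps]" using assms(1) by (simp add: prime_chain_def)
    then have "sorted_wrt (\<subset>) (butlast Ps @ [last Ps])" "P \<in> set (butlast Ps @ [last Ps])"
      using assms(1) that by (simp_all add: prime_chain_def)
    then have "P \<subset> last Ps" using False by (auto simp: sorted_wrt_append)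
    then show ?thesis using assms(3) by blast
  qed (use assms in simp)
  then show ?thesis using assms by (auto simp: prime_chain_def sorted_wrt_append)
qed

lemma ex_var_chain_Un:
  fixes C T :: "'v::finite set"
  assumes "finite T" "T \<inter> C = {}"
  shows "\<exists>Qs. prime_chain (mpoly_ring :: ('v, 'k::field) mpoly ring) Qs \<and> last Qs = var_ideal (C \<union> T) \<and>
    hd Qs = var_ideal C \<and> length Qs = card T + 1 \<and> (\<forall>Q\<in>set Qs. var_ideal C \<subseteq> Q)"
  using assms
proof (induction T)
  case empty
  show ?case
    by (intro exI[of _ "[var_ideal C]"]) (simp add: prime_chain_def primeideal_var_ideal)
next
  case (insert v T)
  then obtain Qs where Qs: "prime_chain (mpoly_ring :: ('v, 'k) mpoly ring) Qs" "last Qs = var_ideal (C \<union> T)"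
    "hd Qs = var_ideal C" "length Qs = card T + 1" "\<forall>Q\<in>set Qs. var_ideal C \<subseteq> Q"
    by auto
  have ne: "Qs \<noteq> []" using Qs(4) by auto
  have "C \<union> T \<subset> C \<union> insert v T" using insert(2,4) by auto
  then have "var_ideal (C \<union> T) \<subset> (var_ideal (C \<union> insert v T) :: ('v, 'k) mpoly set)"
    by (rule var_ideal_strict_mono)
  then have "prime_chain mpoly_ring (Qs @ [var_ideal (C \<union> insert v T)])"
    using Qs by (intro prime_chain_snoc primeideal_var_ideal) auto
  moreover have "var_ideal C \<subseteq> (var_ideal (C \<union> insert v T) :: ('v, 'k) mpoly set)"
    by (rule var_ideal_mono) auto
  ultimately show ?case
    using Qs(3-5) ne insert(1,2) by (intro exI[of _ "Qs @ [var_ideal (C \<union> insert v T)]"]) auto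
qed

lemma ex_var_chain:
  assumes "C \<subseteq> (D :: 'v::finite set)"
  shows "\<exists>Qs. prime_chain (mpoly_ring :: ('v, 'k::field) mpoly ring) Qs \<and> last Qs = var_ideal D \<and>
    hd Qs = var_ideal C \<and> length Qs = card D - card C + 1 \<and> (\<forall>Q\<in>set Qs. var_ideal C \<subseteq> Q)"
proof -
  have eqs: "C \<union> (D - C) = D" "card (D - C) = card D - card C"
    using assms by (auto simp: card_Diff_subset)
  show ?thesis using ex_var_chain_Un[of "D - C" C, unfolded eqs] by auto
qed

text \<open>The \<open>- 1\<close> pays for a junction at which both chains have the same
  prime.\<close>

lemma prime_chain_append:
  assumes "prime_chain R Ps" "prime_chain R Qs" "last Ps \<subseteq> hd Qs"
  shows "\<exists>Rs. prime_chain R Rs \<and> last Rs = last Qs \<and> length Ps + length Qs - 1 \<le> length Rs"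
proof -
  obtain Q Qs' where Qs: "Qs = Q # Qs'" using assms(2) by (cases Qs) (auto simp: prime_chain_def)
  have step: "\<exists>Rs. prime_chain R Rs \<and> last Rs = last (Q # Qs') \<and> length As + length Qs' \<le> length Rs"
    if "prime_chain R As" "last As = Q" "prime_chain R (Q # Qs')" for As Q Qs'
    using that
  proof (induction Qs' arbitrary: As Q)
    case Nil then show ?case by auto
  next
    case (Cons Q' Qs')
    have "prime_chain R (As @ [Q'])" using Cons.prems by (intro prime_chain_snoc) (auto simp: prime_chain_def)
    moreover have "prime_chain R (Q' # Qs')" using Cons.prems(3) by (auto simp: prime_chain_def)
    ultimately show ?case using Cons.IH[of "As @ [Q']" Q'] by auto
  qed
  show ?thesis
  proof (cases "last Ps = Q")
    case True
    then show ?thesis using step[OF assms(1) True] assms(2) Qs by auto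
  next
    case False
    then have "prime_chain R (Ps @ [Q])"
      using assms Qs by (intro prime_chain_snoc) (auto simp: prime_chain_def)
    from step[OF this _ assms(2)[unfolded Qs]] obtain Rs where
      "prime_chain R Rs" "last Rs = last (Q # Qs')" "length (Ps @ [Q]) + length Qs' \<le> length Rs" by auto
    then show ?thesis using Qs by (intro exI[of _ Rs]) auto
  qed
qed

lemma prime_height_ge:
  assumes "prime_chain R Ps" "last Ps = P"
  shows "enat (length Ps - 1) \<le> prime_height R P"
  unfolding prime_height_def using assms by (intro SUP_upper) auto

text \<open>A chain ending at \<open>var_ideal D\<close> is prolonged by the variables outside
  \<open>D\<close>; the bound for all chains then limits the part below.\<close>

lemma prime_height_var_ideal_le:
  "prime_height (mpoly_ring :: ('v::finite, 'k::field) mpoly ring) (var_ideal D) \<le> enat (card D)"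
  unfolding prime_height_def
proof (rule SUP_least)
  fix Ps assume "Ps \<in> {Ps. prime_chain (mpoly_ring :: ('v, 'k) mpoly ring) Ps \<and> last Ps = var_ideal D}"
  then have Ps: "prime_chain (mpoly_ring :: ('v, 'k) mpoly ring) Ps" "last Ps = var_ideal D" by auto
  obtain Qs where Qs: "prime_chain (mpoly_ring :: ('v, 'k) mpoly ring) Qs" "hd Qs = var_ideal D"
    "length Qs = card (UNIV :: 'v set) - card D + 1"
    using ex_var_chain[of D UNIV] by auto
  obtain Rs where Rs: "prime_chain (mpoly_ring :: ('v, 'k) mpoly ring) Rs" "length Ps + length Qs - 1 \<le> length Rs"
    using prime_chain_append[OF Ps(1) Qs(1)] Ps(2) Qs(2) by auto
  have "length Rs \<le> card (UNIV :: 'v set) + 1" using prime_chain_length_le[OF Rs(1)] .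
  moreover have "card D \<le> card (UNIV :: 'v set)" by (intro card_mono) auto
  ultimately show "enat (length Ps - 1) \<le> enat (card D)" using Rs(2) Qs(3) by simp
qed

lemma prime_contains_var:
  assumes "primeideal Q (mpoly_ring :: ('v::finite, 'k::field) mpoly ring)" "monom_of a \<in> Q"
  shows "\<exists>v. lookup a v > 0 \<and> monom_of (mvar v) \<in> Q"
  using assms(2)
proof (induction "mdeg a" arbitrary: a)
  case 0
  then have "a = 0" by (intro poly_mapping_eqI) (simp add: mdeg_def)
  then show ?case using 0(2) prime_one_notin[OF assms(1)] by (simp add: monom_of_def)
next
  case (Suc n)
  have "\<exists>v. lookup a v \<noteq> 0"
  proof (rule ccontr)
    assume "\<nexists>v. lookup a v \<noteq> 0"
    then have "mdeg a = 0" by (simp add: mdeg_def)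
    then show False using Suc.hyps(2) by simp
  qed
  then obtain v where v: "lookup a v > 0" by auto
  then have "mono_dvd (mvar v) a" by (auto simp: mono_dvd_def lookup_single when_def)
  then obtain b where b: "a = mvar v + b" by (auto simp: mono_dvd_iff)
  have "monom_of (mvar v) \<in> Q \<or> monom_of b \<in> Q"
    using Suc.prems assms(1) unfolding b monom_of_add by (auto simp: primeideal_ring_of_type_algebra_iff)
  then show ?case
  proof
    assume "monom_of b \<in> Q"
    moreover have "mdeg a = mdeg (mvar v) + mdeg b" unfolding b by (simp add: mdeg_def lookup_add sum.distrib)
    moreover have "mdeg (mvar v) = 1" by (simp add: mdeg_def lookup_single when_def)
    ultimately obtain u where "lookup b u > 0" "monom_of (mvar u) \<in> Q"
      using Suc.hyps by auto
    then show ?case unfolding b by (auto simp: lookup_add)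
  qed (use v in blast)
qed

text \<open>Take the variables lying in \<open>Q\<close>: every monomial of \<open>I\<close> has a
  factor among them. Codimension and dimension are thereby reduced to ideals generated by
  variables.\<close>

lemma prime_over_monomial_ideal:
  assumes I: "monomial_ideal (I :: ('v::finite, 'k::field) mpoly set)"
    and Q: "primeideal Q mpoly_ring" and "I \<subseteq> Q"
  shows "\<exists>D. I \<subseteq> var_ideal D \<and> var_ideal D \<subseteq> Q"
proof (intro exI conjI)
  let ?D = "{v. monom_of (mvar v) \<in> Q}"
  show "I \<subseteq> var_ideal ?D"
  proof
    fix p assume "p \<in> I"
    then have "monom_of a \<in> Q" if "a \<in> keys p" for a
      using monomial_ideal_mem_iff[OF I] that assms(3) by blast
    then show "p \<in> var_ideal ?D"
      using prime_contains_var[OF Q] by (fastforce simp: var_ideal_def)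
  qed
  have idl: "ideal Q mpoly_ring" using Q by (rule primeideal.axioms(1))
  show "var_ideal ?D \<subseteq> Q"
  proof
    fix p assume p: "p \<in> (var_ideal ?D :: ('v, 'k) mpoly set)"
    show "p \<in> Q"
    proof (rule ideal_mem_if_monomials[OF idl])
      fix a assume "a \<in> keys p"
      then obtain v where v: "monom_of (mvar v) \<in> Q" "lookup a v > 0"
        using p by (auto simp: var_ideal_def)
      then have "mono_dvd (mvar v) a" by (auto simp: mono_dvd_def lookup_single when_def)
      then obtain b where b: "a = mvar v + b" by (auto simp: mono_dvd_iff)
      show "monom_of a \<in> Q" unfolding b monom_of_add by (rule ideal_closed(4)[OF idl v(1)])
    qed
  qed
qed

text \<open>Any prime over \<open>I\<close> contains some \<open>var_ideal C\<close> over
  \<open>I\<close>, below which adding variables one by one makes \<open>card C\<close>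
  steps.\<close>

theorem codim_monomial_ideal:
  assumes I: "monomial_ideal (I :: ('v::finite, 'k::field) mpoly set)"
    and D: "I \<subseteq> var_ideal D" and min: "\<And>C. I \<subseteq> var_ideal C \<Longrightarrow> card D \<le> card C"
  shows "codim mpoly_ring I = enat (card D)"
proof (rule antisym)
  have "codim mpoly_ring I \<le> prime_height mpoly_ring (var_ideal D :: ('v, 'k) mpoly set)"
    unfolding codim_def using D primeideal_var_ideal by (intro INF_lower) auto
  also have "\<dots> \<le> enat (card D)" by (rule prime_height_var_ideal_le)
  finally show "codim mpoly_ring I \<le> enat (card D)" .
  show "enat (card D) \<le> codim mpoly_ring I" unfolding codim_def
  proof (rule INF_greatest)
    fix Q assume "Q \<in> {P. primeideal P mpoly_ring \<and> I \<subseteq> P}"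
    then have Q: "primeideal Q mpoly_ring" "I \<subseteq> Q" by auto
    obtain C where C: "I \<subseteq> var_ideal C" "var_ideal C \<subseteq> Q"
      using prime_over_monomial_ideal[OF I Q] by blast
    obtain Qs where Qs: "prime_chain (mpoly_ring :: ('v, 'k) mpoly ring) Qs" "last Qs = var_ideal C"
      "length Qs = card C + 1"
      using ex_var_chain[of "{}" C] by auto
    have "prime_chain mpoly_ring [Q]" using Q by (simp add: prime_chain_def)
    from prime_chain_append[OF Qs(1) this] C(2) Qs(2) obtain Rs where
      "prime_chain mpoly_ring Rs" "last Rs = Q" "length Qs \<le> length Rs" by auto
    then have "enat (length Rs - 1) \<le> prime_height mpoly_ring Q" by (intro prime_height_ge)
    moreover have "enat (card D) \<le> enat (length Rs - 1)"
      using min[OF C(1)] Qs(3) \<open>length Qs \<le> length Rs\<close> by simp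
    ultimately show "enat (card D) \<le> prime_height mpoly_ring Q" by (rule order_trans[rotated])
  qed
qed

text \<open>A chain of the quotient pulls back to one above some \<open>var_ideal C\<close> and can
  be preceded by the chain of the variables of \<open>C\<close>; the bound for all chains leaves it
  \<open>n - card C\<close> steps.\<close>

theorem krull_dim_monomial_ideal:
  assumes I: "monomial_ideal (I :: ('v::finite, 'k::field) mpoly set)"
    and D: "I \<subseteq> var_ideal D" and min: "\<And>C. I \<subseteq> var_ideal C \<Longrightarrow> card D \<le> card C"
  shows "krull_dim (mpoly_ring Quot I) = enat (card (UNIV :: 'v set) - card D)"
proof (rule antisym)
  note idl = monomial_ideal_ideal[OF I]
  show "krull_dim (mpoly_ring Quot I) \<le> enat (card (UNIV :: 'v set) - card D)"
    unfolding krull_dim_def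
  proof (rule SUP_least)
    fix Ps assume "Ps \<in> {Ps. prime_chain (mpoly_ring Quot I) Ps}"
    then have Ps: "prime_chain (mpoly_ring Quot I) Ps" by simp
    let ?v = "\<lambda>P. {p. coset I p \<in> P}"
    have ne: "Ps \<noteq> []" and pr: "primeideal (hd Ps) (mpoly_ring Quot I)"
      using Ps by (auto simp: prime_chain_def)
    note ch = prime_chain_vimage_quot[OF idl Ps]
    obtain C where C: "I \<subseteq> var_ideal C" "var_ideal C \<subseteq> ?v (hd Ps)"
      using prime_over_monomial_ideal[OF I prime_vimage_quot[OF idl pr]
          ideal_vimage_quot(2)[OF idl primeideal.axioms(1)[OF pr]]] by blast
    obtain Qs where Qs: "prime_chain (mpoly_ring :: ('v, 'k) mpoly ring) Qs" "last Qs = var_ideal C"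
      "length Qs = card C + 1"
      using ex_var_chain[of "{}" C] by auto
    have "last Qs \<subseteq> hd (map ?v Ps)" using C(2) Qs(2) ne by (simp add: hd_map)
    from prime_chain_append[OF Qs(1) ch this] obtain Rs where
      "prime_chain (mpoly_ring :: ('v, 'k) mpoly ring) Rs" "length Qs + length (map ?v Ps) - 1 \<le> length Rs" by auto
    then have "length Qs + length Ps - 1 \<le> card (UNIV :: 'v set) + 1"
      using prime_chain_length_le[of Rs] by simp
    then show "enat (length Ps - 1) \<le> enat (card (UNIV :: 'v set) - card D)"
      using Qs(3) min[OF C(1)] by simp
  qed
  obtain Qs where Qs: "prime_chain (mpoly_ring :: ('v, 'k) mpoly ring) Qs"
    "length Qs = card (UNIV :: 'v set) - card D + 1" "\<forall>Q\<in>set Qs. var_ideal D \<subseteq> Q"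
    using ex_var_chain[of D UNIV] by auto
  have "prime_chain (mpoly_ring Quot I) (map ((`) (coset I)) Qs)"
    using Qs(3) D by (intro prime_chain_image_quot[OF idl Qs(1)]) blast
  then have "enat (length (map ((`) (coset I)) Qs) - 1) \<le> krull_dim (mpoly_ring Quot I)"
    unfolding krull_dim_def by (intro SUP_upper) simp
  then show "enat (card (UNIV :: 'v set) - card D) \<le> krull_dim (mpoly_ring Quot I)"
    using Qs(2) by simp
qed


section \<open>Koszul cohomology and depth\<close>

text \<open>Koszul signs require an order on the variables; any numbering serves.\<close>

definition var_index :: "'v::finite \<Rightarrow> nat" where
  "var_index = (SOME f. inj f)"

lemma inj_var_index: "inj (var_index :: 'v::finite \<Rightarrow> nat)"
proof -
  have "\<exists>f :: 'v \<Rightarrow> nat. inj f" using finite_imp_inj_to_nat_seg[of "UNIV :: 'v set"] by auto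
  then show ?thesis unfolding var_index_def by (rule someI_ex)
qed

text \<open>The sign picked up when \<open>v\<close> is sorted into the exterior product of the
  elements of \<open>F\<close>.\<close>

definition koszul_sign :: "'v::finite \<Rightarrow> 'v set \<Rightarrow> 'k::field" where
  "koszul_sign v F = (- 1) ^ card {u\<in>F. var_index u < var_index v}"

lemma koszul_sign_square: "koszul_sign v F * koszul_sign v F = (1 :: 'k::field)"
  by (simp add: koszul_sign_def flip: power_mult_distrib)

lemma koszul_sign_insert:
  assumes "u \<notin> F"
  shows "koszul_sign v (insert u F) = (if var_index u < var_index v then - 1 else 1) * (koszul_sign v F :: 'k::field)"
proof (cases "var_index u < var_index v")
  case True
  then have "{w\<in>insert u F. var_index w < var_index v} = insert u {w\<in>F. var_index w < var_index v}" by auto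
  then show ?thesis using assms True by (simp add: koszul_sign_def)
next
  case False
  then have "{w\<in>insert u F. var_index w < var_index v} = {w\<in>F. var_index w < var_index v}" by auto
  then show ?thesis using False by (simp add: koszul_sign_def)
qed

text \<open>The first identity makes the differential square to zero; the second cancels the mixed
  terms of the contraction homotopy.\<close>

lemma koszul_sign_swap:
  assumes "u \<noteq> v" "u \<notin> F" "v \<notin> F"
  shows "koszul_sign u F * koszul_sign v (insert u F) = - (koszul_sign v F * koszul_sign u (insert v F) :: 'k::field)"
    and "koszul_sign u (insert v F) * koszul_sign v (insert u F) = - (koszul_sign v F * koszul_sign u F :: 'k::field)"
proof -
  have "var_index u \<noteq> var_index v" using injD[OF inj_var_index] assms(1) by blast
  then consider "var_index u < var_index v" "\<not> var_index v < var_index u"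
    | "var_index v < var_index u" "\<not> var_index u < var_index v" by linarith
  then have "koszul_sign u F * koszul_sign v (insert u F) = - (koszul_sign v F * koszul_sign u (insert v F) :: 'k::field) \<and>
    koszul_sign u (insert v F) * koszul_sign v (insert u F) = - (koszul_sign v F * koszul_sign u F :: 'k::field)"
    by cases (simp_all add: koszul_sign_insert assms)
  then show "koszul_sign u F * koszul_sign v (insert u F) = - (koszul_sign v F * koszul_sign u (insert v F) :: 'k::field)"
    "koszul_sign u (insert v F) * koszul_sign v (insert u F) = - (koszul_sign v F * koszul_sign u F :: 'k::field)"
    by blast+
qed

text \<open>The Koszul cochain complex of \<open>S/J\<close> for the squares of the variables; a cochain assigns a
  polynomial to every set of variables.\<close>

definition koszul_d :: "('v::finite set \<Rightarrow> ('v, 'k::field) mpoly) \<Rightarrow> 'v set \<Rightarrow> ('v, 'k) mpoly" where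
  "koszul_d z G = (\<Sum>v\<in>G. single (single v 2) (koszul_sign v (G - {v})) * z (G - {v}))"

text \<open>Cochains of \<open>S/J\<close> are given by lifts to \<open>S\<close>, with equations
  read as membership in \<open>J\<close>. The same lift can thus be read modulo a larger ideal, as
  in \<open>koszul_coboundary_cancel\<close>.\<close>

definition koszul_cocycle :: "('v::finite, 'k::field) mpoly set \<Rightarrow> nat \<Rightarrow> ('v set \<Rightarrow> ('v, 'k) mpoly) \<Rightarrow> bool" where
  "koszul_cocycle J s z \<longleftrightarrow> (\<forall>G. card G = Suc s \<longrightarrow> koszul_d z G \<in> J)"

definition koszul_coboundary :: "('v::finite, 'k::field) mpoly set \<Rightarrow> nat \<Rightarrow> ('v set \<Rightarrow> ('v, 'k) mpoly) \<Rightarrow> bool" where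
  "koszul_coboundary J s z \<longleftrightarrow> (\<exists>w. \<forall>F. card F = s \<longrightarrow> z F - koszul_d w F \<in> J)"

definition koszul_vanishes :: "('v::finite, 'k::field) mpoly set \<Rightarrow> nat \<Rightarrow> bool" where
  "koszul_vanishes J s \<longleftrightarrow> (\<forall>z. koszul_cocycle J s z \<longrightarrow> koszul_coboundary J s z)"

lemma koszul_d_add: "koszul_d (\<lambda>F. a F + b F) G = koszul_d a G + koszul_d b G"
  by (simp add: koszul_d_def distrib_left sum.distrib)

lemma koszul_d_diff: "koszul_d (\<lambda>F. a F - b F) G = koszul_d a G - koszul_d b G"
  by (simp add: koszul_d_def right_diff_distrib sum_subtractf)

lemma koszul_d_mult: "koszul_d (\<lambda>F. g * a F) G = g * koszul_d a G"
  by (simp add: koszul_d_def sum_distrib_left mult_ac)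

lemma koszul_d_mem:
  assumes "ideal J mpoly_ring" "\<And>F. Suc (card F) = card G \<Longrightarrow> a F \<in> J"
  shows "koszul_d a G \<in> J"
  unfolding koszul_d_def
proof (rule ideal_sum_closed[OF assms(1)])
  fix v assume v: "v \<in> G"
  then have "Suc (card (G - {v})) = card G" by (intro card_Suc_Diff1) auto
  then show "single (single v 2) (koszul_sign v (G - {v})) * a (G - {v}) \<in> J"
    using assms by (intro ideal_closed(3)[OF assms(1)])
qed

text \<open>Removing two variables in the two possible orders gives opposite terms;
  \<open>var_index\<close> splits the ordered pairs into two halves exchanged by the swap.\<close>

lemma koszul_d_koszul_d: "koszul_d (koszul_d z) G = (0 :: ('v::finite, 'k::field) mpoly)"
proof -
  define T where "T v u = single (single v 2) (koszul_sign v (G - {v})) *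
    (single (single u 2) (koszul_sign u (G - {v} - {u})) * z (G - {v} - {u}))" for u v
  have anti: "T v u + T u v = 0" if "u \<in> G" "v \<in> G" "u \<noteq> v" for u v
  proof -
    define F where "F = G - {v} - {u}"
    have eqs: "G - {v} = insert u F" "G - {u} = insert v F" "insert u F - {u} = F" "insert v F - {v} = F"
      and uv: "u \<notin> F" "v \<notin> F"
      using that by (auto simp: F_def)
    let ?m = "single u 2 + single v 2 :: 'v monomial"
    have "T v u = single ?m (koszul_sign v (insert u F) * koszul_sign u F) * z F"
      by (simp add: T_def eqs mult_single add.commute flip: mult.assoc)
    moreover have "T u v = single ?m (koszul_sign u (insert v F) * koszul_sign v F) * z F"
      by (simp add: T_def eqs mult_single add.commute flip: mult.assoc)
    moreover have "koszul_sign v (insert u F) * koszul_sign u F = - (koszul_sign u (insert v F) * koszul_sign v F :: 'k)"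
      using koszul_sign_swap(1)[OF that(3) uv, where ?'k = 'k] by (simp only: mult.commute)
    ultimately show ?thesis by (simp add: single_uminus)
  qed
  let ?L = "{(v, u). v \<in> G \<and> u \<in> G \<and> var_index v < var_index u}"
  let ?R = "{(v, u). v \<in> G \<and> u \<in> G \<and> var_index u < var_index v}"
  have "koszul_d (koszul_d z) G = (\<Sum>v\<in>G. \<Sum>u\<in>G - {v}. T v u)"
    by (simp add: koszul_d_def T_def sum_distrib_left)
  also have "\<dots> = (\<Sum>(v, u)\<in>Sigma G (\<lambda>v. G - {v}). T v u)" by (rule sum.Sigma) auto
  also have "Sigma G (\<lambda>v. G - {v}) = ?L \<union> ?R"
  proof -
    have ne: "u \<noteq> v \<longleftrightarrow> var_index v < var_index u \<or> var_index u < var_index v" for u v :: 'v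
      using injD[OF inj_var_index, of u v] linorder_neq_iff[of "var_index v" "var_index u"] by auto
    have "Sigma G (\<lambda>v. G - {v}) = {(v, u). v \<in> G \<and> u \<in> G \<and> u \<noteq> v}" by auto
    also have "\<dots> = ?L \<union> ?R" unfolding ne by blast
    finally show ?thesis .
  qed
  also have "(\<Sum>(v, u)\<in>?L \<union> ?R. T v u) = (\<Sum>(v, u)\<in>?L. T v u) + (\<Sum>(v, u)\<in>?R. T v u)"
    by (rule sum.union_disjoint) auto
  also have "(\<Sum>(v, u)\<in>?R. T v u) = (\<Sum>(v, u)\<in>?L. T u v)"
    by (rule sum.reindex_bij_witness[of _ prod.swap prod.swap]) auto
  also have "(\<Sum>(v, u)\<in>?L. T v u) + (\<Sum>(v, u)\<in>?L. T u v) = (\<Sum>(v, u)\<in>?L. T v u + T u v)"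
    by (simp add: case_prod_unfold sum.distrib)
  also have "\<dots> = 0" using anti by (intro sum.neutral) auto
  finally show ?thesis .
qed

text \<open>Contraction with \<open>u\<close> is a null-homotopy of multiplication by the square of the variable \<open>u\<close>.\<close>

lemma koszul_homotopy:
  fixes z :: "'v::finite set \<Rightarrow> ('v, 'k::field) mpoly" and u :: 'v
  defines "h \<equiv> \<lambda>z F. if u \<in> F then 0 else single 0 (koszul_sign u F) * z (insert u F)"
  shows "koszul_d (h z) F + h (koszul_d z) F = monom_of (single u 2) * z F"
proof (cases "u \<in> F")
  case True
  have "koszul_d (h z) F = (\<Sum>v\<in>F. if v = u then monom_of (single u 2) * z F else 0)"
    unfolding koszul_d_def
  proof (rule sum.cong)
    fix v assume "v \<in> F"
    show "single (single v 2) (koszul_sign v (F - {v})) * h z (F - {v}) =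
        (if v = u then monom_of (single u 2) * z F else 0)"
      using True by (auto simp: h_def insert_absorb mult_single koszul_sign_square monom_of_def simp flip: mult.assoc)
  qed simp
  then show ?thesis using True by (simp add: h_def)
next
  case False
  have neg: "single (single v 2) (koszul_sign v (F - {v})) * h z (F - {v}) +
      single 0 (koszul_sign u F) *
        (single (single v 2) (koszul_sign v (insert u F - {v})) * z (insert u F - {v})) = 0"
    if v: "v \<in> F" for v
  proof -
    let ?F = "F - {v}"
    have uv: "u \<noteq> v" using v False by auto
    have eqs: "insert u F - {v} = insert u ?F" "F = insert v ?F" using v uv by auto
    have "koszul_sign u (insert v ?F) * koszul_sign v (insert u ?F) = - (koszul_sign v ?F * koszul_sign u ?F :: 'k)"
      using uv False by (intro koszul_sign_swap) auto
    then have s: "koszul_sign u F * koszul_sign v (insert u ?F) = - (koszul_sign v ?F * koszul_sign u ?F :: 'k)"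
      using eqs(2) by simp
    have "single (single v 2) (koszul_sign v ?F) * h z ?F =
        single (single v 2) (koszul_sign v ?F * koszul_sign u ?F) * z (insert u ?F)"
      using uv False by (simp add: h_def mult_single flip: mult.assoc)
    moreover have "single 0 (koszul_sign u F) *
        (single (single v 2) (koszul_sign v (insert u F - {v})) * z (insert u F - {v})) =
        single (single v 2) (koszul_sign u F * koszul_sign v (insert u ?F)) * z (insert u ?F)"
      unfolding eqs(1) by (simp add: mult_single flip: mult.assoc)
    ultimately show ?thesis unfolding s by (simp add: single_uminus)
  qed
  let ?t = "\<lambda>v. single 0 (koszul_sign u F) *
        (single (single v 2) (koszul_sign v (insert u F - {v})) * z (insert u F - {v}))"
  have "h (koszul_d z) F = single 0 (koszul_sign u F) * koszul_d z (insert u F)"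
    using False by (simp add: h_def)
  also have "\<dots> = (\<Sum>v\<in>insert u F. ?t v)" by (simp only: koszul_d_def sum_distrib_left)
  also have "\<dots> = ?t u + (\<Sum>v\<in>F. ?t v)" using False by simp
  also have "?t u = monom_of (single u 2) * z F"
    using False by (simp add: mult_single koszul_sign_square monom_of_def flip: mult.assoc)
  finally have "koszul_d (h z) F + h (koszul_d z) F = monom_of (single u 2) * z F +
      (\<Sum>v\<in>F. single (single v 2) (koszul_sign v (F - {v})) * h z (F - {v}) + ?t v)"
    by (simp add: koszul_d_def[of "h z"] sum.distrib)
  then show ?thesis using neg by simp
qed

text \<open>The polynomials that turn the given cocycle into a coboundary form an ideal, and the
  contraction homotopy puts the square of every variable into it.\<close>

lemma koszul_annihilated:
  fixes J :: "('v::finite, 'k::field) mpoly set"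
  assumes J: "ideal J mpoly_ring" and z: "koszul_cocycle J s z"
    and g: "\<And>a. a \<in> keys g \<Longrightarrow> \<exists>v. lookup a v \<ge> 2"
  shows "koszul_coboundary J s (\<lambda>F. g * z F)"
proof -
  let ?K = "{g. koszul_coboundary J s (\<lambda>F. g * z F)}"
  have K: "ideal ?K mpoly_ring" unfolding ideal_ring_of_type_algebra_iff
  proof (intro conjI ballI allI)
    have "0 * z F - koszul_d (\<lambda>F. 0) F \<in> J" for F
      using ideal_closed(1)[OF J] by (simp add: koszul_d_def)
    then show "0 \<in> ?K" unfolding koszul_coboundary_def by blast
  next
    fix a b assume "a \<in> ?K" "b \<in> ?K"
    then obtain w1 w2 where w: "\<forall>F. card F = s \<longrightarrow> a * z F - koszul_d w1 F \<in> J"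
      "\<forall>F. card F = s \<longrightarrow> b * z F - koszul_d w2 F \<in> J" by (auto simp: koszul_coboundary_def)
    have "(a + b) * z F - koszul_d (\<lambda>F. w1 F + w2 F) F \<in> J" if "card F = s" for F
    proof -
      have "(a * z F - koszul_d w1 F) + (b * z F - koszul_d w2 F) \<in> J"
        using w that by (intro ideal_closed(2)[OF J]) auto
      then show ?thesis by (simp add: koszul_d_add algebra_simps)
    qed
    then show "a + b \<in> ?K" unfolding koszul_coboundary_def by blast
  next
    fix a r assume "a \<in> ?K"
    then obtain w where w: "\<forall>F. card F = s \<longrightarrow> a * z F - koszul_d w F \<in> J" by (auto simp: koszul_coboundary_def)
    have "r * a * z F - koszul_d (\<lambda>F. r * w F) F \<in> J" if "card F = s" for F
    proof -
      have "r * (a * z F - koszul_d w F) \<in> J" using w that by (intro ideal_closed(3)[OF J]) auto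
      then show ?thesis by (simp add: koszul_d_mult algebra_simps)
    qed
    then show "r * a \<in> ?K" unfolding koszul_coboundary_def by blast
  qed
  have y: "monom_of (single u 2) \<in> ?K" for u
  proof -
    let ?h = "\<lambda>z F. if u \<in> F then 0 else single 0 (koszul_sign u F) * z (insert u F)"
    have "monom_of (single u 2) * z F - koszul_d (?h z) F \<in> J" if "card F = s" for F
    proof -
      have "?h (koszul_d z) F \<in> J"
        using z that ideal_closed(1,3)[OF J] by (auto simp: koszul_cocycle_def)
      moreover have "monom_of (single u 2) * z F - koszul_d (?h z) F = ?h (koszul_d z) F"
        by (subst koszul_homotopy[of u z F, symmetric]) (simp only: add_diff_cancel_left')
      ultimately show ?thesis by (simp only:)
    qed
    then show ?thesis unfolding koszul_coboundary_def by blast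
  qed
  have "g \<in> ?K"
  proof (rule ideal_mem_if_monomials[OF K])
    fix a assume "a \<in> keys g"
    then obtain v where "lookup a v \<ge> 2" using g by blast
    then have "mono_dvd (single v 2) a" by (auto simp: mono_dvd_def lookup_single when_def)
    then obtain b where b: "a = single v 2 + b" by (auto simp: mono_dvd_iff)
    show "monom_of a \<in> ?K" unfolding b monom_of_add by (rule ideal_closed(4)[OF K y])
  qed
  then show ?thesis by simp
qed

text \<open>\<open>J + (p)\<close> in explicit form, so that the cofactor of \<open>p\<close> can be
  read off for every value of a cochain.\<close>

definition add_generator :: "('v, 'k::field) mpoly set \<Rightarrow> ('v, 'k) mpoly \<Rightarrow> ('v, 'k) mpoly set" where
  "add_generator J p = {a + p * b | a b. a \<in> J}"

lemma ideal_add_generator: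
  assumes "ideal J mpoly_ring"
  shows "ideal (add_generator J p) mpoly_ring" "J \<subseteq> add_generator J p" "p \<in> add_generator J p"
    "\<And>K. ideal K mpoly_ring \<Longrightarrow> J \<subseteq> K \<Longrightarrow> p \<in> K \<Longrightarrow> add_generator J p \<subseteq> K"
proof -
  show "ideal (add_generator J p) mpoly_ring" unfolding ideal_ring_of_type_algebra_iff
  proof (intro conjI ballI allI)
    have "0 = 0 + p * 0" by simp
    then show "0 \<in> add_generator J p" unfolding add_generator_def using ideal_closed(1)[OF assms] by blast
  next
    fix x y assume "x \<in> add_generator J p" "y \<in> add_generator J p"
    then obtain a b c d where "x = a + p * b" "y = c + p * d" "a \<in> J" "c \<in> J" by (auto simp: add_generator_def)
    then have "x + y = (a + c) + p * (b + d)" "a + c \<in> J"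
      using ideal_closed(2)[OF assms] by (auto simp: algebra_simps)
    then show "x + y \<in> add_generator J p" unfolding add_generator_def by blast
  next
    fix x r assume "x \<in> add_generator J p"
    then obtain a b where "x = a + p * b" "a \<in> J" by (auto simp: add_generator_def)
    then have "r * x = r * a + p * (r * b)" "r * a \<in> J"
      using ideal_closed(3)[OF assms] by (auto simp: algebra_simps)
    then show "r * x \<in> add_generator J p" unfolding add_generator_def by blast
  qed
  show "J \<subseteq> add_generator J p"
  proof
    fix a assume "a \<in> J"
    moreover have "a = a + p * 0" by simp
    ultimately show "a \<in> add_generator J p" unfolding add_generator_def by blast
  qed
  have "p = 0 + p * 1" by simp
  then show "p \<in> add_generator J p" unfolding add_generator_def using ideal_closed(1)[OF assms] by blast
  show "add_generator J p \<subseteq> K" if "ideal K mpoly_ring" "J \<subseteq> K" "p \<in> K" for K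
    using that ideal_closed(2,4)[OF that(1)] by (auto simp: add_generator_def)
qed

text \<open>A piece of the long exact sequence for multiplication by \<open>f\<close> on
  \<open>S/J\<close>, done with cochains: the kernel of \<open>f\<close> in degree \<open>s\<close>
  comes from degree \<open>s - 1\<close> modulo \<open>f\<close>, where the cohomology
  vanishes.\<close>

lemma koszul_coboundary_cancel:
  fixes J :: "('v::finite, 'k::field) mpoly set"
  assumes J: "ideal J mpoly_ring" and reg: "\<And>g. f * g \<in> J \<Longrightarrow> g \<in> J"
    and van: "s > 0 \<Longrightarrow> koszul_vanishes (add_generator J f) (s - 1)"
    and cob: "koszul_coboundary J s (\<lambda>F. f * z F)"
  shows "koszul_coboundary J s z"
proof -
  obtain w where w: "\<And>F. card F = s \<Longrightarrow> f * z F - koszul_d w F \<in> J"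
    using cob by (auto simp: koszul_coboundary_def)
  show ?thesis
  proof (cases s)
    case 0
    have "z F - koszul_d w F \<in> J" if "card F = 0" for F
    proof -
      have F: "F = {}" using that by simp
      then have "f * z F \<in> J" using w[of F] 0 by (simp add: koszul_d_def)
      then show ?thesis using reg F by (simp add: koszul_d_def)
    qed
    then show ?thesis unfolding koszul_coboundary_def using 0 by blast
  next
    case (Suc s')
    let ?J = "add_generator J f"
    note J' = ideal_add_generator[OF J, where p = f]
    \<comment> \<open>Modulo \<open>J\<close> the differential of \<open>w\<close> is a multiple of
      \<open>f\<close>, so it vanishes modulo \<open>J + (f)\<close>.\<close>
    have "koszul_cocycle ?J s' w" unfolding koszul_cocycle_def
    proof (intro allI impI)
      fix G :: "'v set" assume "card G = Suc s'"
      then have "f * z G - koszul_d w G \<in> ?J" using w Suc J'(2) by blast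
      then have "f * z G - (f * z G - koszul_d w G) \<in> ?J"
        by (rule ideal_closed(6)[OF J'(1) ideal_closed(4)[OF J'(1) J'(3)]])
      then show "koszul_d w G \<in> ?J" by simp
    qed
    then have "koszul_coboundary ?J s' w" using van Suc by (simp add: koszul_vanishes_def)
    then obtain u where u: "\<And>F. card F = s' \<Longrightarrow> w F - koszul_d u F \<in> ?J"
      by (auto simp: koszul_coboundary_def)
    have "\<exists>b. w F - koszul_d u F - f * b \<in> J" if cF: "card F = s'" for F
    proof -
      obtain a b where "w F - koszul_d u F = a + f * b" "a \<in> J" using u[OF cF] by (auto simp: add_generator_def)
      then show ?thesis by (intro exI[of _ b]) simp
    qed
    \<comment> \<open>Up to a coboundary, \<open>w\<close> is \<open>f\<close> times a cochain
      \<open>v\<close> modulo \<open>J\<close>. Cancelling \<open>f\<close> afterwards shows that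
      \<open>v\<close> bounds \<open>z\<close>.\<close>
    then obtain v where v: "\<And>F. card F = s' \<Longrightarrow> w F - koszul_d u F - f * v F \<in> J" by metis
    have "z G - koszul_d v G \<in> J" if G: "card G = s" for G
    proof -
      have "koszul_d (\<lambda>F. w F - koszul_d u F - f * v F) G \<in> J"
        using v G Suc by (intro koszul_d_mem[OF J]) simp
      then have "koszul_d w G - f * koszul_d v G \<in> J"
        by (simp add: koszul_d_diff koszul_d_mult koszul_d_koszul_d)
      then have "(f * z G - koszul_d w G) + (koszul_d w G - f * koszul_d v G) \<in> J"
        using w[OF G] by (intro ideal_closed(2)[OF J])
      then have "f * (z G - koszul_d v G) \<in> J" by (simp add: algebra_simps)
      then show ?thesis by (rule reg)
    qed
    then show ?thesis unfolding koszul_coboundary_def by (intro exI[of _ v]) simp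
  qed
qed

lemma mdeg_add: "mdeg (a + b) = mdeg a + mdeg b"
  by (simp add: mdeg_def lookup_add sum.distrib)

lemma mdeg_keys_power:
  fixes p :: "('v::finite, 'k::field) mpoly"
  assumes "\<And>a. a \<in> keys p \<Longrightarrow> mdeg a \<ge> 1" "a \<in> keys (p ^ n)"
  shows "mdeg a \<ge> n"
  using assms(2)
proof (induction n arbitrary: a)
  case (Suc n)
  then obtain b c where bc: "a = b + c" "b \<in> keys p" "c \<in> keys (p ^ n)"
    using keys_mult[of p "p ^ n"] by auto
  then show ?case using Suc.IH[OF bc(3)] assms(1)[OF bc(2)] by (simp add: mdeg_add)
qed simp

text \<open>Multiplication by \<open>f\<close> is injective on this cohomology, but its power with
  exponent \<open>n + 1\<close> is zero there: a monomial of degree above \<open>n\<close> in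
  \<open>n\<close> variables has an exponent of at least 2.\<close>

lemma koszul_vanishes_step:
  fixes J :: "('v::finite, 'k::field) mpoly set"
  assumes J: "ideal J mpoly_ring" and reg: "\<And>g. f * g \<in> J \<Longrightarrow> g \<in> J"
    and f: "\<And>a. a \<in> keys f \<Longrightarrow> mdeg a \<ge> 1"
    and van: "s > 0 \<Longrightarrow> koszul_vanishes (add_generator J f) (s - 1)"
  shows "koszul_vanishes J s"
  unfolding koszul_vanishes_def
proof (intro allI impI)
  fix z assume z: "koszul_cocycle J s z"
  have cancel: "koszul_coboundary J s z"
    if "koszul_cocycle J s z" "koszul_coboundary J s (\<lambda>F. f ^ N * z F)" for N z
    using that(2)
  proof (induction N)
    case (Suc N)
    then have "koszul_coboundary J s (\<lambda>F. f * (f ^ N * z F))" by (simp add: mult.assoc)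
    from koszul_coboundary_cancel[OF J reg van this] show ?case by (rule Suc.IH) 
  qed simp
  let ?n = "card (UNIV :: 'v set)"
  have "\<exists>v. lookup a v \<ge> 2" if a: "a \<in> keys (f ^ Suc ?n)" for a
  proof (rule ccontr)
    assume "\<not> (\<exists>v. lookup a v \<ge> 2)"
    then have "lookup a v \<le> 1" for v by (metis Suc_1 not_less_eq_eq One_nat_def)
    then have "mdeg a \<le> (\<Sum>v\<in>(UNIV :: 'v set). 1)" unfolding mdeg_def by (intro sum_mono) auto
    then show False using mdeg_keys_power[OF f a] by simp
  qed
  then have "koszul_coboundary J s (\<lambda>F. f ^ Suc ?n * z F)" by (rule koszul_annihilated[OF J z])
  then show "koszul_coboundary J s z" by (rule cancel[OF z])
qed

fun add_generators :: "('v, 'k::field) mpoly set \<Rightarrow> ('v, 'k) mpoly list \<Rightarrow> ('v, 'k) mpoly set" where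
  "add_generators J [] = J"
| "add_generators J (p # ps) = add_generators (add_generator J p) ps"

lemma ideal_add_generators:
  assumes "ideal J mpoly_ring"
  shows "ideal (add_generators J ps) mpoly_ring" "J \<subseteq> add_generators J ps" "set ps \<subseteq> add_generators J ps"
    "\<And>K. ideal K mpoly_ring \<Longrightarrow> J \<subseteq> K \<Longrightarrow> set ps \<subseteq> K \<Longrightarrow> add_generators J ps \<subseteq> K"
proof -
  have "ideal (add_generators J ps) mpoly_ring \<and> J \<subseteq> add_generators J ps \<and> set ps \<subseteq> add_generators J ps \<and>
    (\<forall>K. ideal K mpoly_ring \<longrightarrow> J \<subseteq> K \<longrightarrow> set ps \<subseteq> K \<longrightarrow> add_generators J ps \<subseteq> K)"
    using assms
  proof (induction ps arbitrary: J)
    case (Cons p ps)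
    note g = ideal_add_generator[OF Cons.prems, where p = p]
    note IH = Cons.IH[OF g(1)]
    have "p \<in> add_generators (add_generator J p) ps" using g(3) IH by blast
    then show ?case using IH g(2,4) by (auto dest: subsetD)
  qed simp
  then show "ideal (add_generators J ps) mpoly_ring" "J \<subseteq> add_generators J ps" "set ps \<subseteq> add_generators J ps"
    "\<And>K. ideal K mpoly_ring \<Longrightarrow> J \<subseteq> K \<Longrightarrow> set ps \<subseteq> K \<Longrightarrow> add_generators J ps \<subseteq> K" by blast+
qed

text \<open>Each regular element at the front of the list lifts vanishing in degree
  \<open>s - 1\<close> modulo that element to vanishing in degree \<open>s\<close>.\<close>

theorem koszul_vanishes_below_depth:
  fixes J :: "('v::finite, 'k::field) mpoly set"
  assumes "ideal J mpoly_ring"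
    and "\<And>i g. i < length ps \<Longrightarrow> ps ! i * g \<in> add_generators J (take i ps) \<Longrightarrow> g \<in> add_generators J (take i ps)"
    and "\<And>p a. p \<in> set ps \<Longrightarrow> a \<in> keys p \<Longrightarrow> mdeg a \<ge> 1"
    and "s < length ps"
  shows "koszul_vanishes J s"
  using assms
proof (induction ps arbitrary: J s)
  case (Cons p ps)
  show ?case
  proof (rule koszul_vanishes_step)
    show "ideal J mpoly_ring" by fact
    show "g \<in> J" if "p * g \<in> J" for g using Cons.prems(2)[of 0 g] that by simp
    show "mdeg a \<ge> 1" if "a \<in> keys p" for a using Cons.prems(3)[of p a] that by simp
    assume "s > 0"
    show "koszul_vanishes (add_generator J p) (s - 1)"
    proof (rule Cons.IH)
      show "ideal (add_generator J p) mpoly_ring" using Cons.prems(1) by (rule ideal_add_generator)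
      show "g \<in> add_generators (add_generator J p) (take i ps)"
        if "i < length ps" "ps ! i * g \<in> add_generators (add_generator J p) (take i ps)" for i g
        using Cons.prems(2)[of "Suc i" g] that by simp
    qed (use Cons.prems \<open>s > 0\<close> in auto)
  qed
qed simp

text \<open>Turns regularity in the quotient ring into a statement about lifted polynomials.\<close>

lemma Idl_quot_mem_iff:
  fixes I :: "('v, 'k::field) mpoly set"
  assumes I: "ideal I mpoly_ring"
  shows "coset I g \<in> Idl\<^bsub>mpoly_ring Quot I\<^esub> (set (map (coset I) ps)) \<longleftrightarrow> g \<in> add_generators I ps"
proof
  let ?Q = "mpoly_ring Quot I"
  let ?S = "set (map (coset I) ps)"
  note G = ideal_add_generators[OF I, where ps = ps]
  have "?S \<subseteq> coset I ` add_generators I ps" using G(3) by auto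
  then have "Idl\<^bsub>?Q\<^esub> ?S \<subseteq> coset I ` add_generators I ps"
    by (rule Idl_le[OF ideal_image_quot[OF I G(1)]])
  then show "g \<in> add_generators I ps" if "coset I g \<in> Idl\<^bsub>?Q\<^esub> ?S"
    using that rcos_mem_image_iff[OF I G(1,2), of g] by blast
  have "?S \<subseteq> carrier ?Q" by (auto simp: quot_carrier[OF I])
  then have idl: "ideal (Idl\<^bsub>?Q\<^esub> ?S) ?Q" "?S \<subseteq> Idl\<^bsub>?Q\<^esub> ?S"
    by (rule ring.genideal_ideal[OF cring.axioms(1)[OF quot_cring[OF I]]],
        rule ring.genideal_self[OF cring.axioms(1)[OF quot_cring[OF I]]])
  note v = ideal_vimage_quot[OF I idl(1)]
  have "add_generators I ps \<subseteq> {p. coset I p \<in> Idl\<^bsub>?Q\<^esub> ?S}"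
    using idl(2) by (intro G(4) v) auto
  then show "coset I g \<in> Idl\<^bsub>?Q\<^esub> ?S" if "g \<in> add_generators I ps"
    using that by blast
qed

lemma irrelevant_ideal_keys:
  assumes "p \<in> (irrelevant_ideal :: ('v::finite, 'k::field) mpoly set)" "a \<in> keys p"
  shows "mdeg a \<ge> 1"
proof -
  have "range (\<lambda>v. monom_of (mvar v)) = (monom_of ` range mvar :: ('v, 'k) mpoly set)" by auto
  then have "p \<in> Idl\<^bsub>mpoly_ring\<^esub> (monom_of ` range mvar)" using assms(1) by (simp only: irrelevant_ideal_def)
  then obtain v where "mono_dvd (mvar v) a" using assms(2) by (auto simp: Idl_monomials)
  then obtain b where "a = mvar v + b" by (auto simp: mono_dvd_iff)
  moreover have "mdeg (mvar v) = 1" by (simp add: mdeg_def lookup_single when_def)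
  ultimately show ?thesis by (simp add: mdeg_add)
qed

text \<open>Being strictly below the supremum \<open>depth\<close>, the number \<open>s\<close> is
  below the length of some regular sequence; this avoids asking whether the supremum is
  attained.\<close>

theorem cohen_macaulay_koszul_vanishes:
  fixes I :: "('v::finite, 'k::field) mpoly set"
  assumes I: "ideal I mpoly_ring" and cm: "cohen_macaulay_quot I"
    and "krull_dim (mpoly_ring Quot I) = enat d" "s < d"
  shows "koszul_vanishes I s"
proof -
  have "enat s < depth (mpoly_ring Quot I) (image_mod I irrelevant_ideal)"
    using cm assms(3,4) by (simp add: cohen_macaulay_quot_def)
  then obtain fs where fs: "regular_sequence (mpoly_ring Quot I) fs"
    "set fs \<subseteq> image_mod I irrelevant_ideal" "s < length fs"
    unfolding depth_def less_SUP_iff by auto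
  have "\<forall>f\<in>set fs. \<exists>p. p \<in> irrelevant_ideal \<and> f = coset I p"
    using fs(2) by (auto simp: image_mod_def)
  then obtain P where P: "\<And>f. f \<in> set fs \<Longrightarrow> P f \<in> irrelevant_ideal \<and> f = coset I (P f)"
    by metis
  define ps where "ps = map P fs"
  have fps: "fs = map (coset I) ps"
    unfolding ps_def map_map using P by (intro map_idI[symmetric]) auto
  show ?thesis
  proof (rule koszul_vanishes_below_depth[OF I])
    fix i g assume i: "i < length ps" and pg: "ps ! i * g \<in> add_generators I (take i ps)"
    have t: "take i fs = map (coset I) (take i ps)" by (simp add: fps take_map)
    have "fs ! i \<otimes>\<^bsub>mpoly_ring Quot I\<^esub> (coset I g) = coset I (ps ! i * g)"
      using i by (simp add: fps quot_mult[OF I])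
    then have "fs ! i \<otimes>\<^bsub>mpoly_ring Quot I\<^esub> (coset I g) \<in> Idl\<^bsub>mpoly_ring Quot I\<^esub> (set (take i fs))"
      unfolding t using pg by (simp only: Idl_quot_mem_iff[OF I])
    moreover have "coset I g \<in> carrier (mpoly_ring Quot I)" by (simp add: quot_carrier[OF I])
    moreover have "i < length fs" using i by (simp add: fps)
    ultimately have "coset I g \<in> Idl\<^bsub>mpoly_ring Quot I\<^esub> (set (take i fs))"
      using fs(1) unfolding regular_sequence_def by blast
    then show "g \<in> add_generators I (take i ps)"
      unfolding t by (simp only: Idl_quot_mem_iff[OF I])
  next
    fix p a assume "p \<in> set ps" "a \<in> keys p"
    then show "mdeg a \<ge> 1" using P irrelevant_ideal_keys by (auto simp: ps_def)
  next
    show "s < length ps" using fs(3) by (simp add: ps_def)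
  qed
qed

text \<open>The part of the Koszul complex in the multidegree which is \<open>-1\<close> on \<open>\<sigma>\<close> and \<open>\<beta>\<close> elsewhere
  (for the grading in which the generator indexed by \<open>v\<close> has degree \<open>-2\<close>) is the relative cochain complex of
  the faces containing \<open>\<sigma>\<close>, where \<open>F\<close> is a face if its monomial \<open>m F\<close> is not in the ideal.\<close>

theorem reisner_criterion:
  fixes I :: "('v::finite, 'k::field) mpoly set" and \<phi> :: "'v set \<Rightarrow> 'k" and \<sigma> :: "'v set" and \<beta> :: "'v monomial"
  defines "m \<equiv> \<lambda>F. \<beta> + (\<Sum>v\<in>F. single v (if v \<in> \<sigma> then 1 else 2))"
  assumes I: "monomial_ideal I" and van: "koszul_vanishes I s"
    and \<beta>: "\<And>v. v \<in> \<sigma> \<Longrightarrow> lookup \<beta> v = 0"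
    and \<phi>: "\<And>G. \<sigma> \<subseteq> G \<Longrightarrow> card G = Suc s \<Longrightarrow> monom_of (m G) \<notin> I \<Longrightarrow>
      (\<Sum>v\<in>G - \<sigma>. koszul_sign v (G - {v}) * \<phi> (G - {v})) = 0"
  shows "\<exists>\<chi>. \<forall>F. \<sigma> \<subseteq> F \<longrightarrow> card F = s \<longrightarrow> monom_of (m F) \<notin> I \<longrightarrow>
      \<phi> F = (\<Sum>v\<in>F - \<sigma>. koszul_sign v (F - {v}) * \<chi> (F - {v}))"
proof -
  note idl = monomial_ideal_ideal[OF I]
  have lm: "lookup (m F) v = lookup \<beta> v + (if v \<in> F then if v \<in> \<sigma> then 1 else 2 else 0)" for F v
  proof -
    have "(\<Sum>u\<in>F. lookup (single u (if u \<in> \<sigma> then 1 else 2)) v) =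
        (\<Sum>u\<in>F. if u = v then if v \<in> \<sigma> then 1 else 2 else 0)"
      by (intro sum.cong) (auto simp: lookup_single when_def)
    also have "\<dots> = (if v \<in> F then if v \<in> \<sigma> then 1 else 2 else 0)" by simp
    finally show ?thesis by (simp add: m_def lookup_add lookup_sum)
  qed
  have m_rem: "m G = single v 2 + m (G - {v})" if "v \<in> G - \<sigma>" for G v
    using that by (intro poly_mapping_eqI) (auto simp: lookup_add lm lookup_single when_def)
  \<comment> \<open>The function \<open>\<phi>\<close> is placed in one multidegree: by
    \<open>m_rem\<close> the monomials \<open>m G\<close> and \<open>m (G - {v})\<close> differ by
    the coefficient of the differential.\<close>
  define z where "z F = (if \<sigma> \<subseteq> F then single (m F) (\<phi> F) else 0)" for F
  have "koszul_d z G \<in> I" if G: "card G = Suc s" for G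
  proof (cases "\<sigma> \<subseteq> G")
    case True
    have "koszul_d z G = (\<Sum>v\<in>G - \<sigma>. single (single v 2) (koszul_sign v (G - {v})) * z (G - {v}))"
      unfolding koszul_d_def using True by (intro sum.mono_neutral_right) (auto simp: z_def)
    also have "\<dots> = (\<Sum>v\<in>G - \<sigma>. single (m G) (koszul_sign v (G - {v}) * \<phi> (G - {v})))"
    proof (rule sum.cong)
      fix v assume v: "v \<in> G - \<sigma>"
      then have "\<sigma> \<subseteq> G - {v}" using True by auto
      then show "single (single v 2) (koszul_sign v (G - {v})) * z (G - {v}) =
          single (m G) (koszul_sign v (G - {v}) * \<phi> (G - {v}))"
        by (simp add: z_def mult_single m_rem[OF v])
    qed simp
    also have "\<dots> = single (m G) (\<Sum>v\<in>G - \<sigma>. koszul_sign v (G - {v}) * \<phi> (G - {v}))"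
    proof -
      have "finite T \<Longrightarrow> (\<Sum>v\<in>T. single (m G) (c v)) = single (m G) (sum c T)"
        for T :: "'v set" and c :: "'v \<Rightarrow> 'k"
        by (induction T rule: finite_induct) (simp_all add: single_add)
      then show ?thesis by simp
    qed
    finally have d: "koszul_d z G = single (m G) (\<Sum>v\<in>G - \<sigma>. koszul_sign v (G - {v}) * \<phi> (G - {v}))" .
    show ?thesis
    proof (cases "monom_of (m G) \<in> I")
      case True
      then show ?thesis unfolding d by (subst single_eq_scale_monom) (rule ideal_closed(3)[OF idl])
    next
      case False
      then show ?thesis unfolding d using \<phi>[OF True G] ideal_closed(1)[OF idl] by simp
    qed
  next
    case False
    then have "koszul_d z G = 0" unfolding koszul_d_def by (intro sum.neutral) (auto simp: z_def)
    then show ?thesis using ideal_closed(1)[OF idl] by simp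
  qed
  then have "koszul_coboundary I s z" using van by (simp add: koszul_vanishes_def koszul_cocycle_def)
  then obtain w where w: "\<And>F. card F = s \<Longrightarrow> z F - koszul_d w F \<in> I" by (auto simp: koszul_coboundary_def)
  have "\<phi> F = (\<Sum>v\<in>F - \<sigma>. koszul_sign v (F - {v}) * lookup (w (F - {v})) (m (F - {v})))"
    if F: "\<sigma> \<subseteq> F" "card F = s" "monom_of (m F) \<notin> I" for F
  proof -
    have "m F \<notin> keys (z F - koszul_d w F)"
      using w[OF F(2)] F(3) monomial_ideal_mem_iff[OF I] by blast
    then have "\<phi> F = lookup (koszul_d w F) (m F)"
      using F(1) by (simp add: in_keys_iff lookup_minus z_def)
    also have "\<dots> = (\<Sum>v\<in>F. lookup
        (single (single v 2) (koszul_sign v (F - {v})) * w (F - {v})) (m F))"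
      by (simp add: koszul_d_def lookup_sum)
    also have "\<dots> = (\<Sum>v\<in>F - \<sigma>. lookup
        (single (single v 2) (koszul_sign v (F - {v})) * w (F - {v})) (m F))"
    proof (rule sum.mono_neutral_right)
      show "\<forall>v\<in>F - (F - \<sigma>). lookup
          (single (single v 2) (koszul_sign v (F - {v})) * w (F - {v})) (m F) = 0"
      proof
        fix v assume v: "v \<in> F - (F - \<sigma>)"
        \<comment> \<open>On \<open>\<sigma>\<close> the exponents are only 1, so no term that drops
          a vertex of \<open>\<sigma>\<close> reaches this multidegree: here the entry -1 forces
          sets to contain \<open>\<sigma>\<close>.\<close>
        have "lookup (m F) v < lookup (single v (2::nat)) v"
          using v \<beta> by (simp add: lm)
        then have "\<not> mono_dvd (single v 2) (m F)" unfolding mono_dvd_def by (metis not_less)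
        then show "lookup
          (single (single v 2) (koszul_sign v (F - {v})) * w (F - {v})) (m F) = 0"
          by (simp add: lookup_single_mult)
      qed
    qed auto
    also have "\<dots> = (\<Sum>v\<in>F - \<sigma>. koszul_sign v (F - {v}) * lookup (w (F - {v})) (m (F - {v})))"
    proof (rule sum.cong)
      fix v assume v: "v \<in> F - \<sigma>"
      have "mono_dvd (single v 2) (m F)" unfolding mono_dvd_iff using m_rem[OF v] by blast
      moreover have "m F - single v 2 = m (F - {v})" by (simp add: m_rem[OF v])
      ultimately show "lookup
          (single (single v 2) (koszul_sign v (F - {v})) * w (F - {v})) (m F) =
          koszul_sign v (F - {v}) * lookup (w (F - {v})) (m (F - {v}))"
        by (simp add: lookup_single_mult)
    qed simp
    finally show ?thesis .
  qed
  then show ?thesis by (intro exI[of _ "\<lambda>H. lookup (w H) (m H)"]) simp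
qed


section \<open>Hilbert function and multiplicity\<close>

lemma subfield_constants: "subfield constants (mpoly_ring :: ('v, 'k::field) mpoly ring)"
proof -
  have "single 0 \<in> ring_hom (ring_of_type_algebra :: 'k ring) (mpoly_ring :: ('v, 'k) mpoly ring)"
    by (rule ring_hom_memI) (simp_all add: mult_single single_add)
  then have hom: "ring_hom_ring (ring_of_type_algebra :: 'k ring) (mpoly_ring :: ('v, 'k) mpoly ring) (single 0)"
    by (intro ring_hom_ringI2 ring_from_type_algebra)
  have "subfield (carrier (ring_of_type_algebra :: 'k ring)) ring_of_type_algebra"
    by (rule field.carrier_is_subfield[OF field_from_type_algebra])
  from ring_hom_ring.img_is_subfield(2)[OF hom this] show ?thesis by (simp add: constants_def)
qed

section \<open>Dimensions of pieces of a monomial quotient\<close>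

context
  fixes I :: "('v::finite, 'k::field) mpoly set"
  assumes I: "monomial_ideal I" and proper: "monom_of 0 \<notin> I"
begin

lemma subfield_constants_quot: "subfield (image_mod I constants) (mpoly_ring Quot I)"
proof -
  note idl = monomial_ideal_ideal[OF I]
  have "\<one>\<^bsub>mpoly_ring Quot I\<^esub> \<noteq> \<zero>\<^bsub>mpoly_ring Quot I\<^esub>"
    using proper by (simp add: quot_one[OF idl] quot_zero[OF idl] quot_rcos_eq_iff[OF idl] monom_of_def)
  from ring_hom_ring.img_is_subfield(2)[OF quot_hom[OF idl] subfield_constants this]
  show ?thesis by (simp add: image_mod_def)
qed

text \<open>A polynomial in \<open>I\<close> has all its monomials in \<open>I\<close>, so a further
  monomial outside \<open>I\<close> is independent of the others and extends their span by a
  line.\<close>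

lemma dimension_standard_monomials:
  assumes "finite B" "\<And>b. b \<in> B \<Longrightarrow> monom_of b \<notin> I"
  shows "ring.dimension (mpoly_ring Quot I) (card B) (image_mod I constants) (image_mod I {p. keys p \<subseteq> B})"
  using assms
proof (induction B)
  note idl = monomial_ideal_ideal[OF I]
  interpret Q: ring "mpoly_ring Quot I" using quot_cring[OF idl] by (rule cring.axioms(1))
  case empty
  have "image_mod I {p. keys p \<subseteq> {}} = {\<zero>\<^bsub>mpoly_ring Quot I\<^esub>}"
    by (simp add: image_mod_def quot_zero[OF idl])
  then show ?case using Q.zero_dim by simp
next
  note idl = monomial_ideal_ideal[OF I]
  interpret Q: ring "mpoly_ring Quot I" using quot_cring[OF idl] by (rule cring.axioms(1))
  case (insert b B)
  let ?rc = "coset I"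
  let ?E = "image_mod I {p. keys p \<subseteq> B}"
  let ?K = "image_mod I (constants :: ('v, 'k) mpoly set)"
  have notin: "?rc (monom_of b) \<notin> ?E"
  proof
    assume "?rc (monom_of b) \<in> ?E"
    then obtain p where p: "keys p \<subseteq> B" "monom_of b - p \<in> I"
      by (auto simp: image_mod_def quot_rcos_eq_iff[OF idl])
    have "b \<notin> keys p" using p(1) insert.hyps(2) by blast
    then have "b \<in> keys (monom_of b - p)"
      by (simp add: in_keys_iff lookup_minus monom_of_def)
    then have "monom_of b \<in> I" using p(2) monomial_ideal_mem_iff[OF I] by blast
    then show False using insert.prems by simp
  qed
  have ext: "Q.line_extension ?K (?rc (monom_of b)) ?E = image_mod I {p. keys p \<subseteq> insert b B}"
  proof
    show "Q.line_extension ?K (?rc (monom_of b)) ?E \<subseteq> image_mod I {p. keys p \<subseteq> insert b B}"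
    proof
      fix x assume "x \<in> Q.line_extension ?K (?rc (monom_of b)) ?E"
      then obtain c p where x: "x = (?rc (single 0 c) \<otimes>\<^bsub>mpoly_ring Quot I\<^esub> ?rc (monom_of b)) \<oplus>\<^bsub>mpoly_ring Quot I\<^esub> ?rc p"
        and p: "keys p \<subseteq> B"
        unfolding Q.line_extension_def r_coset_def set_add_def' by (auto simp: image_mod_def constants_def)
      have "x = ?rc (single b c + p)"
        by (simp add: x quot_mult[OF idl] quot_add[OF idl] monom_of_def mult_single)
      moreover have "keys (single b c + p) \<subseteq> insert b B"
        using keys_add[of "single b c" p] p by (auto split: if_splits)
      ultimately show "x \<in> image_mod I {p. keys p \<subseteq> insert b B}" by (auto simp: image_mod_def)
    qed
    show "image_mod I {p. keys p \<subseteq> insert b B} \<subseteq> Q.line_extension ?K (?rc (monom_of b)) ?E"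
    proof
      fix x assume "x \<in> image_mod I {p. keys p \<subseteq> insert b B}"
      then obtain p where p: "x = ?rc p" "keys p \<subseteq> insert b B" by (auto simp: image_mod_def)
      define c where "c = lookup p b"
      define q where "q = p - single b c"
      have q: "keys q \<subseteq> B"
      proof
        fix a assume "a \<in> keys q"
        then have "lookup p a - (c when b = a) \<noteq> 0" by (simp add: q_def in_keys_iff lookup_minus lookup_single)
        then have "a \<noteq> b" "lookup p a \<noteq> 0" by (auto simp: c_def when_def split: if_splits)
        then show "a \<in> B" using p(2) by (auto simp: in_keys_iff)
      qed
      have "x = (?rc (single 0 c) \<otimes>\<^bsub>mpoly_ring Quot I\<^esub> ?rc (monom_of b)) \<oplus>\<^bsub>mpoly_ring Quot I\<^esub> ?rc q"
        by (simp add: p(1) q_def quot_mult[OF idl] quot_add[OF idl] monom_of_def mult_single)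
      moreover have "?rc (single 0 c) \<in> ?K" "?rc q \<in> ?E"
        using q by (auto simp: image_mod_def constants_def)
      ultimately show "x \<in> Q.line_extension ?K (?rc (monom_of b)) ?E"
        unfolding Q.line_extension_def r_coset_def set_add_def' by blast
    qed
  qed
  have "Q.dimension (card B) ?K ?E" using insert by simp
  then have "Q.dimension (Suc (card B)) ?K (Q.line_extension ?K (?rc (monom_of b)) ?E)"
    by (intro Q.Suc_dim notin) (simp_all add: quot_carrier[OF idl])
  then show ?case using insert.hyps by (simp add: ext)
qed

text \<open>Dropping from a polynomial its monomials in \<open>I\<close> does not change its coset,
  so only the monomials outside \<open>I\<close> span.\<close>

lemma dim_mod_eq_card:
  assumes "finite {a\<in>U. monom_of a \<notin> I}"
  shows "dim_mod I {p. keys p \<subseteq> U} = card {a\<in>U. monom_of a \<notin> I}"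
proof -
  note idl = monomial_ideal_ideal[OF I]
  interpret Q: ring "mpoly_ring Quot I" using quot_cring[OF idl] by (rule cring.axioms(1))
  let ?B = "{a\<in>U. monom_of a \<notin> I}"
  let ?rc = "coset I"
  have "image_mod I {p. keys p \<subseteq> U} = image_mod I {p. keys p \<subseteq> ?B}"
  proof
    show "image_mod I {p. keys p \<subseteq> ?B} \<subseteq> image_mod I {p. keys p \<subseteq> U}"
      unfolding image_mod_def by (rule image_mono) auto
    show "image_mod I {p. keys p \<subseteq> U} \<subseteq> image_mod I {p. keys p \<subseteq> ?B}"
    proof
      fix x assume "x \<in> image_mod I {p. keys p \<subseteq> U}"
      then obtain p where p: "x = ?rc p" "keys p \<subseteq> U" by (auto simp: image_mod_def)
      define q where "q = (\<Sum>a\<in>keys p \<inter> ?B. single a (lookup p a))"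
      have lq: "lookup q a = (if a \<in> keys p \<inter> ?B then lookup p a else 0)" for a
      proof -
        have "lookup q a = (\<Sum>b\<in>keys p \<inter> ?B. if b = a then lookup p b else 0)"
          unfolding q_def lookup_sum by (intro sum.cong) (auto simp: lookup_single when_def)
        then show ?thesis by simp
      qed
      have "p - q \<in> I"
      proof (rule ideal_mem_if_monomials[OF idl])
        fix a assume "a \<in> keys (p - q)"
        then have "lookup p a - lookup q a \<noteq> 0" by (simp add: in_keys_iff lookup_minus)
        then have "a \<in> keys p" "a \<notin> ?B" by (auto simp: lq in_keys_iff split: if_splits)
        then show "monom_of a \<in> I" using p(2) by blast
      qed
      then have "x = ?rc q" using p(1) by (simp add: quot_rcos_eq_iff[OF idl])
      moreover have "keys q \<subseteq> ?B" by (auto simp: in_keys_iff lq split: if_splits)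
      ultimately show "x \<in> image_mod I {p. keys p \<subseteq> ?B}" by (auto simp: image_mod_def)
    qed
  qed
  then have "Q.dimension (card ?B) (image_mod I constants) (image_mod I {p. keys p \<subseteq> U})"
    using dimension_standard_monomials[OF assms] by simp
  then show ?thesis unfolding dim_mod_def by (rule Q.dimI[OF subfield_constants_quot])
qed

lemma hilbert_function_eq_card: "hilbert_function I i = card {a. mdeg a = i \<and> monom_of a \<notin> I}"
proof -
  have "{a. mdeg a = i} \<subseteq> (monomial_box i :: 'v monomial set)"
    unfolding monomial_box_def mdeg_def by (auto intro: member_le_sum)
  then have "finite {a :: 'v monomial. mdeg a = i}" using monomial_box_card(1) by (rule finite_subset)
  then have "finite {a \<in> {a. mdeg a = i}. monom_of a \<notin> I}" by simp
  from dim_mod_eq_card[OF this]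
  have "dim_mod I {p. keys p \<subseteq> {a. mdeg a = i}} = card {a. mdeg a = i \<and> monom_of a \<notin> I}" by simp
  moreover have "homogeneous_part i = {p :: ('v, 'k) mpoly. keys p \<subseteq> {a. mdeg a = i}}"
    by (auto simp: homogeneous_part_def)
  ultimately show ?thesis by (simp add: hilbert_function_def)
qed

end

text \<open>Stars and bars for the exponent lists along an enumeration of \<open>Y\<close>.
  Truncated subtraction is right also for empty \<open>Y\<close>: it gives 1 for
  \<open>j = 0\<close> and 0 otherwise.\<close>

lemma card_monomials_of_degree:
  "card {b :: 'v::finite monomial. keys b \<subseteq> Y \<and> mdeg b = j} = (j + card Y - 1) choose j"
proof -
  obtain ys where ys: "set ys = Y" "distinct ys" using finite_distinct_list[of Y] by auto
  have len: "length ys = card Y" using ys distinct_card by force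
  let ?f = "\<lambda>b :: 'v monomial. map (lookup b) ys"
  have mdeg: "mdeg b = sum_list (?f b)" if "keys b \<subseteq> Y" for b
  proof -
    have "mdeg b = (\<Sum>v\<in>Y. lookup b v)"
      unfolding mdeg_def using that by (intro sum.mono_neutral_right) (auto simp: in_keys_iff)
    also have "\<dots> = sum_list (?f b)" using ys by (simp add: sum_list_distinct_conv_sum_set)
    finally show ?thesis .
  qed
  have "bij_betw ?f {b. keys b \<subseteq> Y \<and> mdeg b = j} {l. length l = card Y \<and> sum_list l = j}"
  proof (rule bij_betw_imageI)
    show "inj_on ?f {b. keys b \<subseteq> Y \<and> mdeg b = j}"
    proof (rule inj_onI, rule poly_mapping_eqI)
      fix b b' :: "'v monomial" and v
      assume b: "b \<in> {b. keys b \<subseteq> Y \<and> mdeg b = j}" "b' \<in> {b. keys b \<subseteq> Y \<and> mdeg b = j}" "?f b = ?f b'"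
      show "lookup b v = lookup b' v"
      proof (cases "v \<in> Y")
        case True
        then show ?thesis using b(3) ys(1) by auto
      next
        case False
        then have "v \<notin> keys b" "v \<notin> keys b'" using b by auto
        then show ?thesis by (simp add: in_keys_iff)
      qed
    qed
    show "?f ` {b. keys b \<subseteq> Y \<and> mdeg b = j} = {l. length l = card Y \<and> sum_list l = j}"
    proof
      show "?f ` {b. keys b \<subseteq> Y \<and> mdeg b = j} \<subseteq> {l. length l = card Y \<and> sum_list l = j}"
        using mdeg len by auto
      show "{l. length l = card Y \<and> sum_list l = j} \<subseteq> ?f ` {b. keys b \<subseteq> Y \<and> mdeg b = j}"
      proof
        fix l :: "nat list" assume l: "l \<in> {l. length l = card Y \<and> sum_list l = j}"
        define b where "b = (\<Sum>i<card Y. single (ys ! i) (l ! i))"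
        have look: "lookup b v = (\<Sum>i<card Y. if ys ! i = v then l ! i else 0)" for v
          unfolding b_def lookup_sum by (intro sum.cong) (auto simp: lookup_single when_def)
        have k: "keys b \<subseteq> Y"
        proof
          fix v assume "v \<in> keys b"
          then have "(\<Sum>i<card Y. if ys ! i = v then l ! i else 0) \<noteq> 0" by (simp add: in_keys_iff look)
          then obtain i where "i \<in> {..<card Y}" "(if ys ! i = v then l ! i else 0) \<noteq> 0"
            by (rule sum.not_neutral_contains_not_neutral)
          then have "i < length ys" "ys ! i = v" using len by (auto split: if_splits)
          then show "v \<in> Y" using nth_mem[of i ys] ys(1) by simp
        qed
        have "?f b = l"
        proof (rule nth_equalityI)
          show "length (?f b) = length l" using l len by simp
          fix i assume "i < length (?f b)"
          then have i: "i < card Y" using len by simp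
          have "lookup b (ys ! i) = (\<Sum>k<card Y. if k = i then l ! k else 0)"
            unfolding look using i ys(2) len by (intro sum.cong) (auto simp: nth_eq_iff_index_eq)
          then show "?f b ! i = l ! i" using i len by simp
        qed
        moreover have "mdeg b = j" using mdeg[OF k] l calculation by simp
        ultimately show "l \<in> ?f ` {b. keys b \<subseteq> Y \<and> mdeg b = j}" using k by blast
      qed
    qed
  qed
  then have "card {b. keys b \<subseteq> Y \<and> mdeg b = j} = card {l :: nat list. length l = card Y \<and> sum_list l = j}"
    by (rule bij_betw_same_card)
  then show ?thesis using card_length_sum_list[of "card Y" j] by simp
qed

text \<open>Displays the binomial coefficient, up to \<open>fact r\<close>, as a polynomial in
  \<open>j\<close> of degree \<open>r\<close>.\<close>

lemma fact_mult_binomial_eq_prod: "fact r * ((j + r) choose r) = (\<Prod>k=1..r. j + k)"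
proof -
  have "(\<Prod>k=1..r. j + k) * fact j = fact (j + r)"
    by (induction r) (simp_all add: algebra_simps)
  moreover have "fact r * fact j * ((j + r) choose r) = fact (j + r)"
    using binomial_fact_lemma[of r "j + r"] by simp
  ultimately have "fact j * (fact r * ((j + r) choose r)) = fact j * (\<Prod>k=1..r. j + k)"
    by (simp add: algebra_simps)
  then show ?thesis by simp
qed

text \<open>The number of monomials with support \<open>Z\<close> and degree \<open>t\<close> that are squarefree outside \<open>m\<close> given
  variables of \<open>Z\<close>, where \<open>z = card Z\<close>, for \<open>t \<ge> z\<close> and \<open>m > 0\<close>.\<close>

definition support_poly :: "nat \<Rightarrow> nat \<Rightarrow> rat poly" where
  "support_poly z m = (if m = 0 then 0 else
     smult (1 / fact (m - 1)) (\<Prod>k=1..m - 1. [:of_nat k - of_nat z, 1:]))"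

lemma poly_support_poly:
  assumes "z \<le> t" "m > 0"
  shows "poly (support_poly z m) (of_nat t) = of_nat ((t - z + m - 1) choose (t - z))"
proof -
  obtain r where m: "m = Suc r" using assms(2) gr0_implies_Suc by blast
  obtain j where t: "t = z + j" using assms(1) le_Suc_ex by blast
  have "of_nat (fact r * ((j + r) choose r)) = (of_nat (\<Prod>k=1..r. j + k) :: rat)"
    by (simp only: fact_mult_binomial_eq_prod)
  then have "of_nat ((j + r) choose r) = (1 / fact r) * (\<Prod>k=1..r. of_nat j + of_nat k :: rat)"
    by (simp add: field_simps)
  moreover have "(j + r) choose j = (j + r) choose r" using binomial_symmetric[of j "j + r"] by simp
  moreover have "poly (support_poly z m) (of_nat t) = (1 / fact r) * (\<Prod>k=1..r. of_nat j + of_nat k)"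
    by (simp add: support_poly_def m t poly_prod algebra_simps)
  ultimately show ?thesis by (simp add: m t)
qed

lemma coeff_support_poly:
  assumes "m > 0"
  shows "degree (support_poly z m) = m - 1" "coeff (support_poly z m) (m - 1) = 1 / fact (m - 1)"
proof -
  let ?P = "\<Prod>k=1..m - 1. [:of_nat k - of_nat z, 1 :: rat:]"
  have d: "degree ?P = m - 1" by (subst degree_prod_eq_sum_degree) auto
  have l: "lead_coeff ?P = 1" by (simp add: lead_coeff_prod)
  show "degree (support_poly z m) = m - 1" using assms d by (simp add: support_poly_def)
  show "coeff (support_poly z m) (m - 1) = 1 / fact (m - 1)"
    using assms l d by (simp add: support_poly_def)
qed

lemma degree_support_poly_le: "m \<le> d \<Longrightarrow> degree (support_poly z m) \<le> d - 1"
  using coeff_support_poly(1)[of m z] by (cases "m = 0") (auto simp: support_poly_def)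

lemma coeff_support_poly_top:
  assumes "m \<le> d" "d > 0"
  shows "coeff (support_poly z m) (d - 1) = (if m = d then 1 / fact (d - 1) else 0)"
proof -
  consider "m = d" | "m = 0" | "0 < m" "m < d" using assms by linarith
  then show ?thesis
  proof cases
    case 3
    then have "degree (support_poly z m) < d - 1" by (simp add: coeff_support_poly)
    then show ?thesis using 3 by (simp add: coeff_eq_0)
  qed (use assms coeff_support_poly(2)[of m z] in \<open>auto simp: support_poly_def\<close>)
qed

text \<open>The ideal as a graph with loops: \<open>adj\<close> stands for the squarefree
  generators, \<open>L\<close> for the variables whose squares lie in \<open>I\<close>. Stating
  membership directly for monomials suits both the count of standard monomials and the Koszul
  argument.\<close>

locale quadratic_ideal =
  fixes I :: "('v::finite, 'k::field) mpoly set" and adj :: "'v \<Rightarrow> 'v \<Rightarrow> bool" and L :: "'v set"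
  assumes monomial: "monomial_ideal I"
    and adj_sym: "adj u v \<Longrightarrow> adj v u"
    and adj_irrefl: "\<not> adj u u"
    and monom_mem_iff: "monom_of a \<in> I \<longleftrightarrow>
      (\<exists>u v. adj u v \<and> lookup a u > 0 \<and> lookup a v > 0) \<or>
      (\<exists>v\<in>L. lookup a v \<ge> 2)"
begin

definition independent_set :: "'v set \<Rightarrow> bool" where
  "independent_set Z \<longleftrightarrow> (\<forall>u\<in>Z. \<forall>v\<in>Z. \<not> adj u v)"

lemma independent_set_subset: "independent_set Z \<Longrightarrow> W \<subseteq> Z \<Longrightarrow> independent_set W"
  by (auto simp: independent_set_def)

definition squarefree_monomial :: "'v set \<Rightarrow> 'v monomial" where
  "squarefree_monomial Z = (\<Sum>v\<in>Z. mvar v)"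

lemma lookup_squarefree_monomial:
  "lookup (squarefree_monomial Z) v = (if v \<in> Z then 1 else 0)"
proof -
  have "lookup (squarefree_monomial Z) v = (\<Sum>u\<in>Z. if u = v then 1 else 0)"
    unfolding squarefree_monomial_def lookup_sum by (intro sum.cong) (auto simp: lookup_single when_def)
  then show ?thesis by simp
qed

lemma mdeg_squarefree_monomial: "mdeg (squarefree_monomial Z) = card Z"
  by (simp add: mdeg_def lookup_squarefree_monomial sum.If_cases)

definition standard_on :: "'v set \<Rightarrow> 'v monomial set" where
  "standard_on Z = {a. keys a = Z \<and> (\<forall>v\<in>L. lookup a v \<le> 1)}"

lemma standard_iff:
  "monom_of a \<notin> I \<longleftrightarrow> independent_set (keys a) \<and> a \<in> standard_on (keys a)"
proof -
  have "(\<exists>u v. adj u v \<and> lookup a u > 0 \<and> lookup a v > 0) \<longleftrightarrow>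
      \<not> independent_set (keys a)"
    by (auto simp: independent_set_def in_keys_iff Bex_def)
  moreover have "n \<ge> 2 \<longleftrightarrow> \<not> n \<le> 1" for n :: nat by auto
  ultimately show ?thesis unfolding monom_mem_iff standard_on_def by auto
qed

lemma standard_on_eq:
  "standard_on Z = (+) (squarefree_monomial Z) ` {b. keys b \<subseteq> Z - L}"
proof
  show "standard_on Z \<subseteq> (+) (squarefree_monomial Z) ` {b. keys b \<subseteq> Z - L}"
  proof
    fix a assume a: "a \<in> standard_on Z"
    have "a = squarefree_monomial Z + (a - squarefree_monomial Z)"
      using a by (intro poly_mapping_eqI) (auto simp: standard_on_def lookup_add lookup_minus lookup_squarefree_monomial in_keys_iff)
    moreover have "keys (a - squarefree_monomial Z) \<subseteq> Z - L"
    proof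
      fix v assume "v \<in> keys (a - squarefree_monomial Z)"
      then have lt: "(if v \<in> Z then 1 else 0) < lookup a v"
        by (simp add: in_keys_iff lookup_minus lookup_squarefree_monomial)
      then have "v \<in> Z" using a by (auto simp: standard_on_def in_keys_iff)
      moreover have "v \<notin> L" using a lt \<open>v \<in> Z\<close> by (auto simp: standard_on_def)
      ultimately show "v \<in> Z - L" by simp
    qed
    ultimately show "a \<in> (+) (squarefree_monomial Z) ` {b. keys b \<subseteq> Z - L}" by blast
  qed
  show "(+) (squarefree_monomial Z) ` {b. keys b \<subseteq> Z - L} \<subseteq> standard_on Z"
  proof clarify
    fix b :: "'v monomial" assume b: "keys b \<subseteq> Z - L"
    have z: "lookup b v = 0" if "v \<notin> Z - L" for v using b that by (auto simp: in_keys_iff)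
    have "v \<in> keys (squarefree_monomial Z + b) \<longleftrightarrow> v \<in> Z" for v
      using z[of v] by (simp add: in_keys_iff lookup_add lookup_squarefree_monomial)
    moreover have "lookup (squarefree_monomial Z + b) v \<le> 1" if "v \<in> L" for v
      using z[of v] that by (simp add: lookup_add lookup_squarefree_monomial)
    ultimately show "squarefree_monomial Z + b \<in> standard_on Z" unfolding standard_on_def by blast
  qed
qed

lemma card_standard_on_degree:
  assumes "card Z \<le> t"
  shows "card {a\<in>standard_on Z. mdeg a = t} = (t - card Z + card (Z - L) - 1) choose (t - card Z)"
proof -
  have "{a\<in>standard_on Z. mdeg a = t} =
      (+) (squarefree_monomial Z) ` {b. keys b \<subseteq> Z - L \<and> mdeg b = t - card Z}"
  proof -
    have "{a\<in>standard_on Z. mdeg a = t} =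
        (+) (squarefree_monomial Z) ` {b. keys b \<subseteq> Z - L \<and> mdeg (squarefree_monomial Z + b) = t}"
      unfolding standard_on_eq by blast
    moreover have "mdeg (squarefree_monomial Z + b) = t \<longleftrightarrow> mdeg b = t - card Z" for b
      using assms by (auto simp: mdeg_add mdeg_squarefree_monomial)
    ultimately show ?thesis by simp
  qed
  then have "card {a\<in>standard_on Z. mdeg a = t} = card {b :: 'v monomial. keys b \<subseteq> Z - L \<and> mdeg b = t - card Z}"
    by (simp add: card_image)
  then show ?thesis by (simp add: card_monomials_of_degree)
qed

lemma proper: "monom_of 0 \<notin> I"
  by (simp add: monom_mem_iff)

lemma hilbert_function_eq_sum:
  "hilbert_function I t = (\<Sum>Z\<in>{Z. independent_set Z}. card {a\<in>standard_on Z. mdeg a = t})"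
proof -
  have "{a. mdeg a = t \<and> monom_of a \<notin> I} = (\<Union>Z\<in>{Z. independent_set Z}. {a\<in>standard_on Z. mdeg a = t})"
    unfolding standard_iff by (auto simp: standard_on_def)
  moreover have "finite {a :: 'v monomial. mdeg a = t}"
  proof (rule finite_subset)
    show "{a. mdeg a = t} \<subseteq> (monomial_box t :: 'v monomial set)"
      unfolding monomial_box_def mdeg_def by (auto intro: member_le_sum)
  qed (rule monomial_box_card(1))
  ultimately have "card {a. mdeg a = t \<and> monom_of a \<notin> I} = (\<Sum>Z\<in>{Z. independent_set Z}. card {a\<in>standard_on Z. mdeg a = t})"
    by (simp only:) (rule card_UN_disjoint, auto simp: standard_on_def)
  then show ?thesis by (simp add: hilbert_function_eq_card[OF monomial proper])
qed

text \<open>The standard monomials are grouped by support; once the degree exceeds the number of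
  variables, each group is counted by a polynomial. Polynomials agreeing at all large integers
  coincide, which settles the definite description.\<close>

lemma hilbert_poly_eq:
  "hilbert_poly I = (\<Sum>Z\<in>{Z. independent_set Z}. support_poly (card Z) (card (Z - L)))" (is "_ = ?P")
  unfolding hilbert_poly_def
proof (rule the_equality)
  have one: "of_nat (card {a\<in>standard_on Z. mdeg a = t}) = poly (support_poly (card Z) (card (Z - L))) (of_nat t)"
    if "t > card (UNIV :: 'v set)" for Z t
  proof -
    have "card Z \<le> card (UNIV :: 'v set)" by (intro card_mono) auto
    then have t: "card Z < t" using that by simp
    show ?thesis
    proof (cases "card (Z - L) = 0")
      case True
      \<comment> \<open>For \<open>Z \<subseteq> L\<close> the only standard monomial with support
        \<open>Z\<close> is squarefree, of degree \<open>card Z\<close>. Since \<open>t\<close> is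
        strictly larger, the count is 0 and agrees with the convention in
        \<open>support_poly\<close>.\<close>
      show ?thesis unfolding card_standard_on_degree[OF less_imp_le[OF t]] True support_poly_def
        using t by (simp add: binomial_eq_0)
    next
      case False
      then have "0 < card (Z - L)" by (rule neq0_conv[THEN iffD1])
      then show ?thesis
        by (simp only: card_standard_on_degree[OF less_imp_le[OF t]] poly_support_poly[OF less_imp_le[OF t]])
    qed
  qed
  have ev: "of_nat (hilbert_function I t) = poly ?P (of_nat t)" if "t > card (UNIV :: 'v set)" for t
    by (simp add: hilbert_function_eq_sum poly_sum one[OF that])
  then show ev': "\<forall>\<^sub>F t in sequentially. of_nat (hilbert_function I t) = poly ?P (of_nat t)"
    by (rule eventually_sequentiallyI[of "Suc (card (UNIV :: 'v set))"]) simp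
  fix P :: "rat poly" assume P: "\<forall>\<^sub>F t in sequentially. of_nat (hilbert_function I t) = poly P (of_nat t)"
  define D where "D = P - ?P"
  from P ev' have "\<forall>\<^sub>F t in sequentially. poly D (of_nat t) = 0"
    unfolding D_def by eventually_elim simp
  then obtain N where N: "\<And>t. t \<ge> N \<Longrightarrow> poly D (of_nat t) = 0"
    by (auto simp: eventually_sequentially)
  have "infinite ((of_nat :: nat \<Rightarrow> rat) ` {N..})"
    by (simp add: finite_image_iff inj_on_def infinite_Ici)
  moreover have "of_nat ` {N..} \<subseteq> {x. poly D x = 0}" using N by auto
  ultimately have inf: "infinite {x. poly D x = 0}" by (rule infinite_super[rotated])
  have "D = 0" by (rule ccontr) (use inf poly_roots_finite[of D] in simp)
  then show "P = ?P" by (simp add: D_def)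
qed

text \<open>For \<open>d > 0\<close> exactly the supports with \<open>card (Z - L) = d\<close> reach
  degree \<open>d - 1\<close>, each with leading coefficient \<open>1 / fact (d - 1)\<close>. For
  \<open>d = 0\<close> every independent set lies in \<open>L\<close> and carries one standard
  monomial.\<close>

theorem multiplicity_eq_card:
  assumes dim: "krull_dim (mpoly_ring Quot I) = enat d"
    and le: "\<And>Z. independent_set Z \<Longrightarrow> card (Z - L) \<le> d"
    and ex: "independent_set Z0" "card (Z0 - L) = d"
  shows "multiplicity_quot I = of_nat (card {Z. independent_set Z \<and> card (Z - L) = d})"
proof (cases "d = 0")
  case True
  have ZL: "Z - L = {}" if "independent_set Z" for Z
    using le[OF that] True by (metis card_0_eq finite_code le_zero_eq)
  have std: "{a. monom_of a \<notin> I} = squarefree_monomial ` {Z. independent_set Z}"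
  proof -
    have "standard_on Z = {squarefree_monomial Z}" if "independent_set Z" for Z
      unfolding standard_on_eq ZL[OF that] by simp
    moreover have "{a. monom_of a \<notin> I} = (\<Union>Z\<in>{Z. independent_set Z}. standard_on Z)"
      unfolding standard_iff by (auto simp: standard_on_def)
    ultimately show ?thesis by auto
  qed
  have inj: "inj squarefree_monomial"
  proof (rule injI)
    fix Z W assume "squarefree_monomial Z = squarefree_monomial W"
    then have "(if v \<in> Z then 1 else 0 :: nat) = (if v \<in> W then 1 else 0)" for v
      by (metis lookup_squarefree_monomial)
    then show "Z = W" by (metis subsetI subset_antisym zero_neq_one)
  qed
  have "finite {a \<in> UNIV. monom_of a \<notin> I}" using std by simp
  from dim_mod_eq_card[OF monomial proper this]
  have "dim_mod I UNIV = card {a. monom_of a \<notin> I}" by simp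
  also have "\<dots> = card {Z. independent_set Z}" unfolding std using inj
    by (intro card_image) (auto simp: inj_on_def)
  also have "{Z. independent_set Z} = {Z. independent_set Z \<and> card (Z - L) = d}" using ZL True by auto
  finally show ?thesis using dim True by (simp add: multiplicity_quot_def Let_def)
next
  case False
  let ?S = "{Z. independent_set Z}"
  let ?T = "{Z. independent_set Z \<and> card (Z - L) = d}"
  have co: "coeff (support_poly (card Z) (card (Z - L))) (d - 1) = (if card (Z - L) = d then 1 / fact (d - 1) else 0)"
    if "Z \<in> ?S" for Z
    using that le False by (intro coeff_support_poly_top) auto
  have c: "coeff (hilbert_poly I) (d - 1) = of_nat (card ?T) / fact (d - 1)"
  proof -
    have "coeff (hilbert_poly I) (d - 1) = (\<Sum>Z\<in>?S. if card (Z - L) = d then 1 / fact (d - 1) else 0)"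
      unfolding hilbert_poly_eq coeff_sum by (intro sum.cong co) auto
    also have "\<dots> = (\<Sum>Z\<in>?T. 1 / fact (d - 1))"
      by (subst sum.inter_filter[symmetric]) auto
    finally show ?thesis by simp
  qed
  have "coeff (hilbert_poly I) (d - 1) \<noteq> 0" unfolding c using ex by auto
  then have "d - 1 \<le> degree (hilbert_poly I)" by (rule le_degree)
  moreover have "degree (hilbert_poly I) \<le> d - 1"
    unfolding hilbert_poly_eq
  proof (rule degree_sum_le)
    fix Z assume "Z \<in> ?S"
    then show "degree (support_poly (card Z) (card (Z - L))) \<le> d - 1"
      using le False by (intro degree_support_poly_le) auto
  qed simp
  ultimately have "degree (hilbert_poly I) = d - 1" by simp
  then show ?thesis using dim False c by (simp add: multiplicity_quot_def Let_def)
qed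

end


section \<open>Polarization and the Taylor bounds\<close>

text \<open>Polarization: \<open>x\<^sub>v\<^sup>2\<close> becomes the edge between \<open>(v, 0)\<close> and \<open>(v, 1)\<close>.\<close>

definition polarization :: "'v monomial \<Rightarrow> ('v \<times> nat) set" where
  "polarization a = {(v, j). j < lookup a v}"

lemma card_polarization:
  "finite (polarization (a :: 'v::finite monomial))" "card (polarization a) = mdeg a"
proof -
  have "polarization a = (SIGMA v:UNIV. {..<lookup a v})" by (auto simp: polarization_def)
  then show "finite (polarization a)" "card (polarization a) = mdeg a"
    by (simp_all add: mdeg_def)
qed

lemma inj_polarization: "inj polarization"
proof (rule injI, rule poly_mapping_eqI)
  fix a b :: "'v monomial" and v assume eq: "polarization a = polarization b"
  have "j < lookup a v \<longleftrightarrow> j < lookup b v" for j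
  proof -
    have "(v, j) \<in> polarization a \<longleftrightarrow> (v, j) \<in> polarization b" using eq by simp
    then show ?thesis by (simp add: polarization_def)
  qed
  then show "lookup a v = lookup b v"
    by (metis less_irrefl_nat linorder_neqE_nat)
qed

text \<open>Polarizations are closed downwards in the second coordinate, so the larger of two
  exponents becomes a union. The empty \<open>T\<close> fits because the supremum of no natural
  numbers is 0.\<close>

lemma polarization_lcm:
  fixes T :: "'v::finite monomial set"
  assumes "finite T"
  shows "polarization (lcm_monomial T) = \<Union>(polarization ` T)"
proof -
  have look: "lookup (lcm_monomial T) v = (SUP a\<in>T. lookup a v)" for v
    unfolding lcm_monomial_def by (subst lookup_Abs_poly_mapping) auto
  have "j < (SUP a\<in>T. lookup a v) \<longleftrightarrow> (\<exists>a\<in>T. j < lookup a v)" for v j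
  proof (cases "T = {}")
    case False
    then show ?thesis using assms by (intro less_cSUP_iff bdd_above_finite) auto
  qed (simp add: Sup_nat_def)
  then show ?thesis unfolding polarization_def look by auto
qed

lemma taylor_shift_spans:
  fixes I :: "('v::finite, 'k::field) mpoly set"
  assumes "finite (GEN I)"
  shows "taylor_min_shift I i = min_span (polarization ` GEN I) i"
    "taylor_max_shift I i = max_span (polarization ` GEN I) i"
proof -
  have *: "mdeg (lcm_monomial T) = card (\<Union>(polarization ` T))" "card (polarization ` T) = card T"
    if "T \<subseteq> GEN I" for T
  proof -
    have "finite T" using that assms finite_subset by blast
    then show "mdeg (lcm_monomial T) = card (\<Union>(polarization ` T))"
      by (metis card_polarization(2) polarization_lcm)
    show "card (polarization ` T) = card T"
      using inj_polarization by (intro card_image) (auto simp: inj_on_def)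
  qed
  have "{mdeg (lcm_monomial T) | T. T \<subseteq> GEN I \<and> finite T \<and> card T = i} =
      {card (\<Union>T) | T. T \<subseteq> polarization ` GEN I \<and> card T = i}" (is "?L = ?R")
  proof
    show "?L \<subseteq> ?R"
    proof clarify
      fix T assume T: "T \<subseteq> GEN I" "i = card T"
      show "\<exists>T'. mdeg (lcm_monomial T) = card (\<Union>T') \<and> T' \<subseteq> polarization ` GEN I \<and> card T' = card T"
        using *[OF T(1)] image_mono[OF T(1)] by (intro exI[of _ "polarization ` T"]) simp
    qed
    show "?R \<subseteq> ?L"
    proof clarify
      fix T' assume "T' \<subseteq> polarization ` GEN I" "i = card T'"
      then obtain T where T: "T \<subseteq> GEN I" "T' = polarization ` T" by (auto simp: subset_image_iff)
      moreover have "finite T" using T(1) assms finite_subset by blast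
      ultimately show "\<exists>T. card (\<Union>T') = mdeg (lcm_monomial T) \<and> T \<subseteq> GEN I \<and> finite T \<and> card T = card T'"
        using *[OF T(1)] by (intro exI[of _ T]) simp
    qed
  qed
  then show "taylor_min_shift I i = min_span (polarization ` GEN I) i"
    "taylor_max_shift I i = max_span (polarization ` GEN I) i"
    by (simp_all add: taylor_min_shift_def taylor_max_shift_def min_span_def max_span_def)
qed

lemma ex_maximizer:
  fixes f :: "'a \<Rightarrow> nat"
  assumes "P k" "\<And>y. P y \<Longrightarrow> f y \<le> b"
  shows "\<exists>x. P x \<and> (\<forall>y. P y \<longrightarrow> f y \<le> f x)"
proof -
  have "\<forall>y. P y \<longrightarrow> f y < Suc b" using assms(2) by (simp add: less_Suc_eq_le)
  from ex_has_greatest_nat[of P, OF assms(1) this] show ?thesis .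
qed

section \<open>Minimal generators of quadratic monomial ideals\<close>

lemma mdeg_zero_iff: "mdeg a = 0 \<longleftrightarrow> a = 0"
  by (auto simp: mdeg_def poly_mapping_eq_iff fun_eq_iff)

lemma mdeg_mvar: "mdeg (mvar v) = 1"
  by (simp add: mdeg_def lookup_single when_def)

lemma mdeg_pos_split:
  assumes "mdeg a > 0"
  shows "\<exists>v b. a = mvar v + b"
proof -
  have "\<exists>v. lookup a v \<noteq> 0" using assms by (metis mdeg_zero_iff lookup_zero poly_mapping_eqI less_irrefl_nat)
  then obtain v where "lookup a v > 0" by auto
  then have "mono_dvd (mvar v) a" by (auto simp: mono_dvd_def lookup_single when_def)
  then show ?thesis by (auto simp: mono_dvd_iff)
qed

lemma mdeg_two_split:
  assumes "mdeg a = 2"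
  shows "\<exists>u v. a = mvar u + mvar v"
proof -
  obtain u b where b: "a = mvar u + b" using mdeg_pos_split[of a] assms by auto
  have "mdeg a = 1 + mdeg b" unfolding b mdeg_add mdeg_mvar ..
  then have "mdeg b = 1" using assms by simp
  then obtain v c where c: "b = mvar v + c" using mdeg_pos_split[of b] by auto
  have "mdeg b = 1 + mdeg c" unfolding c mdeg_add mdeg_mvar ..
  then have "mdeg c = 0" using \<open>mdeg b = 1\<close> by simp
  then show ?thesis using b c by (auto simp: mdeg_zero_iff)
qed

lemma mvar_add_self: "mvar v + mvar v = single v 2"
  by (simp only: single_add[symmetric] one_add_one)

text \<open>Among the divisors of \<open>a\<close> in \<open>I\<close>, one of least degree is
  minimal for divisibility.\<close>

lemma ex_GEN_dvd:
  fixes I :: "('v::finite, 'k::field) mpoly set"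
  assumes "monom_of a \<in> I"
  shows "\<exists>g\<in>GEN I. mono_dvd g a"
proof -
  let ?P = "\<lambda>b. monom_of b \<in> I \<and> mono_dvd b a"
  have "?P a" using assms by simp
  then obtain g where g: "?P g" "\<And>b. ?P b \<Longrightarrow> mdeg g \<le> mdeg b"
    using ex_has_least_nat[of ?P a mdeg] by blast
  have "g \<in> GEN I" unfolding GEN_def
  proof (intro CollectI conjI allI impI)
    show "monom_of g \<in> I" using g by simp
    fix b assume b: "monom_of b \<in> I \<and> (\<forall>v. lookup b v \<le> lookup g v)"
    then have bg: "mono_dvd b g" by (simp add: mono_dvd_def)
    then have "mdeg g \<le> mdeg b" using g b mono_dvd_trans[OF bg] by blast
    moreover obtain t where t: "g = b + t" using bg by (auto simp: mono_dvd_iff)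
    ultimately have "mdeg t = 0" by (simp add: mdeg_add)
    then show "b = g" using t by (simp add: mdeg_zero_iff)
  qed
  then show ?thesis using g by blast
qed

lemma quadratic_ideal_of:
  fixes I :: "('v::finite, 'k::field) mpoly set"
  assumes "quadratic_monomial_ideal I"
  shows "quadratic_ideal I (\<lambda>u v. u \<noteq> v \<and> monom_of (mvar u + mvar v) \<in> I) {v. monom_of (single v 2) \<in> I}"
proof
  show mon: "monomial_ideal I" using assms by (simp add: quadratic_monomial_ideal_def)
  fix a :: "'v monomial"
  show "monom_of a \<in> I \<longleftrightarrow>
      (\<exists>u v. (u \<noteq> v \<and> monom_of (mvar u + mvar v) \<in> I) \<and> lookup a u > 0 \<and> lookup a v > 0) \<or>
      (\<exists>v\<in>{v. monom_of (single v 2) \<in> I}. lookup a v \<ge> 2)" (is "_ \<longleftrightarrow> ?R")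
  proof
    assume "monom_of a \<in> I"
    then obtain g where g: "g \<in> GEN I" "mono_dvd g a" using ex_GEN_dvd by blast
    then have gI: "monom_of g \<in> I" and "mdeg g = 2"
      using assms by (auto simp: GEN_def quadratic_monomial_ideal_def)
    then obtain u v where uv: "g = mvar u + mvar v" using mdeg_two_split by blast
    show ?R
    proof (cases "u = v")
      case True
      then have "g = single v 2" using uv mvar_add_self by simp
      moreover from this have "lookup a v \<ge> 2"
        using g(2) unfolding mono_dvd_def by (metis lookup_single_eq)
      ultimately show ?thesis using gI by auto
    next
      case False
      have "lookup g u > 0" "lookup g v > 0" by (simp_all add: uv lookup_add)
      then have "lookup a u > 0" "lookup a v > 0"
        using g(2) unfolding mono_dvd_def by (meson less_le_trans)+
      then show ?thesis using False gI uv by auto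
    qed
  next
    assume ?R
    then show "monom_of a \<in> I"
    proof (elim disjE exE bexE conjE)
      fix u v assume uv: "u \<noteq> v" "monom_of (mvar u + mvar v) \<in> I" "lookup a u > 0" "lookup a v > 0"
      then have "mono_dvd (mvar u + mvar v) a" by (auto simp: mono_dvd_def lookup_add lookup_single when_def)
      then show ?thesis using monomial_ideal_upward[OF mon uv(2)] by blast
    next
      fix v assume v: "v \<in> {v. monom_of (single v 2) \<in> I}" "lookup a v \<ge> 2"
      then have "mono_dvd (single v 2) a" by (auto simp: mono_dvd_def lookup_single when_def)
      then show ?thesis using monomial_ideal_upward[OF mon] v by blast
    qed
  qed
qed (auto simp: add.commute)

section \<open>The polarized graph and its covers\<close>

context quadratic_ideal
begin

text \<open>A monomial of \<open>I\<close> is divisible by one of the listed monomials, and none of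
  these has a proper divisor in \<open>I\<close>.\<close>

lemma GEN_eq: "GEN I = {mvar u + mvar v | u v. adj u v} \<union> {single v 2 | v. v \<in> L}"
proof
  show "GEN I \<subseteq> {mvar u + mvar v | u v. adj u v} \<union> {single v 2 | v. v \<in> L}"
  proof
    fix a assume a: "a \<in> GEN I"
    then have min: "\<And>b. monom_of b \<in> I \<Longrightarrow> mono_dvd b a \<Longrightarrow> b = a" and "monom_of a \<in> I"
      by (auto simp: GEN_def mono_dvd_def)
    then consider u v where "adj u v" "lookup a u > 0" "lookup a v > 0"
      | v where "v \<in> L" "lookup a v \<ge> 2" using monom_mem_iff by blast
    then show "a \<in> {mvar u + mvar v | u v. adj u v} \<union> {single v 2 | v. v \<in> L}"
    proof cases
      case 1
      then have "u \<noteq> v" using adj_irrefl by auto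
      then have "mono_dvd (mvar u + mvar v) a" using 1 by (auto simp: mono_dvd_def lookup_add lookup_single when_def)
      moreover have "monom_of (mvar u + mvar v) \<in> I"
        unfolding monom_mem_iff using 1(1) by (intro disjI1 exI[of _ u] exI[of _ v]) (simp add: lookup_add)
      ultimately show ?thesis using min 1(1) by blast
    next
      case 2
      then have "mono_dvd (single v 2) a" by (auto simp: mono_dvd_def lookup_single when_def)
      moreover have "monom_of (single v 2) \<in> I"
        unfolding monom_mem_iff using 2(1) by (intro disjI2 bexI[of _ v]) auto
      ultimately show ?thesis using min 2(1) by blast
    qed
  qed
  have "mvar u + mvar v \<in> GEN I" if uv: "adj u v" for u v
  proof -
    have ne: "u \<noteq> v" using uv adj_irrefl by auto
    have "b = mvar u + mvar v" if b: "monom_of b \<in> I" "mono_dvd b (mvar u + mvar v)" for b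
    proof -
      have le: "lookup b w \<le> (if w = u \<or> w = v then 1 else 0)" for w
        using b(2) ne by (auto simp: mono_dvd_def lookup_add lookup_single when_def split: if_splits dest: spec[of _ w])
      have "\<not> (\<exists>w\<in>L. lookup b w \<ge> 2)"
      proof
        assume "\<exists>w\<in>L. lookup b w \<ge> 2"
        then obtain w where "lookup b w \<ge> 2" by blast
        then show False using le[of w] by (auto split: if_splits)
      qed
      then obtain u' v' where uv': "adj u' v'" "lookup b u' > 0" "lookup b v' > 0"
        using b(1) monom_mem_iff by blast
      then have "u' \<noteq> v'" using adj_irrefl by auto
      moreover have "u' = u \<or> u' = v" "v' = u \<or> v' = v" using le[of u'] le[of v'] uv' by (auto split: if_splits)
      ultimately have pos: "lookup b u > 0" "lookup b v > 0" using uv' by auto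
      show ?thesis
      proof (rule poly_mapping_eqI)
        fix w show "lookup b w = lookup (mvar u + mvar v) w"
          using le[of w] pos ne by (auto simp: lookup_add lookup_single when_def)
      qed
    qed
    moreover have "monom_of (mvar u + mvar v) \<in> I"
      unfolding monom_mem_iff using uv by (intro disjI1 exI[of _ u] exI[of _ v]) (simp add: lookup_add)
    ultimately show ?thesis by (auto simp: GEN_def mono_dvd_def)
  qed
  moreover have "single v 2 \<in> GEN I" if v: "v \<in> L" for v
  proof -
    have "b = single v 2" if b: "monom_of b \<in> I" "mono_dvd b (single v 2)" for b
    proof -
      have le: "lookup b w \<le> (if w = v then 2 else 0)" for w
        using b(2) by (auto simp: mono_dvd_def lookup_single when_def split: if_splits dest: spec[of _ w])
      have "\<not> (\<exists>u w. adj u w \<and> lookup b u > 0 \<and> lookup b w > 0)"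
      proof clarify
        fix u w assume "adj u w" "lookup b u > 0" "lookup b w > 0"
        then show False using le[of u] le[of w] adj_irrefl by (auto split: if_splits)
      qed
      then obtain w where "lookup b w \<ge> 2" using b(1) monom_mem_iff by blast
      then have "lookup b v = 2" using le[of w] by (auto split: if_splits)
      show ?thesis
      proof (rule poly_mapping_eqI)
        fix w show "lookup b w = lookup (single v 2) w"
          using le[of w] \<open>lookup b v = 2\<close> by (auto simp: lookup_single when_def)
      qed
    qed
    moreover have "monom_of (single v 2) \<in> I"
      unfolding monom_mem_iff using v by (intro disjI2 bexI[of _ v]) auto
    ultimately show ?thesis by (auto simp: GEN_def mono_dvd_def)
  qed
  ultimately show "{mvar u + mvar v | u v. adj u v} \<union> {single v 2 | v. v \<in> L} \<subseteq> GEN I" by blast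
qed

lemma finite_GEN: "finite (GEN I)"
proof -
  have "GEN I \<subseteq> (\<lambda>(u, v). mvar u + mvar v) ` UNIV \<union> (\<lambda>v. single v 2) ` UNIV"
    unfolding GEN_eq by auto
  then show ?thesis by (rule finite_subset) simp
qed

abbreviation polar_edges :: "('v \<times> nat) set set" where
  "polar_edges \<equiv> polarization ` GEN I"

lemma polar_edges_eq:
  "polar_edges = {{(u, 0), (v, 0)} | u v. adj u v} \<union> {{(v, 0), (v, 1)} | v. v \<in> L}"
proof -
  have edge: "polarization (mvar u + mvar v) = {(u, 0), (v, 0)}" if "adj u v" for u v
    using that adj_irrefl by (auto simp: polarization_def lookup_add lookup_single when_def split: if_splits)
  have loop: "polarization (single v 2) = {(v, 0), (v, 1)}" for v :: 'v
    by (auto simp: polarization_def lookup_single when_def less_2_cases_iff split: if_splits)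
  have "polar_edges = {polarization (mvar u + mvar v) | u v. adj u v} \<union>
      {polarization (single v 2) | v. v \<in> L}"
    unfolding GEN_eq by blast
  moreover have "{polarization (mvar u + mvar v) | u v. adj u v} = {{(u, 0), (v, 0)} | u v. adj u v}"
  proof (intro equalityI subsetI)
    fix x assume "x \<in> {polarization (mvar u + mvar v) | u v. adj u v}"
    then obtain u v where "x = polarization (mvar u + mvar v)" "adj u v" by blast
    then show "x \<in> {{(u, 0), (v, 0)} | u v. adj u v}" using edge by blast
  next
    fix x assume "x \<in> {{(u, 0 :: nat), (v, 0)} | u v. adj u v}"
    then obtain u v where "x = {(u, 0), (v, 0)}" "adj u v" by blast
    then show "x \<in> {polarization (mvar u + mvar v) | u v. adj u v}" using edge by blast
  qed
  ultimately show ?thesis unfolding loop by simp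
qed

lemma edge_set_polar: "edge_set polar_edges"
proof -
  have ne: "u \<noteq> v" if "adj u v" for u v
    using that adj_irrefl by auto
  have "card e = 2" if "e \<in> polar_edges" for e
    using that unfolding polar_edges_eq by (auto simp: card_insert_if dest: ne)
  then show ?thesis using finite_GEN by (simp add: edge_set_def)
qed

lemma vertex_cover_polar_iff:
  "vertex_cover polar_edges C \<longleftrightarrow> (\<forall>u v. adj u v \<longrightarrow> (u, 0) \<in> C \<or> (v, 0) \<in> C) \<and> (\<forall>v\<in>L. (v, 0) \<in> C \<or> (v, 1) \<in> C)"
  unfolding polar_edges_eq vertex_cover_def by (simp add: ball_Un) blast

text \<open>The Stanley-Reisner complex of the radical of \<open>I\<close>: looped variables are
  nilpotent in \<open>S/I\<close>, so they are in no face.\<close>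

definition face :: "'v set \<Rightarrow> bool" where
  "face F \<longleftrightarrow> independent_set F \<and> F \<inter> L = {}"

lemma face_subset: "face F \<Longrightarrow> G \<subseteq> F \<Longrightarrow> face G"
  using independent_set_subset by (auto simp: face_def)

text \<open>For independent \<open>Z\<close>, the least cover that misses exactly the vertices
  \<open>(v, 0)\<close> with \<open>v \<in> Z\<close>: a loop at such a \<open>v\<close> must then
  be covered by \<open>(v, 1)\<close>.\<close>

definition polar_cover :: "'v set \<Rightarrow> ('v \<times> nat) set" where
  "polar_cover Z = (\<lambda>v. (v, 0)) ` (- Z) \<union> (\<lambda>v. (v, 1)) ` (Z \<inter> L)"

lemma mem_polar_cover: "(v, j) \<in> polar_cover Z \<longleftrightarrow> (j = 0 \<and> v \<notin> Z) \<or> (j = 1 \<and> v \<in> Z \<inter> L)"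
  by (auto simp: polar_cover_def)

text \<open>A looped vertex costs one element on either level, so only the vertices of
  \<open>Z - L\<close> save anything.\<close>

lemma card_polar_cover: "card (polar_cover Z) = card (UNIV :: 'v set) - card (Z - L)"
proof -
  have "card (polar_cover Z) = card (- Z) + card (Z \<inter> L)"
    unfolding polar_cover_def by (subst card_Un_disjoint) (auto simp: card_image inj_on_def)
  also have "\<dots> = card (- Z \<union> (Z \<inter> L))" by (rule card_Un_disjoint[symmetric]) auto
  also have "- Z \<union> (Z \<inter> L) = UNIV - (Z - L)" by auto
  also have "card \<dots> = card (UNIV :: 'v set) - card (Z - L)" by (rule card_Diff_subset) auto
  finally show ?thesis .
qed

lemma inj_polar_cover: "inj polar_cover"
proof (rule injI)
  fix Z W assume "polar_cover Z = polar_cover W"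
  then have "v \<notin> Z \<longleftrightarrow> v \<notin> W" for v using mem_polar_cover[of v 0 Z] mem_polar_cover[of v 0 W] by simp
  then show "Z = W" by auto
qed

lemma polar_cover_subset:
  assumes "vertex_cover polar_edges C"
  shows "independent_set {v. (v, 0) \<notin> C}" "polar_cover {v. (v, 0) \<notin> C} \<subseteq> C"
  using assms by (auto simp: vertex_cover_polar_iff independent_set_def polar_cover_def)

lemma vertex_cover_polar_cover: "independent_set Z \<Longrightarrow> vertex_cover polar_edges (polar_cover Z)"
  by (auto simp: vertex_cover_polar_iff independent_set_def mem_polar_cover)

lemma subset_var_ideal_iff: "I \<subseteq> var_ideal D \<longleftrightarrow> face (- D)"
proof
  assume sub: "I \<subseteq> var_ideal D"
  have mem: "\<exists>v\<in>D. lookup a v > 0" if "monom_of a \<in> I" for a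
    using sub that monom_of_mem_var_ideal by blast
  have "\<not> adj u v" if "u \<in> - D" "v \<in> - D" for u v
  proof
    assume uv: "adj u v"
    then have "monom_of (mvar u + mvar v) \<in> I"
      unfolding monom_mem_iff by (intro disjI1 exI[of _ u] exI[of _ v]) (simp add: lookup_add)
    from mem[OF this] show False using that by (auto simp: lookup_add lookup_single when_def split: if_splits)
  qed
  moreover have "v \<notin> L" if "v \<in> - D" for v
  proof
    assume "v \<in> L"
    then have "monom_of (single v 2) \<in> I"
      unfolding monom_mem_iff by (intro disjI2 bexI[of _ v]) auto
    from mem[OF this] show False using that by (auto simp: lookup_single when_def split: if_splits)
  qed
  ultimately show "face (- D)" by (auto simp: face_def independent_set_def)
next
  assume f: "face (- D)"
  show "I \<subseteq> var_ideal D"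
  proof
    fix p assume "p \<in> I"
    then have a: "monom_of a \<in> I" if "a \<in> keys p" for a
      using monomial_ideal_mem_iff[OF monomial] that by blast
    have "\<exists>v\<in>D. lookup a v > 0" if "a \<in> keys p" for a
      using a[OF that] unfolding monom_mem_iff
    proof (elim disjE exE bexE conjE)
      fix u v assume "adj u v" "lookup a u > 0" "lookup a v > 0"
      then show ?thesis using f by (auto simp: face_def independent_set_def)
    next
      fix v assume "v \<in> L" "lookup a v \<ge> 2"
      then show ?thesis using f by (intro bexI[of _ v]) (auto simp: face_def)
    qed
    then show "p \<in> var_ideal D" by (auto simp: var_ideal_def)
  qed
qed

text \<open>The monomial \<open>m F\<close> of \<open>reisner_criterion\<close>, with
  \<open>\<beta>\<close> the squarefree monomial of \<open>T\<close>; \<open>T\<close> will be a set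
  of looped variables.\<close>

definition face_monomial :: "'v set \<Rightarrow> 'v set \<Rightarrow> 'v set \<Rightarrow> 'v monomial" where
  "face_monomial T \<sigma> F = squarefree_monomial T + (\<Sum>v\<in>F. single v (if v \<in> \<sigma> then 1 else 2))"

lemma lookup_face_monomial:
  "lookup (face_monomial T \<sigma> F) v =
    (if v \<in> T then 1 else 0) + (if v \<in> F then if v \<in> \<sigma> then 1 else 2 else 0)"
proof -
  have "(\<Sum>u\<in>F. lookup (single u (if u \<in> \<sigma> then 1 else 2)) v) =
      (\<Sum>u\<in>F. if u = v then if v \<in> \<sigma> then 1 else 2 else 0)"
    by (intro sum.cong) (auto simp: lookup_single when_def)
  also have "\<dots> = (if v \<in> F then if v \<in> \<sigma> then 1 else 2 else 0)" by simp
  finally show ?thesis by (simp add: face_monomial_def lookup_add lookup_sum lookup_squarefree_monomial)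
qed

text \<open>Exponent 1 at a looped variable of \<open>T\<close> is harmless by itself and only adds
  that variable to the support. A looped variable in \<open>F\<close> is outside
  \<open>\<sigma>\<close>, so its exponent is at least 2.\<close>

lemma face_monomial_notin_iff:
  assumes "\<sigma> \<subseteq> F" "\<sigma> \<inter> L = {}" "T \<subseteq> L"
  shows "monom_of (face_monomial T \<sigma> F) \<notin> I \<longleftrightarrow> independent_set (F \<union> T) \<and> F \<inter> L = {}"
proof -
  let ?m = "face_monomial T \<sigma> F"
  have "lookup ?m v > 0 \<longleftrightarrow> v \<in> F \<union> T" for v by (simp add: lookup_face_monomial)
  then have "(\<exists>u v. adj u v \<and> lookup ?m u > 0 \<and> lookup ?m v > 0) \<longleftrightarrow>
      \<not> independent_set (F \<union> T)"
    by (auto simp: independent_set_def)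
  moreover have "(\<exists>v\<in>L. lookup ?m v \<ge> 2) \<longleftrightarrow> F \<inter> L \<noteq> {}"
  proof
    assume "\<exists>v\<in>L. lookup ?m v \<ge> 2"
    then show "F \<inter> L \<noteq> {}" by (auto simp: lookup_face_monomial split: if_splits)
  next
    assume "F \<inter> L \<noteq> {}"
    then obtain v where "v \<in> F" "v \<in> L" by blast
    moreover have "v \<notin> \<sigma>" using \<open>v \<in> L\<close> assms(2) by blast
    ultimately show "\<exists>v\<in>L. lookup ?m v \<ge> 2" by (intro bexI[of _ v]) (auto simp: lookup_face_monomial)
  qed
  ultimately show ?thesis unfolding monom_mem_iff by blast
qed

section \<open>Codimension, dimension and multiplicity from the largest faces\<close>

context
  fixes d :: nat
  assumes face_le: "\<And>F. face F \<Longrightarrow> card F \<le> d" and face_ex: "\<exists>F. face F \<and> card F = d"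
begin

lemma d_le: "d \<le> card (UNIV :: 'v set)"
  using face_ex by (metis card_mono finite_code subset_UNIV)

lemma codim_eq: "codim mpoly_ring I = enat (card (UNIV :: 'v set) - d)"
  and krull_dim_eq: "krull_dim (mpoly_ring Quot I) = enat d"
proof -
  obtain F where F: "face F" "card F = d" using face_ex by blast
  have D: "I \<subseteq> var_ideal (- F)" using F by (simp add: subset_var_ideal_iff)
  have card: "card (- F) = card (UNIV :: 'v set) - d"
    using F(2) by (simp add: Compl_eq_Diff_UNIV card_Diff_subset)
  have min: "card (- F) \<le> card C" if C: "I \<subseteq> var_ideal C" for C
  proof -
    have "card (- C) \<le> d" using C face_le by (simp add: subset_var_ideal_iff)
    moreover have "card (- C) = card (UNIV :: 'v set) - card C" by (simp add: Compl_eq_Diff_UNIV card_Diff_subset)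
    ultimately show ?thesis using card by linarith
  qed
  show "codim mpoly_ring I = enat (card (UNIV :: 'v set) - d)"
    using codim_monomial_ideal[OF monomial D min] card by simp
  show "krull_dim (mpoly_ring Quot I) = enat d"
    using krull_dim_monomial_ideal[OF monomial D min] card d_le by simp
qed

lemma polar_cover_ge:
  assumes "finite C" "vertex_cover polar_edges C"
  shows "(card (UNIV :: 'v set) - d) \<le> card C"
proof -
  let ?Z = "{v. (v, 0) \<notin> C}"
  have "face (?Z - L)" using polar_cover_subset(1)[OF assms(2)] independent_set_subset by (auto simp: face_def)
  then have "card (?Z - L) \<le> d" by (rule face_le)
  then have "(card (UNIV :: 'v set) - d) \<le> card (polar_cover ?Z)" by (simp add: card_polar_cover)
  also have "\<dots> \<le> card C" using polar_cover_subset(2)[OF assms(2)] assms(1) by (rule card_mono[rotated])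
  finally show ?thesis .
qed

text \<open>Every cover contains the \<open>polar_cover\<close> of the vertices it misses on level
  0; at minimum size the two must be equal.\<close>

lemma min_covers_eq:
  "covers_of_card polar_edges (card (UNIV :: 'v set) - d) = polar_cover ` {Z. independent_set Z \<and> card (Z - L) = d}"
  and min_cover_number_polar: "min_cover_number polar_edges (card (UNIV :: 'v set) - d)"
proof -
  have fin: "finite (polar_cover Z)" for Z by (simp add: polar_cover_def)
  have sub: "polar_cover Z \<in> covers_of_card polar_edges (card (UNIV :: 'v set) - d)"
    if Z: "independent_set Z" "card (Z - L) = d" for Z
  proof -
    let ?C = "polar_cover Z \<inter> \<Union>polar_edges"
    have cov: "vertex_cover polar_edges ?C"
      using vertex_cover_polar_cover[OF Z(1)] by (auto simp: vertex_cover_def)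
    have "card (polar_cover Z) = (card (UNIV :: 'v set) - d)" using Z(2) by (simp add: card_polar_cover)
    moreover have "(card (UNIV :: 'v set) - d) \<le> card ?C" using fin cov by (intro polar_cover_ge) auto
    ultimately have "?C = polar_cover Z" using fin[of Z] by (intro card_seteq) auto
    then show ?thesis using cov \<open>card (polar_cover Z) = (card (UNIV :: 'v set) - d)\<close> by (auto simp: covers_of_card_def)
  qed
  have sup: "C \<in> polar_cover ` {Z. independent_set Z \<and> card (Z - L) = d}"
    if C: "C \<in> covers_of_card polar_edges (card (UNIV :: 'v set) - d)" for C
  proof -
    note D = covers_of_cardD[OF edge_set_polar C]
    let ?Z = "{v. (v, 0) \<notin> C}"
    note Z = polar_cover_subset[OF D(5)]
    have "(card (UNIV :: 'v set) - d) \<le> card (polar_cover ?Z)" using fin vertex_cover_polar_cover[OF Z(1)] by (intro polar_cover_ge)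
    then have eq: "polar_cover ?Z = C" using Z(2) D(1,3) by (intro card_seteq) auto
    have "card (?Z - L) \<le> card (UNIV :: 'v set)" by (intro card_mono) auto
    then have "card (?Z - L) = d" using eq D(3) d_le card_polar_cover[of ?Z] by simp
    then show ?thesis using eq Z(1) by blast
  qed
  show eq: "covers_of_card polar_edges (card (UNIV :: 'v set) - d) = polar_cover ` {Z. independent_set Z \<and> card (Z - L) = d}"
    using sub sup by blast
  obtain F where F: "face F" "card F = d" using face_ex by blast
  then have "F - L = F" by (auto simp: face_def)
  then have "covers_of_card polar_edges (card (UNIV :: 'v set) - d) \<noteq> {}" using F sub[of F] by (auto simp: face_def)
  then show "min_cover_number polar_edges (card (UNIV :: 'v set) - d)"
    using polar_cover_ge by (simp add: min_cover_number_def)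
qed

lemma multiplicity_eq_covers:
  "multiplicity_quot I = of_nat (card (covers_of_card polar_edges (card (UNIV :: 'v set) - d)))"
proof -
  obtain F where F: "face F" "card F = d" using face_ex by blast
  then have "F - L = F" by (auto simp: face_def)
  have "multiplicity_quot I = of_nat (card {Z. independent_set Z \<and> card (Z - L) = d})"
  proof (rule multiplicity_eq_card[OF krull_dim_eq])
    show "card (Z - L) \<le> d" if "independent_set Z" for Z
      using that independent_set_subset[of Z "Z - L"] by (intro face_le) (auto simp: face_def)
    show "independent_set F" "card (F - L) = d" using F \<open>F - L = F\<close> by (auto simp: face_def)
  qed
  also have "card {Z. independent_set Z \<and> card (Z - L) = d} = card (covers_of_card polar_edges (card (UNIV :: 'v set) - d))"
    unfolding min_covers_eq using inj_polar_cover by (intro card_image[symmetric]) (auto simp: inj_on_def)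
  finally show ?thesis .
qed

section \<open>The Cohen-Macaulay case: purity and connectedness\<close>

context
  assumes cm: "cohen_macaulay_quot I"
begin

lemma vanishes: "s < d \<Longrightarrow> koszul_vanishes I s"
  using cohen_macaulay_koszul_vanishes[OF monomial_ideal_ideal[OF monomial] cm krull_dim_eq] .

text \<open>Translates \<open>reisner_criterion\<close> to faces: a set \<open>T\<close> of looped
  variables restricts the complex to the faces that stay independent after adding
  \<open>T\<close>.\<close>

lemma reisner:
  assumes "\<sigma> \<inter> L = {}" "T \<subseteq> L" "s < d"
    and "\<And>G. \<sigma> \<subseteq> G \<Longrightarrow> card G = Suc s \<Longrightarrow> face G \<Longrightarrow> independent_set (G \<union> T) \<Longrightarrow>
      (\<Sum>v\<in>G - \<sigma>. koszul_sign v (G - {v}) * \<phi> (G - {v})) = (0 :: 'k)"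
  shows "\<exists>\<chi>. \<forall>F. \<sigma> \<subseteq> F \<longrightarrow> card F = s \<longrightarrow> face F \<longrightarrow> independent_set (F \<union> T) \<longrightarrow>
      \<phi> F = (\<Sum>v\<in>F - \<sigma>. koszul_sign v (F - {v}) * \<chi> (F - {v}))"
proof -
  have iff: "monom_of (face_monomial T \<sigma> F) \<notin> I \<longleftrightarrow> face F \<and> independent_set (F \<union> T)" if "\<sigma> \<subseteq> F" for F
    using face_monomial_notin_iff[OF that assms(1,2)] independent_set_subset[of "F \<union> T" F] by (auto simp: face_def)
  have \<beta>: "lookup (squarefree_monomial T) v = 0" if "v \<in> \<sigma>" for v
    using that assms(1,2) by (auto simp: lookup_squarefree_monomial)
  have "\<exists>\<chi>. \<forall>F. \<sigma> \<subseteq> F \<longrightarrow> card F = s \<longrightarrow> monom_of (face_monomial T \<sigma> F) \<notin> I \<longrightarrow>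
      \<phi> F = (\<Sum>v\<in>F - \<sigma>. koszul_sign v (F - {v}) * \<chi> (F - {v}))"
    unfolding face_monomial_def
  proof (rule reisner_criterion[OF monomial vanishes[OF assms(3)] \<beta>])
    fix G assume G: "\<sigma> \<subseteq> G" "card G = Suc s"
      "monom_of (squarefree_monomial T + (\<Sum>v\<in>G. single v (if v \<in> \<sigma> then 1 else 2))) \<notin> I"
    then show "(\<Sum>v\<in>G - \<sigma>. koszul_sign v (G - {v}) * \<phi> (G - {v})) = 0"
      using iff[OF G(1)] by (intro assms(4)) (auto simp: face_monomial_def)
  qed
  then show ?thesis using iff by blast
qed

text \<open>Let \<open>G\<close> be a largest admissible set above \<open>F\<close>, of size below
  \<open>d\<close>, and take \<open>\<sigma> = G\<close>. No larger set is admissible, so the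
  constant 1 is a cocycle in degree \<open>card G\<close>; but a coboundary has an empty sum at
  \<open>G\<close> and vanishes there.\<close>

lemma purity:
  assumes "face F" "T \<subseteq> L" "independent_set (F \<union> T)"
  shows "\<exists>G. F \<subseteq> G \<and> face G \<and> independent_set (G \<union> T) \<and> card G = d"
proof -
  define P where "P G \<longleftrightarrow> F \<subseteq> G \<and> face G \<and> independent_set (G \<union> T)" for G
  have "P F" using assms by (simp add: P_def)
  moreover have "card H \<le> d" if "P H" for H using face_le that by (simp add: P_def)
  ultimately obtain G where "P G" and max: "\<forall>H. P H \<longrightarrow> card H \<le> card G"
    using ex_maximizer[of P F card d] by blast
  then have G: "F \<subseteq> G" "face G" "independent_set (G \<union> T)" by (simp_all add: P_def)
  have "card G = d"
  proof (rule ccontr)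
    assume "card G \<noteq> d"
    then have lt: "card G < d" using face_le[OF G(2)] by simp
    have "\<exists>\<chi>. \<forall>H. G \<subseteq> H \<longrightarrow> card H = card G \<longrightarrow> face H \<longrightarrow> independent_set (H \<union> T) \<longrightarrow>
        1 = (\<Sum>v\<in>H - G. koszul_sign v (H - {v}) * \<chi> (H - {v}) :: 'k)"
    proof (rule reisner[OF _ assms(2) lt])
      show "G \<inter> L = {}" using G(2) by (simp add: face_def)
      fix H assume H: "G \<subseteq> H" "card H = Suc (card G)" "face H" "independent_set (H \<union> T)"
      have "P H" using G(1) H(1,3,4) by (auto simp: P_def)
      then have "card H \<le> card G" using max by blast
      then show "(\<Sum>v\<in>H - G. koszul_sign v (H - {v}) * 1) = (0 :: 'k)" using H(2) by simp
    qed
    then show False using G(2,3) by auto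
  qed
  then show ?thesis using G by blast
qed

text \<open>Connectedness in codimension one: otherwise the link of the intersection \<open>\<sigma>\<close> of two facets of
  different colours with \<open>\<sigma>\<close> as large as possible is disconnected, and the characteristic function
  of one colour on its vertices contradicts the criterion.\<close>

lemma connected_codim_one:
  assumes A: "\<A> \<subset> {F. face F \<and> card F = d}" "\<A> \<noteq> {}"
  shows "\<exists>F\<in>\<A>. \<exists>F'\<in>{F. face F \<and> card F = d} - \<A>. card (F' - F) \<le> 1"
proof (rule ccontr)
  let ?F = "{F. face F \<and> card F = d}"
  assume "\<not> ?thesis"
  then have far: "\<And>F F'. F \<in> \<A> \<Longrightarrow> F' \<in> ?F - \<A> \<Longrightarrow> 1 < card (F' - F)" by (meson not_le)
  define P where "P p \<longleftrightarrow> fst p \<in> \<A> \<and> snd p \<in> ?F - \<A>" for p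
  obtain F0 F0' where "F0 \<in> \<A>" "F0' \<in> ?F - \<A>" using A by blast
  then have "P (F0, F0')" by (simp add: P_def)
  moreover have "card (fst p \<inter> snd p) \<le> card (UNIV :: 'v set)" for p :: "'v set \<times> 'v set"
    by (rule card_mono) auto
  ultimately obtain p where p: "P p" "\<forall>q. P q \<longrightarrow> card (fst q \<inter> snd q) \<le> card (fst p \<inter> snd p)"
    using ex_maximizer[of P "(F0, F0')" "\<lambda>p. card (fst p \<inter> snd p)" "card (UNIV :: 'v set)"] by blast
  obtain F F' where pF: "p = (F, F')" by (cases p)
  define \<sigma> where "\<sigma> = F \<inter> F'"
  have F: "F \<in> \<A>" "face F" "card F = d" and F': "F' \<notin> \<A>" "face F'" "card F' = d"
    using p(1) A(1) unfolding pF P_def by auto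
  have max: "card (G \<inter> G') \<le> card \<sigma>" if "G \<in> \<A>" "face G'" "card G' = d" "G' \<notin> \<A>" for G G'
    using p(2)[rule_format, of "(G, G')"] that by (simp add: pF P_def \<sigma>_def)
  \<comment> \<open>A vertex of the link contained in facets of both colours would give a larger
    intersection than \<open>\<sigma>\<close>.\<close>
  have no: "\<not> (\<exists>A\<in>\<A>. insert u \<sigma> \<subseteq> A)" if u: "u \<notin> \<sigma>" "insert u \<sigma> \<subseteq> K" "face K" "card K = d" "K \<notin> \<A>" for u K
  proof
    assume "\<exists>A\<in>\<A>. insert u \<sigma> \<subseteq> A"
    then obtain A where A: "A \<in> \<A>" "insert u \<sigma> \<subseteq> A" by blast
    have "card (insert u \<sigma>) \<le> card (A \<inter> K)" using A(2) u(2) by (intro card_mono) auto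
    moreover have "card (insert u \<sigma>) = Suc (card \<sigma>)" using u(1) by simp
    ultimately show False using max[OF A(1) u(3,4,5)] by simp
  qed
  have sub: "F' - F = F' - \<sigma>" by (auto simp: \<sigma>_def)
  have "card (F' - \<sigma>) = d - card \<sigma>" using F'(3) by (subst card_Diff_subset) (auto simp: \<sigma>_def)
  \<comment> \<open>Vertices of the link sit in cohomological degree
    \<open>card \<sigma> + 1\<close>; the distance of the two facets puts this below
    \<open>d\<close>.\<close>
  moreover have "1 < card (F' - F)" using far F(1) F' by simp
  ultimately have s: "Suc (card \<sigma>) < d" unfolding sub by linarith
  have \<sigma>L: "\<sigma> \<inter> L = {}" using F(2) by (auto simp: \<sigma>_def face_def)
  \<comment> \<open>The colour of a link vertex \<open>u\<close> is the value of
    \<open>\<psi>\<close> at \<open>insert u \<sigma>\<close>. On such sets the sum in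
    \<open>\<phi>\<close> has one term and supplies the sign.\<close>
  define \<psi> where "\<psi> G = (if \<exists>A\<in>\<A>. G \<subseteq> A then 1 else 0 :: 'k)" for G
  define \<phi> where "\<phi> G = (\<Sum>u\<in>G - \<sigma>. koszul_sign u (G - {u}) * \<psi> G)" for G
  have \<phi>1: "\<phi> (insert u \<sigma>) = koszul_sign u \<sigma> * \<psi> (insert u \<sigma>)" if "u \<notin> \<sigma>" for u
  proof -
    have "insert u \<sigma> - \<sigma> = {u}" "insert u \<sigma> - {u} = \<sigma>" using that by auto
    then show ?thesis by (simp add: \<phi>_def)
  qed
  have "\<exists>\<chi>. \<forall>H. \<sigma> \<subseteq> H \<longrightarrow> card H = Suc (card \<sigma>) \<longrightarrow> face H \<longrightarrow> independent_set (H \<union> {}) \<longrightarrow>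
      \<phi> H = (\<Sum>v\<in>H - \<sigma>. koszul_sign v (H - {v}) * \<chi> (H - {v}))"
  proof (rule reisner[OF \<sigma>L _ s])
    fix H assume H: "\<sigma> \<subseteq> H" "card H = Suc (Suc (card \<sigma>))" "face H"
    have "card (H - \<sigma>) = 2" using H by (subst card_Diff_subset) auto
    then obtain u v where uv: "H - \<sigma> = {u, v}" "u \<noteq> v" by (auto simp: card_2_iff)
    have nu: "u \<notin> \<sigma>" and nv: "v \<notin> \<sigma>" and Hu: "H - {u} = insert v \<sigma>" and Hv: "H - {v} = insert u \<sigma>"
      using uv H(1) by auto
    \<comment> \<open>By purity an edge of the link lies in a facet, and the colour of that facet is
      the colour of both ends.\<close>
    obtain K where K: "H \<subseteq> K" "face K" "card K = d"
      using purity[OF H(3), of "{}"] H(3) by (auto simp: face_def)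
    have sub: "insert u \<sigma> \<subseteq> K" "insert v \<sigma> \<subseteq> K" using K(1) uv H(1) by auto
    have eq: "\<psi> (insert u \<sigma>) = \<psi> (insert v \<sigma>)"
    proof (cases "K \<in> \<A>")
      case True
      then show ?thesis using sub by (auto simp: \<psi>_def)
    next
      case False
      then show ?thesis using no[OF nu sub(1) K(2,3)] no[OF nv sub(2) K(2,3)] by (simp add: \<psi>_def)
    qed
    have "(\<Sum>w\<in>H - \<sigma>. koszul_sign w (H - {w}) * \<phi> (H - {w})) =
        koszul_sign u (insert v \<sigma>) * \<phi> (insert v \<sigma>) + koszul_sign v (insert u \<sigma>) * \<phi> (insert u \<sigma>)"
      using uv(2) by (simp add: uv(1) Hu Hv)
    also have "\<dots> = (koszul_sign v \<sigma> * koszul_sign u (insert v \<sigma>) + koszul_sign u \<sigma> * koszul_sign v (insert u \<sigma>)) * \<psi> (insert u \<sigma>)"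
      by (simp add: \<phi>1 nu nv eq algebra_simps)
    also have "\<dots> = 0" using koszul_sign_swap(1)[OF uv(2) nu nv, where ?'k = 'k] by simp
    finally show "(\<Sum>w\<in>H - \<sigma>. koszul_sign w (H - {w}) * \<phi> (H - {w})) = 0" .
  qed simp
  then obtain \<chi> where \<chi>: "\<And>H. \<sigma> \<subseteq> H \<Longrightarrow> card H = Suc (card \<sigma>) \<Longrightarrow> face H \<Longrightarrow>
      \<phi> H = (\<Sum>v\<in>H - \<sigma>. koszul_sign v (H - {v}) * \<chi> (H - {v}))"
    by (auto simp: face_def)
  \<comment> \<open>In this degree a coboundary is determined by its single value
    \<open>\<chi> \<sigma>\<close>, so both colours would have to be equal.\<close>
  have const: "\<psi> (insert u \<sigma>) = \<chi> \<sigma>" if "u \<notin> \<sigma>" "face (insert u \<sigma>)" for u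
  proof -
    have "insert u \<sigma> - \<sigma> = {u}" "insert u \<sigma> - {u} = \<sigma>" using that by auto
    then have "\<phi> (insert u \<sigma>) = koszul_sign u \<sigma> * \<chi> \<sigma>" using \<chi>[of "insert u \<sigma>"] that by auto
    then have "koszul_sign u \<sigma> * (koszul_sign u \<sigma> * \<psi> (insert u \<sigma>)) = koszul_sign u \<sigma> * (koszul_sign u \<sigma> * \<chi> \<sigma>)"
      using \<phi>1[OF that(1)] by simp
    then show ?thesis by (simp add: koszul_sign_square flip: mult.assoc)
  qed
  have "F' - \<sigma> \<noteq> {}" "F - \<sigma> \<noteq> {}"
  proof -
    have "card (F' - \<sigma>) \<noteq> 0" using \<open>1 < card (F' - F)\<close> unfolding sub by linarith
    then show "F' - \<sigma> \<noteq> {}" by (metis card.empty)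
    show "F - \<sigma> \<noteq> {}"
    proof
      assume "F - \<sigma> = {}"
      then have "F \<subseteq> F'" by (auto simp: \<sigma>_def)
      then have "F = F'" using F(3) F'(3) by (intro card_subset_eq) auto
      then show False using F(1) F'(1) by simp
    qed
  qed
  then obtain u u' where u: "u \<in> F" "u \<notin> \<sigma>" and u': "u' \<in> F'" "u' \<notin> \<sigma>" by blast
  have iu: "insert u \<sigma> \<subseteq> F" and iu': "insert u' \<sigma> \<subseteq> F'" using u u' by (auto simp: \<sigma>_def)
  have "\<exists>A\<in>\<A>. insert u \<sigma> \<subseteq> A" using iu F(1) by blast
  then have "\<psi> (insert u \<sigma>) = 1" unfolding \<psi>_def by (rule if_P)
  moreover have "\<psi> (insert u' \<sigma>) = 0"
    unfolding \<psi>_def by (rule if_not_P[OF no[OF u'(2) iu' F'(2,3,1)]])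
  ultimately show False
    using const[OF u(2) face_subset[OF F(2) iu]] const[OF u'(2) face_subset[OF F'(2) iu']] by simp
qed

text \<open>To miss \<open>(v, 0)\<close>, the independent set must contain \<open>v\<close>: purity
  extends \<open>{v}\<close> if \<open>v\<close> is not looped, and otherwise finds a facet
  compatible with \<open>T = {v}\<close>. The vertex \<open>(v, 1)\<close> is missed by any facet,
  as \<open>v\<close> is looped.\<close>

lemma ex_min_cover_avoiding:
  assumes "x \<in> \<Union>polar_edges"
  shows "\<exists>C\<in>covers_of_card polar_edges (card (UNIV :: 'v set) - d). x \<notin> C"
proof -
  consider v where "x = (v, 0)" "v \<notin> L" | v where "x = (v, 0)" "v \<in> L" | v where "x = (v, 1)" "v \<in> L"
    using assms unfolding polar_edges_eq by auto
  then have "\<exists>Z. independent_set Z \<and> card (Z - L) = d \<and> x \<notin> polar_cover Z"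
  proof cases
    case 1
    then have "face {v}" using adj_irrefl by (auto simp: face_def independent_set_def)
    then obtain G where G: "v \<in> G" "face G" "card G = d"
      using purity[of "{v}" "{}"] by (auto simp: face_def)
    then have "G - L = G" by (auto simp: face_def)
    then show ?thesis using G 1 by (intro exI[of _ G]) (auto simp: face_def mem_polar_cover)
  next
    case 2
    have "face {}" "independent_set ({} \<union> {v})" using adj_irrefl by (auto simp: face_def independent_set_def)
    then obtain G where G: "face G" "independent_set (G \<union> {v})" "card G = d"
      using purity[of "{}" "{v}"] 2 by auto
    then have "G \<union> {v} - L = G" using 2 by (auto simp: face_def)
    then show ?thesis using G 2 by (intro exI[of _ "G \<union> {v}"]) (auto simp: mem_polar_cover)
  next
    case 3
    obtain G where G: "face G" "card G = d" using face_ex by blast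
    then have "G - L = G" "v \<notin> G" using 3 by (auto simp: face_def)
    then show ?thesis using G 3 by (intro exI[of _ G]) (auto simp: face_def mem_polar_cover)
  qed
  then show ?thesis unfolding min_covers_eq by blast
qed

text \<open>Removing a looped vertex from \<open>Z\<close> exchanges one vertex of the cover, its
  level 1 copy for its level 0 copy. If no exchange crossed the cut, membership in
  \<open>\<A>\<close> would depend on \<open>Z - L\<close> alone and give a cut of the
  facets.\<close>

lemma well_covered_polar: "well_covered polar_edges (card (UNIV :: 'v set) - d)"
  unfolding well_covered_def
proof (intro conjI ballI allI impI)
  show "min_cover_number polar_edges (card (UNIV :: 'v set) - d)" by (rule min_cover_number_polar)
  show "\<exists>C\<in>covers_of_card polar_edges (card (UNIV :: 'v set) - d). x \<notin> C" if "x \<in> \<Union>polar_edges" for x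
    by (rule ex_min_cover_avoiding[OF that])
  fix \<A> assume A: "\<A> \<subset> covers_of_card polar_edges (card (UNIV :: 'v set) - d)" "\<A> \<noteq> {}"
  define M where "M = {Z. independent_set Z \<and> card (Z - L) = d}"
  define \<F> where "\<F> = {F. face F \<and> card F = d}"
  note covers = min_covers_eq[folded M_def]
  show "\<exists>C\<in>\<A>. \<exists>C'\<in>covers_of_card polar_edges (card (UNIV :: 'v set) - d) - \<A>. card (C - C') \<le> 1"
  proof (rule ccontr)
    assume "\<not> ?thesis"
    then have far: "\<not> card (polar_cover Z - polar_cover W) \<le> 1"
      if "Z \<in> M" "W \<in> M" "polar_cover Z \<in> \<A>" "polar_cover W \<notin> \<A>" for Z W
      using that unfolding covers by blast
    have step: "polar_cover Z \<in> \<A> \<longleftrightarrow> polar_cover (Z - {r}) \<in> \<A>" if Z: "Z \<in> M" and r: "r \<in> Z \<inter> L" for Z r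
    proof -
      have "Z - {r} - L = Z - L" using r by auto
      then have Z': "Z - {r} \<in> M" using Z independent_set_subset[of Z "Z - {r}"] by (auto simp: M_def)
      have "polar_cover Z - polar_cover (Z - {r}) \<subseteq> {(r, 1)}" "polar_cover (Z - {r}) - polar_cover Z \<subseteq> {(r, 0)}"
        by (auto simp: polar_cover_def)
      then have "card (polar_cover Z - polar_cover (Z - {r})) \<le> 1" "card (polar_cover (Z - {r}) - polar_cover Z) \<le> 1"
        by (auto dest!: card_mono[rotated])
      then show ?thesis using far[OF Z Z'] far[OF Z' Z] by blast
    qed
    have many: "polar_cover Z \<in> \<A> \<longleftrightarrow> polar_cover (Z - R) \<in> \<A>" if "Z \<in> M" "finite R" "R \<subseteq> Z \<inter> L" for Z R
      using that(2,3,1)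
    proof (induction R)
      case (insert r R)
      have "Z - R - L = Z - L" using insert.prems by auto
      then have "Z - R \<in> M" using insert.prems independent_set_subset[of Z "Z - R"] by (auto simp: M_def)
      moreover have "r \<in> (Z - R) \<inter> L" using insert by auto
      ultimately have "polar_cover (Z - R) \<in> \<A> \<longleftrightarrow> polar_cover (Z - R - {r}) \<in> \<A>" by (rule step)
      moreover have "Z - R - {r} = Z - insert r R" by auto
      ultimately show ?case using insert by auto
    qed simp
    have red: "polar_cover Z \<in> \<A> \<longleftrightarrow> polar_cover (Z - L) \<in> \<A>" if "Z \<in> M" for Z
    proof -
      have "Z - Z \<inter> L = Z - L" by auto
      then show ?thesis using many[OF that, of "Z \<inter> L"] by simp
    qed
    have ZL: "Z - L \<in> \<F>" if "Z \<in> M" for Z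
      using that independent_set_subset[of Z "Z - L"] by (auto simp: face_def M_def \<F>_def)
    let ?A = "{F \<in> \<F>. polar_cover F \<in> \<A>}"
    obtain C where C: "C \<in> \<A>" using A(2) by blast
    then have "C \<in> polar_cover ` M" using A(1) unfolding covers by (rule psubsetD[rotated])
    then obtain Z where "Z \<in> M" "polar_cover Z \<in> \<A>" using C by blast
    then have "Z - L \<in> ?A" using red ZL by blast
    then have ne: "?A \<noteq> {}" by blast
    obtain C' where "C' \<in> polar_cover ` M" "C' \<notin> \<A>" using A(1) unfolding covers by blast
    then obtain W where "W \<in> M" "polar_cover W \<notin> \<A>" by blast
    then have "W - L \<in> \<F> - ?A" using red ZL by blast
    then have "?A \<subset> \<F>" by blast
    from connected_codim_one[folded \<F>_def, OF this ne] obtain F F' where F: "F \<in> ?A" "F' \<in> \<F> - ?A" "card (F' - F) \<le> 1" by blast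
    have noL: "G \<in> M" if "G \<in> \<F>" for G
    proof -
      have "G - L = G" using that by (auto simp: face_def \<F>_def)
      then show ?thesis using that by (auto simp: face_def \<F>_def M_def)
    qed
    \<comment> \<open>Covers are complements on level 0, so differences are reversed; hence the
      bound on \<open>F' - F\<close> is the one wanted.\<close>
    have "polar_cover F - polar_cover F' \<subseteq> (\<lambda>v. (v, 0)) ` (F' - F)"
      using F(1) by (auto simp: polar_cover_def face_def \<F>_def)
    then have "card (polar_cover F - polar_cover F') \<le> card ((\<lambda>v. (v, 0 :: nat)) ` (F' - F))" by (intro card_mono) auto
    also have "\<dots> \<le> card (F' - F)" by (rule card_image_le) simp
    finally have "card (polar_cover F - polar_cover F') \<le> 1" using F(3) by simp
    then show False using far[of F F'] F noL by blast
  qed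
qed

end

end

end

theorem (in quadratic_ideal) taylor_bounds:
  assumes "codim mpoly_ring I = enat c"
  shows "multiplicity_quot I \<le> 1 / fact c * (\<Prod>i=1..c. of_nat (taylor_max_shift I i))
    \<and> (cohen_macaulay_quot I \<longrightarrow>
        multiplicity_quot I \<ge> 1 / fact c * (\<Prod>i=1..c. of_nat (taylor_min_shift I i)))"
proof -
  have "face {}" by (simp add: face_def independent_set_def)
  moreover have "\<And>F. face F \<Longrightarrow> card F \<le> card (UNIV :: 'v set)" by (simp add: card_mono)
  ultimately obtain F where F: "face F" "\<forall>G. face G \<longrightarrow> card G \<le> card F"
    using ex_maximizer[of face "{}" card] by blast
  have le: "\<And>G. face G \<Longrightarrow> card G \<le> card F" and ex: "\<exists>G. face G \<and> card G = card F"
    using F by blast+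
  have c: "c = card (UNIV :: 'v set) - card F" using codim_eq[OF le ex] assms by simp
  let ?N = "card (covers_of_card polar_edges c)"
  have mult: "multiplicity_quot I = of_nat ?N" unfolding c by (rule multiplicity_eq_covers[OF le ex])
  note shifts = taylor_shift_spans[OF finite_GEN]
  have pos: "(fact c :: rat) > 0" by simp
  have "?N * fact c \<le> (\<Prod>i=1..c. max_span polar_edges i)"
    using polar_cover_ge[OF le ex] c by (intro card_min_covers_le edge_set_polar) auto
  then have "of_nat (?N * fact c) \<le> (of_nat (\<Prod>i=1..c. max_span polar_edges i) :: rat)"
    by (simp only: of_nat_le_iff)
  then have upper: "of_nat ?N * fact c \<le> (\<Prod>i=1..c. of_nat (taylor_max_shift I i) :: rat)"
    by (simp add: shifts)
  have lower: "(\<Prod>i=1..c. of_nat (taylor_min_shift I i) :: rat) \<le> of_nat ?N * fact c" if "cohen_macaulay_quot I"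
  proof -
    have "(\<Prod>i=1..c. min_span polar_edges i) \<le> ?N * fact c"
      using well_covered_polar[OF le ex that] unfolding c by (intro card_min_covers_ge edge_set_polar)
    then have "of_nat (\<Prod>i=1..c. min_span polar_edges i) \<le> (of_nat (?N * fact c) :: rat)"
      by (simp only: of_nat_le_iff)
    then show ?thesis by (simp add: shifts)
  qed
  show ?thesis using upper lower pos by (auto simp: mult field_simps)
qed


theorem theorem6p1:
  fixes I :: "('v::finite, 'k::field) mpoly set" and c :: nat
  assumes "quadratic_monomial_ideal I"
    and "codim mpoly_ring I = enat c"
  shows "multiplicity_quot I \<le> 1 / fact c * (\<Prod>i=1..c. of_nat (taylor_max_shift I i))
    \<and> (cohen_macaulay_quot I \<longrightarrow>
        multiplicity_quot I \<ge> 1 / fact c * (\<Prod>i=1..c. of_nat (taylor_min_shift I i)))"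
  by (rule quadratic_ideal.taylor_bounds[OF quadratic_ideal_of[OF assms(1)] assms(2)])

end
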